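(* For each integer $k \geq 3$ there exists $n_0 \in \mathbb{N}$ for which the following holds. Let $H$ be a $k$-partite $k$-graph with vertex classes $V_1, \dots, V_k$ each of size $n \geq n_0$, and let $a_1, \dots, a_k$ be non-negative integers such that $\delta_{[k]\setminus \{i\}}(H) \geq a_i$ for each $i \in [k]$. Then $$\nu(H)\geq \min\Big\{n-1, \sum_{i=1}^k a_i\Big\}.$$
   Context: $[k]=\{1,\dots,k\}$. A $k$-graph (i.e. $k$-uniform hypergraph) $H$ consists of a finite vertex set $V(H)$ and an edge set $E(H)$, each edge being a set of $k$ vertices. It is $k$-partite with vertex classes $V_1,\dots,V_k$ if $V(H)$ is the disjoint union of $V_1,\dots,V_k$ and every edge has precisely one vertex in each $V_i$. A set of vertices is crossing if it has at most one vertex in each vertex class, and it avoids $V_i$ if it is disjoint from $V_i$. A crossing $(k-1)$-tuple is a crossing set of $k-1$ vertices. For a crossing $(k-1)$-tuple $S$, $\deg(S)$ is the number of edges $e\in E(H)$ with $S\subseteq e$. For $i\in[k]$, $\delta_{[k]\setminus\{i\}}(H)$ is the minimum of $\deg(S)$ over all crossing $(k-1)$-tuples $S$ which avoid $V_i$. A matching in $H$ is a set of pairwise-disjoint edges, and $\nu(H)$ is the size of a largest matching in $H$. *)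

theory Defs
  imports Complex_Main "HOL-Library.Disjoint_Sets"
begin

record 'v hypergraph =
  verts :: "'v set"
  edges :: "'v set set"

definition uniform_hypergraph :: "nat \<Rightarrow> 'v hypergraph \<Rightarrow> bool" where
  "uniform_hypergraph k H \<longleftrightarrow>
     finite (verts H) \<and> (\<forall>e\<in>edges H. e \<subseteq> verts H \<and> card e = k)"

text \<open>The vertex classes are \<open>V 1, \<dots>, V k\<close>; the values of \<open>V\<close> outside \<open>{1..k}\<close> are irrelevant.\<close>

definition partite :: "nat \<Rightarrow> 'v hypergraph \<Rightarrow> (nat \<Rightarrow> 'v set) \<Rightarrow> bool" where
  "partite k H V \<longleftrightarrow>
     verts H = (\<Union>i\<in>{1..k}. V i) \<and>
     disjoint_family_on V {1..k} \<and>
     (\<forall>e\<in>edges H. \<forall>i\<in>{1..k}. card (e \<inter> V i) = 1)"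

definition crossing :: "nat \<Rightarrow> 'v hypergraph \<Rightarrow> (nat \<Rightarrow> 'v set) \<Rightarrow> 'v set \<Rightarrow> bool" where
  "crossing k H V S \<longleftrightarrow> S \<subseteq> verts H \<and> (\<forall>i\<in>{1..k}. card (S \<inter> V i) \<le> 1)"

definition deg :: "'v hypergraph \<Rightarrow> 'v set \<Rightarrow> nat" where
  "deg H S = card {e \<in> edges H. S \<subseteq> e}"

text \<open>\<open>min_codegree k H V i\<close> is \<open>\<delta>\<close> with index \<open>[k] \<setminus> {i}\<close>. The \<open>Min\<close> is meaningful
  only if the vertex classes other than \<open>V i\<close> are nonempty, as \<open>Min {}\<close> is unspecified.\<close>

definition min_codegree :: "nat \<Rightarrow> 'v hypergraph \<Rightarrow> (nat \<Rightarrow> 'v set) \<Rightarrow> nat \<Rightarrow> nat" where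
  "min_codegree k H V i =
     Min (deg H ` {S. crossing k H V S \<and> card S = k - 1 \<and> S \<inter> V i = {}})"

definition matching :: "'v hypergraph \<Rightarrow> 'v set set \<Rightarrow> bool" where
  "matching H M \<longleftrightarrow> M \<subseteq> edges H \<and> pairwise disjnt M"

definition matching_number :: "'v hypergraph \<Rightarrow> nat" where
  "matching_number H = Max (card ` {M. matching H M})"

end

theory Submission
  imports Defs "HOL-Combinatorics.Transposition" "HOL-Library.FuncSet"
begin

text \<open>Write the vertex classes as the columns of an array with \<open>n\<close> rows. The rows that are edges form a
  matching, and swapping entries within columns trades one array for another. Shrinking the \<open>a i\<close> we
  may assume that their sum is at most \<open>n - 1\<close>; a row that is not an edge can then be repaired at column
  \<open>i\<close> using at least \<open>a i\<close> other rows, and in a maximal array these repairs are nearly disjoint over \<open>i\<close>.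
  By pigeonhole there is a scale \<open>h\<close>, a constant fraction of \<open>n\<close>, such that each \<open>a i\<close> is either less
  than \<open>h\<close> or much larger than \<open>h\<close>. If one \<open>a i\<close> is large, a small set of exceptional vertices
  is covered first and the remaining vertices of the class are matched by swaps. If two are large, stability
  of a maximal array either forces the configuration of \<open>no_aug_bound\<close> or allows a three-way
  rotation. If at least three are large, a set of absorbing pairs of edges is reserved; it
  absorbs a bounded number of rows that are not edges, while a larger number of them forces all edge rows
  but a few into a rigid structure that again yields the configuration of \<open>no_aug_bound\<close>.\<close>

section \<open>Arrays and augmentations\<close>

text \<open>Two hole rows never hit one edge row of a maximal array at different columns, but a
  single hole row may hit it at several. Adding up the repairs over all columns therefore wants a
  hole row of its own for every column; mixing the entries of \<open>card K - 1\<close> hole rows is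
  enough for that. Since the target is at most \<open>n - 1\<close>, an array that misses it still
  has two holes, so the obstacle is an array with at least two but only few holes. The way out in
  \<open>no_aug_bound\<close> is to simulate further hole rows: each of two genuine holes can be
  transported to any of \<open>card K\<close> prepared places, and the row found there does not
  depend on which of the two was moved. Any two places can thus be occupied at the same time, and
  pairwise conflicts are all that the count uses. The threshold of three large codegrees for
  absorbers has a concrete origin as well: of the five conditions on an absorbing pair, the last one
  needs a column that the others have left free.\<close>

locale kpartite_system =
  fixes K :: "'i set" and n :: nat and V :: "'i \<Rightarrow> 'v set"
    and ed :: "('i \<Rightarrow> 'v) \<Rightarrow> bool" and a :: "'i \<Rightarrow> nat"
  assumes finite_K: "finite K"
    and card_V: "\<And>p. p \<in> K \<Longrightarrow> finite (V p) \<and> card (V p) = n"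
    and ed_cong: "\<And>x y. (\<And>p. p \<in> K \<Longrightarrow> x p = y p) \<Longrightarrow> ed x = ed y"
    and codegree: "\<And>i x. i \<in> K \<Longrightarrow> (\<And>p. p \<in> K - {i} \<Longrightarrow> x p \<in> V p) \<Longrightarrow> a i \<le> card {v \<in> V i. ed (x(i := v))}"
begin

text \<open>Row \<open>r\<close> is the function \<open>X r\<close>, so \<open>ed\<close> applies to
  it directly. Columns outside \<open>K\<close> are unconstrained, which \<open>ed_cong\<close>
  makes harmless.\<close>

definition arr :: "(nat \<Rightarrow> 'i \<Rightarrow> 'v) \<Rightarrow> bool" where
  "arr X \<longleftrightarrow> (\<forall>p\<in>K. bij_betw (\<lambda>r. X r p) {..<n} (V p))"

definition edge_rows :: "(nat \<Rightarrow> 'i \<Rightarrow> 'v) \<Rightarrow> nat set" where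
  "edge_rows X = {r. r < n \<and> ed (X r)}"

definition holes :: "(nat \<Rightarrow> 'i \<Rightarrow> 'v) \<Rightarrow> nat set" where
  "holes X = {r. r < n \<and> \<not> ed (X r)}"

definition sw :: "'i \<Rightarrow> nat \<Rightarrow> nat \<Rightarrow> (nat \<Rightarrow> 'i \<Rightarrow> 'v) \<Rightarrow> nat \<Rightarrow> 'i \<Rightarrow> 'v" where
  "sw p r s X = X(r := (X r)(p := X s p), s := (X s)(p := X r p))"

lemma sw_apply:
  "sw p r s X t q = (if q = p then (if t = r then X s p else if t = s then X r p else X t q) else X t q)"
  by (auto simp: sw_def)

lemma sw_left [simp]: "sw p r s X r = (X r)(p := X s p)"
  and sw_right [simp]: "sw p r s X s = (X s)(p := X r p)"
  by (auto simp: sw_def)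

lemma sw_other [simp]: "t \<noteq> r \<Longrightarrow> t \<noteq> s \<Longrightarrow> sw p r s X t = X t"
  by (simp add: sw_def)

lemma finite_rows [simp]: "finite (edge_rows X)" "finite (holes X)"
  unfolding edge_rows_def holes_def by auto

lemma rows_less: "r \<in> edge_rows X \<Longrightarrow> r < n" "r \<in> holes X \<Longrightarrow> r < n"
  unfolding edge_rows_def holes_def by auto

lemma edge_rows_holes: "edge_rows X \<inter> holes X = {}" "edge_rows X \<union> holes X = {..<n}"
  unfolding edge_rows_def holes_def by auto

lemma edge_or_hole: "r < n \<Longrightarrow> r \<notin> holes X \<Longrightarrow> r \<in> edge_rows X"
  unfolding edge_rows_def holes_def by auto

lemma card_edge_rows_holes: "card (edge_rows X) + card (holes X) = n"
  using card_Un_disjoint[of "edge_rows X" "holes X"] edge_rows_holes[of X] by simp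

lemma arr_mem: "arr X \<Longrightarrow> p \<in> K \<Longrightarrow> r < n \<Longrightarrow> X r p \<in> V p"
  unfolding arr_def bij_betw_def by blast

lemma arr_inj: "arr X \<Longrightarrow> p \<in> K \<Longrightarrow> r < n \<Longrightarrow> s < n \<Longrightarrow> X r p = X s p \<Longrightarrow> r = s"
  unfolding arr_def bij_betw_def inj_on_def by blast

lemma arr_reindex:
  assumes "arr X" and "\<And>p. p \<in> K \<Longrightarrow> bij_betw (\<pi> p) {..<n} {..<n}"
  shows "arr (\<lambda>r p. X (\<pi> p r) p)"
  unfolding arr_def
proof
  fix p assume "p \<in> K"
  then have "bij_betw ((\<lambda>r. X r p) \<circ> \<pi> p) {..<n} (V p)"
    using assms bij_betw_trans unfolding arr_def by blast
  then show "bij_betw (\<lambda>r. X (\<pi> p r) p) {..<n} (V p)"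
    by (simp add: comp_def)
qed

lemma bij_betw_transpose:
  "r < n \<Longrightarrow> s < n \<Longrightarrow> bij_betw (transpose r s) {..<n} {..<n}"
  by (rule bij_betwI[where g = "transpose r s"]) (auto simp: transpose_def)

lemma arr_sw:
  assumes "arr X" "r < n" "s < n"
  shows "arr (sw p r s X)"
proof -
  have "sw p r s X = (\<lambda>t q. X ((if q = p then transpose r s else id) t) q)"
    by (auto simp: sw_def fun_eq_iff transpose_def)
  then show ?thesis
    using arr_reindex[OF assms(1), of "\<lambda>q. if q = p then transpose r s else id"] assms
      bij_betw_transpose by auto
qed

text \<open>A column lists its class without repetition, so counting the vertices that complete
  \<open>x\<close> amounts to counting the rows that supply them, edges and holes alike.\<close>

lemma card_hits:
  assumes "arr X" "i \<in> K" "\<And>p. p \<in> K - {i} \<Longrightarrow> x p \<in> V p"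
  shows "a i \<le> card {r. r < n \<and> ed (x(i := X r i))}"
proof -
  have "bij_betw (\<lambda>r. X r i) {..<n} (V i)" using assms by (auto simp: arr_def)
  then have "bij_betw (\<lambda>r. X r i) {r. r < n \<and> ed (x(i := X r i))} {v \<in> V i. ed (x(i := v))}"
    unfolding bij_betw_def by (auto simp: inj_on_def) 
  then show ?thesis using codegree[OF assms(2), of x] assms(3) bij_betw_same_card by fastforce
qed

lemma card_edge_rows_less:
  assumes "S \<subseteq> {..<n}" "\<And>r. r \<notin> S \<Longrightarrow> Y r = X r" "card (holes Y \<inter> S) < card (holes X \<inter> S)"
  shows "card (edge_rows X) < card (edge_rows Y)"
proof -
  have eq: "holes Y - S = holes X - S" using assms(2) by (auto simp: holes_def)
  have "card (holes Z) = card (holes Z \<inter> S) + card (holes Z - S)" for Z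
    using card_Un_disjoint[of "holes Z \<inter> S" "holes Z - S"]
    by (metis Diff_Diff_Int Diff_disjoint Int_Diff_disjoint Int_Diff_Un finite_Diff finite_Int finite_rows(2))
  then have "card (holes Y) < card (holes X)" using eq assms(3) by simp
  then show ?thesis using card_edge_rows_holes[of X] card_edge_rows_holes[of Y] by linarith
qed

text \<open>The bound 7 is the size of the largest exchange in \<open>no_aug_bound\<close>. The
  decrease of holes is what contradicts maximality; the bounded support and the single remaining
  hole keep repeated augmentations under control in \<open>aug_near\<close>.\<close>

definition aug :: "nat set \<Rightarrow> (nat \<Rightarrow> 'i \<Rightarrow> 'v) \<Rightarrow> (nat \<Rightarrow> 'i \<Rightarrow> 'v) \<Rightarrow> bool" where
  "aug S X Y \<longleftrightarrow> arr Y \<and> S \<subseteq> {..<n} \<and> card S \<le> 7 \<and> (\<forall>r. r \<notin> S \<longrightarrow> Y r = X r) \<and>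
     card (holes Y \<inter> S) < card (holes X \<inter> S) \<and> card (holes Y \<inter> S) \<le> 1"

lemma aug_less: "aug S X Y \<Longrightarrow> card (edge_rows X) < card (edge_rows Y)"
  unfolding aug_def using card_edge_rows_less by blast

text \<open>\<open>F\<close> holds rows that must survive every exchange, namely the reserved
  absorbers; it is empty in the arguments without absorbers. The competitors are all arrays that
  agree with \<open>X\<close> on \<open>F\<close>, not just those reached by short
  exchanges.\<close>

definition maximal :: "nat set \<Rightarrow> (nat \<Rightarrow> 'i \<Rightarrow> 'v) \<Rightarrow> bool" where
  "maximal F X \<longleftrightarrow> arr X \<and> F \<subseteq> edge_rows X \<and>
     (\<forall>Y. arr Y \<longrightarrow> (\<forall>r\<in>F. Y r = X r) \<longrightarrow> card (edge_rows Y) \<le> card (edge_rows X))"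

text \<open>An exchange that keeps \<open>F\<close> and loses no edge row ends in another maximal
  array. This is what permits chains of rotations.\<close>

lemma maximal_transfer:
  assumes "maximal F X" "arr Y" "\<And>r. r \<in> F \<Longrightarrow> Y r = X r"
    "card (edge_rows X) \<le> card (edge_rows Y)"
  shows "maximal F Y" "card (edge_rows Y) = card (edge_rows X)"
proof -
  show "card (edge_rows Y) = card (edge_rows X)"
    using assms unfolding maximal_def by (metis le_antisym)
  moreover have "F \<subseteq> edge_rows Y" using assms unfolding maximal_def edge_rows_def by auto
  ultimately show "maximal F Y" using assms unfolding maximal_def by metis
qed

lemma maximal_no_aug: "maximal F X \<Longrightarrow> S \<inter> F = {} \<Longrightarrow> \<not> aug S X Y"
  using aug_less unfolding maximal_def aug_def by (metis disjoint_iff not_le)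

lemma maximal_exists:
  assumes "arr X0" "F \<subseteq> edge_rows X0"
  shows "\<exists>X. maximal F X \<and> (\<forall>r\<in>F. X r = X0 r)"
proof -
  let ?P = "\<lambda>m. \<exists>X. arr X \<and> (\<forall>r\<in>F. X r = X0 r) \<and> card (edge_rows X) = m"
  have "?P (card (edge_rows X0))" using assms by blast
  moreover have "\<And>m. ?P m \<Longrightarrow> m \<le> n"
    using card_edge_rows_holes by (metis le_add1)
  ultimately obtain m where m: "?P m" "\<And>m'. ?P m' \<Longrightarrow> m' \<le> m"
    using Nat.ex_has_greatest_nat[of ?P _ n] by blast
  then obtain X where X: "arr X" "\<forall>r\<in>F. X r = X0 r" "card (edge_rows X) = m" by blast
  have "maximal F X" unfolding maximal_def
    using X m(2) assms(2) by (auto simp: edge_rows_def)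
  then show ?thesis using X by blast
qed

text \<open>\<open>S\<close> is a list so that its length bounds the number of rows even if some of
  them coincide. The decrease comes from two holes \<open>c\<close>, \<open>d\<close> before and at
  most the row \<open>h\<close> after.\<close>

lemma augI:
  assumes "arr Y" "set S \<subseteq> {..<n}" "length S \<le> 7" "\<And>r. r \<notin> set S \<Longrightarrow> Y r = X r"
    "c \<in> holes X \<inter> set S" "d \<in> holes X \<inter> set S" "c \<noteq> d" "holes Y \<inter> set S \<subseteq> {h}"
  shows "aug (set S) X Y"
proof -
  let ?S = "set S"
  have "card {c, d} \<le> card (holes X \<inter> ?S)" using assms by (intro card_mono) auto
  moreover have "card (holes Y \<inter> ?S) \<le> 1" using card_mono[OF _ assms(8)] by simp
  moreover have "card ?S \<le> 7" using card_length assms(3) order_trans by blast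
  ultimately show ?thesis using assms unfolding aug_def by auto
qed

lemma augI_full:
  assumes "arr Y" "set S \<subseteq> {..<n}" "length S \<le> 7" "\<And>r. r \<notin> set S \<Longrightarrow> Y r = X r"
    "c \<in> holes X \<inter> set S" "holes Y \<inter> set S = {}"
  shows "aug (set S) X Y"
proof -
  have "card (holes X \<inter> set S) \<noteq> 0" using assms(5) by auto
  moreover have "card (set S) \<le> 7" using card_length assms(3) order_trans by blast
  ultimately show ?thesis using assms unfolding aug_def by auto
qed

text \<open>A hole row hits an edge row at \<open>i\<close> if it becomes an edge after borrowing the \<open>i\<close>-th vertex of
  that row. Two hole rows hitting the same edge row at different indices turn one edge into two.\<close>

lemma aug_conflict:
  assumes "arr X" "c \<in> holes X" "d \<in> holes X" "c \<noteq> d" "e \<in> edge_rows X" "i \<noteq> j"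
    "ed ((X c)(i := X e i))" "ed ((X d)(j := X e j))"
  shows "\<exists>Y. aug {c, d, e} X Y"
proof -
  define Y where "Y = sw i c e (sw j d e X)"
  have ne: "e \<noteq> c" "e \<noteq> d" using assms edge_rows_holes by blast+
  have lt: "c < n" "d < n" "e < n" using assms rows_less by auto
  have "Y c = (X c)(i := X e i)" "Y d = (X d)(j := X e j)"
    using ne assms by (auto simp: Y_def sw_def)
  then have "holes Y \<inter> {c, d, e} \<subseteq> {e}" using assms by (auto simp: holes_def)
  moreover have "arr Y" using arr_sw assms lt by (simp add: Y_def)
  ultimately have "aug (set [c, d, e]) X Y" using assms lt
    by (intro augI[of _ _ _ c d e]) (auto simp: Y_def sw_def)
  then show ?thesis by auto
qed

lemma aug_hole:
  assumes "arr X" "c \<in> holes X" "d \<in> holes X" "c \<noteq> d" "ed ((X c)(i := X d i))"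
  shows "\<exists>Y. aug {c, d} X Y"
proof -
  have lt: "c < n" "d < n" using assms rows_less by auto
  have "holes (sw i c d X) \<inter> {c, d} \<subseteq> {d}" using assms by (auto simp: holes_def sw_def)
  then have "aug (set [c, d]) X (sw i c d X)" using assms lt arr_sw
    by (intro augI[of _ _ _ c d d]) (auto simp: sw_def)
  then show ?thesis by auto
qed

text \<open>A hole at \<open>c\<close> or at \<open>d\<close> can be moved to \<open>e j\<close>: it
  takes the \<open>\<beta>\<close>-entry of \<open>g j\<close>, and \<open>g j\<close> then takes
  the \<open>\<alpha>\<close>-entry of \<open>e j\<close>. What remains in \<open>e j\<close> is the
  row \<open>y j\<close>, the same for both starting holes. One move from each hole can be made at
  once, so any two of the rows \<open>y j\<close> act like simultaneous holes. If \<open>y j\<close>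
  is used for repairs at column \<open>j\<close> only, the sets of repairs are pairwise disjoint,
  and each has at least \<open>a j\<close> elements.\<close>

lemma no_aug_bound:
  assumes arr: "arr X" and K: "\<alpha> \<in> K" "\<beta> \<in> K" "\<alpha> \<noteq> \<beta>"
    and cd: "c \<in> holes X" "d \<in> holes X" "c \<noteq> d"
    and g: "g ` K \<subseteq> edge_rows X" "inj_on g K" and e: "e ` K \<subseteq> edge_rows X" "inj_on e K"
    and ge: "g ` K \<inter> e ` K = {}"
    and hc: "\<And>j. j \<in> K \<Longrightarrow> ed ((X c)(\<beta> := X (g j) \<beta>))"
    and hd: "\<And>j. j \<in> K \<Longrightarrow> ed ((X d)(\<beta> := X (g j) \<beta>))"
    and hgc: "\<And>j. j \<in> K \<Longrightarrow> ed ((X (g j))(\<beta> := X c \<beta>, \<alpha> := X (e j) \<alpha>))"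
    and hgd: "\<And>j. j \<in> K \<Longrightarrow> ed ((X (g j))(\<beta> := X d \<beta>, \<alpha> := X (e j) \<alpha>))"
    and hde: "\<And>j. j \<in> K \<Longrightarrow> ed ((X d)(\<alpha> := X (e j) \<alpha>))"
    and no_aug: "\<And>S Y. \<not> aug S X Y"
  shows "sum a K \<le> card (edge_rows X)"
proof -
  define y where "y j = (X (e j))(\<alpha> := X (g j) \<alpha>)" for j
  define hit where "hit j r \<longleftrightarrow> ed ((y j)(j := X r j))" for j r
  have lt: "c < n" "d < n" "\<And>j. j \<in> K \<Longrightarrow> g j < n" "\<And>j. j \<in> K \<Longrightarrow> e j < n"
    using cd g(1) e(1) by (auto simp: holes_def edge_rows_def)
  have he: "z \<noteq> g j" "z \<noteq> e j" "g j \<noteq> z" "e j \<noteq> z" if "z \<in> holes X" "j \<in> K" for z j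
    using that g(1) e(1) edge_rows_holes(1)[of X] by auto
  note cdge = he[OF cd(1)] he[OF cd(2)]
  have gej: "g i \<noteq> e j" "e j \<noteq> g i" if "i \<in> K" "j \<in> K" for i j using ge that by blast+
  have inj: "g i \<noteq> g j" "e i \<noteq> e j" if "i \<in> K" "j \<in> K" "i \<noteq> j" for i j
    using that g(2) e(2) by (meson inj_onD)+
  \<comment> \<open>The move of a hole from \<open>z\<close> to \<open>e j\<close>. It touches only
    \<open>z\<close>, \<open>g j\<close> and \<open>e j\<close>, so moves of different holes along
    different \<open>j\<close> do not interfere.\<close>
  define fr where "fr c j = sw \<alpha> (g j) (e j) \<circ> sw \<beta> c (g j)" for c j
  have arr_fr: "arr (fr z j Z)" if "arr Z" "z < n" "j \<in> K" for z j Z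
    using that lt by (simp add: fr_def arr_sw)
  have fr: "fr z j Z z = (Z z)(\<beta> := Z (g j) \<beta>)"
    "fr z j Z (g j) = (Z (g j))(\<beta> := Z z \<beta>, \<alpha> := Z (e j) \<alpha>)"
    "fr z j Z (e j) = (Z (e j))(\<alpha> := Z (g j) \<alpha>)"
    if "z \<in> holes X" "j \<in> K" for z j Z
    using he[OF that] gej[OF that(2,2)] K(3) by (simp_all add: fr_def fun_upd_def)
  have fr_other: "fr z j Z t = Z t" if "t \<noteq> z" "t \<noteq> g j" "t \<noteq> e j" for z j Z t
    using that by (simp add: fr_def)
  have h2: "ed ((X z)(\<beta> := X (g j) \<beta>))" "ed ((X (g j))(\<beta> := X z \<beta>, \<alpha> := X (e j) \<alpha>))"
    if "z = c \<or> z = d" "j \<in> K" for z j using that hc hd hgc hgd by auto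
  \<comment> \<open>The row \<open>r\<close> may itself be \<open>c\<close> or \<open>d\<close>; the
    move then has to start from the other one, hence the parameter \<open>z\<close>.\<close>
  have hole1: "\<not> hit j r" if "r \<in> holes X" "z = c \<or> z = d" "r \<noteq> z" "j \<in> K" for j r z
  proof
    assume h: "hit j r"
    have z: "z \<in> holes X" using that cd by blast
    define Y where "Y = sw j (e j) r (fr z j X)"
    have ne: "z \<noteq> g j" "z \<noteq> e j" "r \<noteq> g j" "r \<noteq> e j" "g j \<noteq> e j" using he[OF z] he[OF that(1)] that gej by auto
    have "Y z = (X z)(\<beta> := X (g j) \<beta>)" "Y (g j) = (X (g j))(\<beta> := X z \<beta>, \<alpha> := X (e j) \<alpha>)"
      "Y (e j) = (y j)(j := X r j)"
      using ne K that(3,4) z by (simp_all add: Y_def fr fr_other y_def fun_upd_def)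
    then have "holes Y \<inter> {z, g j, e j, r} \<subseteq> {r}"
      using h2[OF that(2,4)] h by (auto simp: hit_def holes_def)
    moreover have "arr Y" using arr_fr arr_sw arr that z lt rows_less by (simp add: Y_def)
    ultimately have "aug (set [z, g j, e j, r]) X Y"
      using z that lt rows_less by (intro augI[of _ _ _ z r r]) (auto simp: Y_def fr_other)
    then show False using no_aug by blast
  qed
  have hole: "\<not> hit j r" if "r \<in> holes X" "j \<in> K" for j r
    using hole1[OF that(1), of c] hole1[OF that(1), of d] cd that by blast
  \<comment> \<open>Both holes are moved, then \<open>r\<close> gives up two of its entries and is
    the only row that may fail. These are the seven rows of \<open>aug\<close>.\<close>
  have generic: False if "hit i r" "hit j r" "i \<noteq> j" "i \<in> K" "j \<in> K" "r \<in> edge_rows X"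
    "r \<notin> {g i, e i, g j, e j}" for i j r
  proof -
    define Y where "Y = sw i (e i) r (sw j (e j) r (fr c i (fr d j X)))"
    have ne: "r \<noteq> c" "r \<noteq> d" "r < n" using that cd by (auto simp: holes_def edge_rows_def)
    have rne: "r \<noteq> g i" "r \<noteq> e i" "r \<noteq> g j" "r \<noteq> e j" "g i \<noteq> r" "e i \<noteq> r" "g j \<noteq> r" "e j \<noteq> r"
      using that(7) by auto
    note D = ne cd(3) cdge[OF that(4)] cdge[OF that(5)] gej[OF that(4,5)] gej[OF that(5,4)] gej[OF that(4,4)] gej[OF that(5,5)]
       inj[OF that(4,5,3)] rne
    have "Y c = (X c)(\<beta> := X (g i) \<beta>)" "Y (g i) = (X (g i))(\<beta> := X c \<beta>, \<alpha> := X (e i) \<alpha>)"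
      "Y (e i) = (y i)(i := X r i)"
      "Y d = (X d)(\<beta> := X (g j) \<beta>)" "Y (g j) = (X (g j))(\<beta> := X d \<beta>, \<alpha> := X (e j) \<alpha>)"
      "Y (e j) = (y j)(j := X r j)"
      using D K that(3-5) cd(1,2) by (simp_all add: Y_def fr fr_other y_def fun_upd_def)
    then have "holes Y \<inter> {c, d, g i, e i, g j, e j, r} \<subseteq> {r}"
      using h2[of c i] h2[of d j] that by (auto simp: hit_def holes_def)
    moreover have "arr Y" using arr_fr arr_sw arr that lt ne by (simp add: Y_def)
    ultimately have "aug (set [c, d, g i, e i, g j, e j, r]) X Y"
      using cd that lt ne by (intro augI[of _ _ _ c d r]) (auto simp: Y_def fr_other)
    then show False using no_aug by blast
  qed
  have own: "\<not> ed (y j)" if "j \<in> K" for j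
  proof
    assume h: "ed (y j)"
    define Y where "Y = fr c j X"
    have "Y c = (X c)(\<beta> := X (g j) \<beta>)" "Y (g j) = (X (g j))(\<beta> := X c \<beta>, \<alpha> := X (e j) \<alpha>)" "Y (e j) = y j"
      using cdge[OF that] gej[OF that that] K cd that by (simp_all add: Y_def fr fr_other y_def fun_upd_def)
    then have "holes Y \<inter> {c, g j, e j} = {}"
      using h2[of c j] that h by (auto simp: holes_def)
    moreover have "arr Y" using arr_fr arr that lt by (simp add: Y_def)
    ultimately have "aug (set [c, g j, e j]) X Y"
      using cd that lt by (intro augI_full[of _ _ _ c]) (auto simp: Y_def fr_other)
    then show False using no_aug by blast
  qed
  \<comment> \<open>Once the second hole has been moved, \<open>e l\<close> carries
    \<open>y l\<close> as a hole row, so this is \<open>aug_hole\<close> for moved holes.\<close>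
  have other: "\<not> ed ((y j)(j := y l j))" if "j \<in> K" "l \<in> K" "j \<noteq> l" for j l
  proof
    assume h: "ed ((y j)(j := y l j))"
    define Y where "Y = sw j (e j) (e l) (fr c j (fr d l X))"
    note D = cd(3) cdge[OF that(1)] cdge[OF that(2)] gej[OF that(1,2)] gej[OF that(2,1)] gej[OF that(1,1)] gej[OF that(2,2)]
       inj[OF that]
    have "Y c = (X c)(\<beta> := X (g j) \<beta>)" "Y (g j) = (X (g j))(\<beta> := X c \<beta>, \<alpha> := X (e j) \<alpha>)"
      "Y (e j) = (y j)(j := y l j)"
      "Y d = (X d)(\<beta> := X (g l) \<beta>)" "Y (g l) = (X (g l))(\<beta> := X d \<beta>, \<alpha> := X (e l) \<alpha>)"
      using D K cd that by (simp_all add: Y_def fr fr_other y_def fun_upd_def)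
    then have "holes Y \<inter> {c, d, g j, e j, g l, e l} \<subseteq> {e l}"
      using h2[of c j] h2[of d l] that h by (auto simp: holes_def)
    moreover have "arr Y" using arr_fr arr_sw arr that lt by (simp add: Y_def)
    ultimately have "aug (set [c, d, g j, e j, g l, e l]) X Y"
      using cd that lt by (intro augI[of _ _ _ c d "e l"]) (auto simp: Y_def fr_other)
    then show False using no_aug by blast
  qed
  \<comment> \<open>Away from column \<open>\<alpha>\<close> the rows \<open>e l\<close> and
    \<open>y l\<close> agree, so such a hit would be a hit on a moved hole.\<close>
  have e_row: "j = \<alpha>" if "hit j (e l)" "j \<in> K" "l \<in> K" for j l
  proof (rule ccontr)
    assume "j \<noteq> \<alpha>"
    then have "X (e l) j = y l j" by (simp add: y_def)
    then have "hit j (e l) \<longleftrightarrow> ed ((y j)(j := y l j))" by (simp add: hit_def)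
    then show False using that own[of j] other[of j l] by (cases "j = l") auto
  qed
  \<comment> \<open>Rows that take part in a move are not covered by \<open>generic\<close>. Here
    and in \<open>e_row\<close> each of them is left with a single possible column, which is enough
    for \<open>unique\<close>.\<close>
  have g_row: "j = \<beta>" if h: "hit j (g l)" and jl: "j \<in> K" "l \<in> K" for j l
  proof (rule ccontr)
    assume jb: "j \<noteq> \<beta>"
    have ja: "j \<noteq> \<alpha>"
    proof
      assume "j = \<alpha>"
      then have "ed ((y j)(j := y l j))" using h by (simp add: hit_def y_def)
      then show False using jl own[of j] other[of j l] by (cases "j = l") auto
    qed
    show False
    proof (cases "j = l")
      case True
      \<comment> \<open>Both holes are filled directly, \<open>c\<close> from \<open>g j\<close> and
        \<open>d\<close> from \<open>e j\<close> by \<open>hde\<close>; the row left over is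
        \<open>g j\<close>.\<close>
      define Y where "Y = sw \<alpha> d (g j) (sw \<beta> c (g j) (sw \<alpha> (e j) (g j) (sw j (e j) (g j) X)))"
      have "Y c = (X c)(\<beta> := X (g j) \<beta>)" "Y d = (X d)(\<alpha> := X (e j) \<alpha>)" "Y (e j) = (y j)(j := X (g j) j)"
        using cdge[OF jl(1)] gej[OF jl(1) jl(1)] K(3) ja jb cd(3)
        by (auto simp: Y_def y_def fun_upd_def intro!: ext)
      then have "holes Y \<inter> {c, d, g j, e j} \<subseteq> {g j}"
        using hc hde h jl True by (auto simp: holes_def hit_def)
      moreover have "arr Y" using arr_sw arr jl lt by (simp add: Y_def)
      ultimately have "aug (set [c, d, g j, e j]) X Y"
        using cd jl lt by (intro augI[of _ _ _ c d "g j"]) (auto simp: Y_def fr_other)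
      then show False using no_aug by blast
    next
      case False
      define Y where "Y = sw j (e j) (g l) (sw \<beta> d (g l) (fr c j X))"
      note D = cd(3) cdge[OF jl(1)] cdge[OF jl(2)] gej[OF jl] gej[OF jl(2,1)] gej[OF jl(1,1)] gej[OF jl(2,2)]
         inj[OF jl False]
      have "Y c = (X c)(\<beta> := X (g j) \<beta>)" "Y (g j) = (X (g j))(\<beta> := X c \<beta>, \<alpha> := X (e j) \<alpha>)"
        "Y (e j) = (y j)(j := X (g l) j)" "Y d = (X d)(\<beta> := X (g l) \<beta>)"
        using D K ja jb cd jl by (simp_all add: Y_def fr fr_other y_def fun_upd_def)
      then have "holes Y \<inter> {c, d, g j, e j, g l} \<subseteq> {g l}"
        using h2[of c j] h2[of d l] jl h by (auto simp: hit_def holes_def)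
      moreover have "arr Y" using arr_fr arr_sw arr jl lt by (simp add: Y_def)
      ultimately have "aug (set [c, d, g j, e j, g l]) X Y"
        using cd jl lt by (intro augI[of _ _ _ c d "g l"]) (auto simp: Y_def fr_other)
      then show False using no_aug by blast
    qed
  qed
  have unique: "i = j" if h: "hit i r" "hit j r" and ij: "i \<in> K" "j \<in> K" and r: "r \<in> edge_rows X" for i j r
  proof (cases "\<exists>l\<in>K. r = g l \<or> r = e l")
    case True
    then show ?thesis using h ij g_row e_row by blast
  next
    case False
    then show ?thesis using generic[of i r j] h ij r by blast
  qed
  define A where "A j = {r. r < n \<and> hit j r}" for j
  have fin: "finite (A j)" for j by (simp add: A_def)
  have "sum a K \<le> (\<Sum>j\<in>K. card (A j))"
  proof (rule sum_mono)
    fix j assume j: "j \<in> K"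
    have "y j p \<in> V p" if "p \<in> K" for p
      using that arr_mem[OF arr that] lt j by (auto simp: y_def)
    then show "a j \<le> card (A j)"
      unfolding A_def hit_def using card_hits[OF arr j, of "y j"] by blast
  qed
  also have "\<dots> = card (\<Union>j\<in>K. A j)"
  proof (rule card_UN_disjoint[symmetric])
    show "\<forall>i\<in>K. \<forall>j\<in>K. i \<noteq> j \<longrightarrow> A i \<inter> A j = {}"
    proof (intro ballI impI)
      fix i j assume ij: "i \<in> K" "j \<in> K" "i \<noteq> j"
      have "r \<in> edge_rows X" if "r < n" "hit i r" for r
        using that hole ij edge_or_hole by blast
      then show "A i \<inter> A j = {}" using ij unique unfolding A_def by blast
    qed
  qed (use fin finite_K in auto)
  also have "\<dots> \<le> card (edge_rows X)"
    using hole by (intro card_mono) (auto simp: A_def intro: edge_or_hole)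
  finally show ?thesis .
qed

end

section \<open>Two large codegrees\<close>

text \<open>Every set is at least as large as the index set, so a greedy choice never gets
  blocked.\<close>

lemma distinct_representatives:
  assumes "finite K" "\<And>j. j \<in> K \<Longrightarrow> finite (S j) \<and> card K \<le> card (S j)"
  shows "\<exists>e. inj_on e K \<and> (\<forall>j\<in>K. e j \<in> S j)"
  using assms
proof (induction K rule: finite_induct)
  case (insert x K)
  have "finite (S j) \<and> card K \<le> card (S j)" if "j \<in> K" for j
    using insert.prems[of j] insert.hyps that by auto
  then obtain e where e: "inj_on e K" "\<forall>j\<in>K. e j \<in> S j" using insert.IH by blast
  have "card (e ` K) < card (S x)"
    using insert.prems[of x] insert.hyps card_image_le[of K e] by simp
  then obtain y where "y \<in> S x" "y \<notin> e ` K"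
    using insert.hyps by (metis card_mono finite_imageI not_less subsetI)
  then show ?case using e insert.hyps
    by (intro exI[of _ "e(x := y)"]) (auto simp: inj_on_def)
qed auto

lemma double_count:
  assumes "finite A" "finite B" "\<And>x. x \<in> A \<Longrightarrow> u \<le> card {y \<in> B. R x y}"
    "\<And>y. y \<in> B \<Longrightarrow> card {x \<in> A. R x y} \<le> v"
  shows "card A * u \<le> card B * v"
proof -
  have "card A * u \<le> (\<Sum>x\<in>A. card {y \<in> B. R x y})"
    using sum_bounded_below[of A u] assms(3) by simp
  also have "\<dots> = (\<Sum>y\<in>B. card {x \<in> A. R x y})"
    by (rule sum_multicount_gen[OF assms(1,2)]) simp
  also have "\<dots> \<le> card B * v"
    using sum_bounded_above[of B _ v] assms(4) by simp
  finally show ?thesis .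
qed

section \<open>Hits of a hole row, and rotations of holes\<close>

context kpartite_system
begin

definition Hit :: "(nat \<Rightarrow> 'i \<Rightarrow> 'v) \<Rightarrow> nat \<Rightarrow> 'i \<Rightarrow> nat set" where
  "Hit X c i = {r \<in> edge_rows X. ed ((X c)(i := X r i))}"

lemma Hit_subset: "Hit X c i \<subseteq> edge_rows X" and finite_Hit [simp]: "finite (Hit X c i)"
  unfolding Hit_def by auto

lemma Hit_edge: "r \<in> Hit X c i \<Longrightarrow> r \<in> edge_rows X"
  unfolding Hit_def by simp

text \<open>None of the rows supplied by \<open>card_hits\<close> is a hole: \<open>c\<close> would
  already be an edge, and any other hole would give an augmentation.\<close>

lemma card_Hit:
  assumes "arr X" "c \<in> holes X" "i \<in> K" "\<And>d Y. d \<in> holes X \<Longrightarrow> d \<noteq> c \<Longrightarrow> \<not> aug {c, d} X Y"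
  shows "a i \<le> card (Hit X c i)"
proof -
  have "X c p \<in> V p" if "p \<in> K - {i}" for p
    using that assms arr_mem rows_less by blast
  then have "a i \<le> card {r. r < n \<and> ed ((X c)(i := X r i))}"
    using card_hits[OF assms(1,3), of "X c"] by blast
  moreover have "\<not> ed ((X c)(i := X r i))" if "r \<in> holes X" for r
  proof (cases "r = c")
    case True
    then show ?thesis using that by (simp add: holes_def)
  next
    case False
    then show ?thesis using aug_hole[OF assms(1,2) that] assms(4) that by blast
  qed
  then have "{r. r < n \<and> ed ((X c)(i := X r i))} = Hit X c i"
    unfolding Hit_def using edge_or_hole rows_less(1) by blast
  ultimately show ?thesis by simp
qed

lemma maximal_holes_disjoint: "maximal F X \<Longrightarrow> c \<in> holes X \<Longrightarrow> c \<notin> F"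
  unfolding maximal_def holes_def edge_rows_def by auto

lemma card_Hit_maximal:
  assumes "maximal F X" "c \<in> holes X" "i \<in> K"
  shows "a i \<le> card (Hit X c i)"
proof (rule card_Hit[OF _ assms(2,3)])
  fix d Y assume "d \<in> holes X"
  then have "{c, d} \<inter> F = {}" using maximal_holes_disjoint assms by blast
  then show "\<not> aug {c, d} X Y" using maximal_no_aug assms(1) by blast
qed (use assms maximal_def in blast)

text \<open>By \<open>aug_conflict\<close>. Rows of \<open>F\<close> are excepted because a reserved
  row must not be broken up.\<close>

lemma Hit_disjoint:
  assumes "maximal F X" "c \<in> holes X" "d \<in> holes X" "c \<noteq> d" "i \<noteq> j"
  shows "Hit X c i \<inter> Hit X d j \<subseteq> F"
proof
  fix e assume e: "e \<in> Hit X c i \<inter> Hit X d j"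
  then obtain Y where Y: "aug {c, d, e} X Y"
    using aug_conflict[of X c d e i j] assms unfolding Hit_def maximal_def by blast
  then have "{c, d, e} \<inter> F \<noteq> {}" using maximal_no_aug assms(1) by blast
  then show "e \<in> F" using maximal_holes_disjoint assms by blast
qed

text \<open>The swap makes \<open>c\<close> an edge, and by maximality \<open>e\<close> must then
  become a hole: the hole has moved while the array stays maximal. Bounds on hits in the rotated
  array give new information about the original one.\<close>

lemma rotate:
  assumes "maximal F X" "c \<in> holes X" "e \<in> Hit X c i" "e \<notin> F"
  shows "maximal F (sw i c e X)" "holes (sw i c e X) = insert e (holes X - {c})"
    "edge_rows (sw i c e X) = insert c (edge_rows X - {e})"
proof -
  let ?Y = "sw i c e X"
  have e: "e \<in> edge_rows X" "ed ((X c)(i := X e i))" using assms(3) by (auto simp: Hit_def)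
  have ne: "e \<noteq> c" using e assms(2) edge_rows_holes by blast
  have lt: "c < n" "e < n" using e assms(2) rows_less by auto
  have sub: "insert c (edge_rows X - {e}) \<subseteq> edge_rows ?Y"
  proof
    fix t assume "t \<in> insert c (edge_rows X - {e})"
    then show "t \<in> edge_rows ?Y" using e lt ne by (cases "t = c") (auto simp: edge_rows_def sw_def)
  qed
  have "c \<notin> edge_rows X - {e}" using assms(2) edge_rows_holes by blast
  then have c: "card (insert c (edge_rows X - {e})) = card (edge_rows X)"
    using e(1) by (metis card_Suc_Diff1 card_insert_disjoint finite_Diff finite_rows(1))
  then have le: "card (edge_rows X) \<le> card (edge_rows ?Y)"
    using card_mono[OF finite_rows(1) sub] by simp
  have F: "?Y r = X r" if "r \<in> F" for r
    using that assms(4) maximal_holes_disjoint[OF assms(1,2)] by (intro sw_other) auto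
  have "arr ?Y" using assms(1) lt by (simp add: maximal_def arr_sw)
  note m = maximal_transfer[OF assms(1) this F le]
  show "maximal F ?Y" by (rule m(1))
  show eq: "edge_rows ?Y = insert c (edge_rows X - {e})"
    using card_subset_eq[OF finite_rows(1) sub] c m(2) by simp
  have "holes Z = {..<n} - edge_rows Z" for Z using edge_rows_holes[of Z] by blast
  then show "holes ?Y = insert e (holes X - {c})" using eq lt ne e(1) edge_rows_holes[of X] by auto
qed

text \<open>Rotating \<open>c\<close> or \<open>d\<close> with \<open>g\<close> gives a hole at
  \<open>g\<close> whose hits at column \<open>i\<close> do not depend on which of the two was used,
  since exactly the entry in column \<open>i\<close> is being replaced. These hits avoid the hits at
  \<open>j\<close> of the hole that stayed; with both choices they avoid the hits of both.\<close>

lemma common_hit_bound: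
  assumes X: "maximal {} X" and cd: "c \<in> holes X" "d \<in> holes X" "c \<noteq> d"
    and i: "i \<in> K" "j \<noteq> i" and g: "g \<in> Hit X c i" "g \<in> Hit X d i"
  shows "card (Hit X c j \<union> Hit X d j) + a i \<le> card (edge_rows X)"
proof -
  define G where "G = {r \<in> edge_rows X - {g}. ed ((X g)(i := X r i))}"
  have gE: "g \<in> edge_rows X" using g Hit_subset by blast
  have main: "a i \<le> Suc (card G) \<and> G \<inter> Hit X e j = {}"
    if "z \<in> {c, d}" "e \<in> {c, d}" "z \<noteq> e" for z e
  proof -
    have z: "z \<in> holes X" "e \<in> holes X" "g \<in> Hit X z i" using that cd g by auto
    define Y where "Y = sw i z g X"
    note rot = rotate[OF X z(1,3), folded Y_def, simplified]
    have ne: "z \<noteq> g" "e \<noteq> g" using z gE edge_rows_holes by blast+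
    have hol: "g \<in> holes Y" "e \<in> holes Y" using rot(2) z that by auto
    have Yo: "Y t = X t" if "t \<noteq> z" "t \<noteq> g" for t using that by (simp add: Y_def)
    have Yg: "(Y g)(i := v) = (X g)(i := v)" for v by (simp add: Y_def)
    have "Hit Y g i \<subseteq> insert z G"
      using rot(3) Yo Yg ne by (auto simp: Hit_def G_def)
    then have "card (Hit Y g i) \<le> card (insert z G)" by (intro card_mono) (auto simp: G_def)
    also have "\<dots> \<le> Suc (card G)" by (rule card_insert_le_m1) auto
    finally have 1: "a i \<le> Suc (card G)" using card_Hit_maximal[OF rot(1) hol(1) i(1)] by linarith
    have zE: "z \<notin> edge_rows X" using z(1) edge_rows_holes by blast
    have "G \<inter> Hit X e j \<subseteq> Hit Y g i \<inter> Hit Y e j"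
    proof
      fix r assume r: "r \<in> G \<inter> Hit X e j"
      then have "r \<noteq> z" "r \<noteq> g" "r \<in> edge_rows X" using zE by (auto simp: G_def)
      moreover have "Y e = X e" using Yo that ne by auto
      ultimately show "r \<in> Hit Y g i \<inter> Hit Y e j"
        using r rot(3) Yo[of r] Yg by (auto simp: Hit_def G_def)
    qed
    then show ?thesis using 1 Hit_disjoint[OF rot(1) hol ne(2)[symmetric], of i j] i(2) by blast
  qed
  have "a i \<le> Suc (card G)" using main[of c d] cd(3) by simp
  moreover have dis: "G \<inter> (Hit X c j \<union> Hit X d j) = {}"
    using main[of c d] main[of d c] cd(3) by auto
  \<comment> \<open>The row \<open>g\<close> lies outside all three sets and pays for the possible
    hit on \<open>z\<close>, which \<open>G\<close> does not count.\<close>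
  moreover have "g \<notin> Hit X c j \<union> Hit X d j"
    using Hit_disjoint[OF X cd, of i j] Hit_disjoint[OF X cd, of j i] g i(2) by blast
  ultimately have "G \<union> (Hit X c j \<union> Hit X d j) \<subseteq> edge_rows X - {g}"
    by (auto simp: G_def dest: Hit_edge)
  then have "card (G \<union> (Hit X c j \<union> Hit X d j)) \<le> card (edge_rows X - {g})"
    by (intro card_mono) auto
  then have "card G + card (Hit X c j \<union> Hit X d j) \<le> card (edge_rows X) - 1"
    using dis gE by (subst (asm) card_Un_disjoint) (auto simp: G_def)
  moreover have "card (edge_rows X) \<ge> 1" using gE by (metis One_nat_def Suc_leI card_gt_0_iff empty_iff finite_rows(1))
  ultimately show ?thesis using \<open>a i \<le> Suc (card G)\<close> by linarith
qed

text \<open>A common hit at \<open>\<beta>\<close> forces one at \<open>\<alpha>\<close>, and this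
  in turn makes nearly all hits at \<open>\<beta>\<close> common. The pairs \<open>g j\<close>,
  \<open>e j\<close> of \<open>no_aug_bound\<close> can then be chosen greedily.\<close>

lemma two_large_common_hit:
  assumes X: "maximal {} X" and cd: "c \<in> holes X" "d \<in> holes X" "c \<noteq> d"
    and K: "\<alpha> \<in> K" "\<beta> \<in> K" "\<alpha> \<noteq> \<beta>"
    and small: "card (edge_rows X) < a \<alpha> + a \<beta> + l" "card K + 4 * l + 4 \<le> a \<alpha>" "card K + 4 * l + 4 \<le> a \<beta>"
    and g0: "g0 \<in> Hit X c \<beta> \<inter> Hit X d \<beta>"
  shows "sum a K \<le> card (edge_rows X)"
proof -
  define m where "m = card (edge_rows X)"
  define P Q A D where "P = Hit X c \<alpha>" "Q = Hit X d \<alpha>" "A = Hit X c \<beta>" "D = Hit X d \<beta>"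
  note defs = P_Q_A_D_def
  have fin: "finite P" "finite Q" "finite A" "finite D" by (simp_all add: defs)
  have ca: "a \<alpha> \<le> card P" "a \<alpha> \<le> card Q" "a \<beta> \<le> card A" "a \<beta> \<le> card D"
    unfolding defs using card_Hit_maximal[OF X] cd K by auto
  have dis: "P \<inter> D = {}" "Q \<inter> A = {}"
    unfolding defs using Hit_disjoint[OF X cd K(3)] Hit_disjoint[OF X cd(2,1) cd(3)[symmetric] K(3)] by auto
  have "card (P \<union> Q) + a \<beta> \<le> m"
    using common_hit_bound[OF X cd K(2) K(3)] g0 unfolding defs m_def by blast
  moreover have "card P + card Q = card (P \<union> Q) + card (P \<inter> Q)" using card_Un_Int fin by blast
  ultimately have "card (P \<inter> Q) \<noteq> 0" using ca small(1,2) unfolding m_def by linarith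
  then obtain e0 where "e0 \<in> P \<inter> Q" by (metis card.empty equals0I)
  then have "card (A \<union> D) + a \<alpha> \<le> m"
    using common_hit_bound[OF X cd K(1) K(3)[symmetric]] unfolding defs m_def by blast
  moreover have "card A + card D = card (A \<union> D) + card (A \<inter> D)" using card_Un_Int fin by blast
  ultimately have AD: "a \<beta> \<le> card (A \<inter> D) + l" using ca small(1) unfolding m_def by linarith
  have "finite (A \<inter> D) \<and> card K \<le> card (A \<inter> D)" using AD small(3) fin by simp
  then obtain g where g: "inj_on g K" "\<forall>j\<in>K. g j \<in> A \<inter> D"
    using distinct_representatives[OF finite_K, of "\<lambda>_. A \<inter> D"] by blast
  define U where "U = edge_rows X - A \<inter> D"
  have "card U = m - card (A \<inter> D)" unfolding U_def m_def defs
    by (rule card_Diff_subset) (use Hit_subset in auto)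
  then have cU: "card U < a \<alpha> + 2 * l + 1" using AD small(1) unfolding m_def by linarith
  have finU: "finite U" by (simp add: U_def)
  \<comment> \<open>The rows from which \<open>h\<close> can recover at \<open>\<alpha>\<close>
    after giving its \<open>\<beta>\<close>-entry to the hole \<open>z\<close>.\<close>
  define T where "T z h = {r \<in> edge_rows X - {h}. ed ((X h)(\<beta> := X z \<beta>, \<alpha> := X r \<alpha>))}" for z h
  have T: "a \<alpha> \<le> Suc (card (T z h)) \<and> T z h \<inter> Hit X z' \<beta> = {}"
    if z: "z \<in> {c, d}" "z' \<in> {c, d}" "z \<noteq> z'" and h: "h \<in> A \<inter> D" for z z' h
  proof -
    define Y where "Y = sw \<beta> z h X"
    have zh: "z \<in> holes X" "z' \<in> holes X" "h \<in> Hit X z \<beta>" "h \<in> edge_rows X"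
      using z h cd Hit_subset by (auto simp: defs)
    note rot = rotate[OF X zh(1,3), folded Y_def, simplified]
    have ne: "z \<noteq> h" "z' \<noteq> h" "z \<notin> edge_rows X" using zh edge_rows_holes by blast+
    have hol: "h \<in> holes Y" "z' \<in> holes Y" using rot(2) zh z by auto
    have Yo: "Y t = X t" if "t \<noteq> z" "t \<noteq> h" for t using that by (simp add: Y_def)
    have Yh: "Y h = (X h)(\<beta> := X z \<beta>)" by (simp add: Y_def)
    have "Hit Y h \<alpha> \<subseteq> insert z (T z h)"
      using rot(3) Yo Yh by (auto simp: Hit_def T_def)
    then have "card (Hit Y h \<alpha>) \<le> card (insert z (T z h))" by (intro card_mono) (auto simp: T_def)
    also have "\<dots> \<le> Suc (card (T z h))" by (rule card_insert_le_m1) auto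
    finally have 1: "a \<alpha> \<le> Suc (card (T z h))" using card_Hit_maximal[OF rot(1) hol(1) K(1)] by linarith
    have "T z h \<inter> Hit X z' \<beta> \<subseteq> Hit Y h \<alpha> \<inter> Hit Y z' \<beta>"
    proof
      fix r assume r: "r \<in> T z h \<inter> Hit X z' \<beta>"
      then have "r \<noteq> z" "r \<noteq> h" "r \<in> edge_rows X" using ne by (auto simp: T_def)
      moreover have "Y z' = X z'" using Yo z ne by auto
      ultimately show "r \<in> Hit Y h \<alpha> \<inter> Hit Y z' \<beta>"
        using r rot(3) Yo[of r] Yh by (auto simp: Hit_def T_def)
    qed
    then show ?thesis using 1 Hit_disjoint[OF rot(1) hol ne(2)[symmetric] K(3)] by blast
  qed
  define S where "S h = T c h \<inter> T d h \<inter> Q" for h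
  have S: "finite (S h) \<and> card K \<le> card (S h)" if "h \<in> A \<inter> D" for h
  proof -
    note Tc = T[of c d, OF _ _ cd(3) that, simplified] and Td = T[of d c, OF _ _ cd(3)[symmetric] that, simplified]
    have sub: "T c h \<subseteq> U" "T d h \<subseteq> U" "Q \<subseteq> U"
      using Tc Td dis unfolding U_def defs by (auto simp: T_def dest: Hit_edge)
    have "card (T c h) + card (T d h) = card (T c h \<union> T d h) + card (T c h \<inter> T d h)"
      using card_Un_Int[of "T c h" "T d h"] sub finU finite_subset by metis
    moreover have "card (T c h \<inter> T d h) + card Q = card (T c h \<inter> T d h \<union> Q) + card (S h)"
      unfolding S_def using card_Un_Int[of "T c h \<inter> T d h" Q] sub finU finite_subset by (metis finite_Int)
    moreover have "card (T c h \<union> T d h) \<le> card U" "card (T c h \<inter> T d h \<union> Q) \<le> card U"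
      using sub finU by (auto intro!: card_mono)
    \<comment> \<open>Each of the three sets misses at most \<open>2 * l + 1\<close> elements of
      \<open>U\<close>, so at least \<open>a \<alpha> - 4 * l - 2\<close> elements are common to
      them.\<close>
    ultimately have "card K \<le> card (S h)" using Tc Td ca cU small(2) by linarith
    then show ?thesis using fin by (simp add: S_def)
  qed
  obtain e where e: "inj_on e K" "\<forall>j\<in>K. e j \<in> S (g j)"
    using distinct_representatives[OF finite_K, of "\<lambda>j. S (g j)"] S g(2) by blast
  have eT: "e j \<in> T c (g j)" "e j \<in> T d (g j)" "e j \<in> Q" if "j \<in> K" for j
    using e(2) that by (auto simp: S_def)
  show ?thesis
  proof (rule no_aug_bound[OF _ K cd _ g(1) _ e(1)])
    show "arr X" using X by (simp add: maximal_def)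
    show "g ` K \<subseteq> edge_rows X" "e ` K \<subseteq> edge_rows X"
      using g(2) eT unfolding defs T_def by (auto dest: Hit_edge)
    show "g ` K \<inter> e ` K = {}"
    proof -
      have "e j \<notin> D" if "j \<in> K" for j
      proof -
        have "g j \<in> A \<inter> D" using g(2) that by blast
        then have "T c (g j) \<inter> D = {}" using T[of c d "g j"] cd(3) by (simp add: defs)
        then show ?thesis using eT(1)[OF that] by blast
      qed
      then show ?thesis using g(2) by fastforce
    qed
    show "\<not> aug S X Y" for S Y using maximal_no_aug[OF X] by simp
  qed (use g(2) eT in \<open>auto simp: defs Hit_def T_def\<close>)
qed

text \<open>Without common hits, all but fewer than \<open>2 * l\<close> edge rows split into
  \<open>P\<close> and \<open>Q\<close>. A hole rotated at \<open>\<alpha>\<close>,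
  \<open>\<beta>\<close>, \<open>\<alpha>\<close> finds nearly all its hits inside \<open>P\<close>,
  and the last rotation must leave a non-edge. Consider the pairs \<open>e'\<close>,
  \<open>f\<close> in \<open>P\<close> for which \<open>f\<close> takes the
  \<open>\<alpha>\<close>-entry of \<open>e'\<close>: counted from \<open>e'\<close> almost all of
  them fail, counted from \<open>f\<close> almost all of them succeed.\<close>

lemma two_large_codegrees:
  assumes X: "maximal {} X" and cd: "c \<in> holes X" "d \<in> holes X" "c \<noteq> d"
    and K: "\<alpha> \<in> K" "\<beta> \<in> K" "\<alpha> \<noteq> \<beta>"
    and small: "card (edge_rows X) < a \<alpha> + a \<beta> + l" "card K + 8 * l + 8 \<le> a \<alpha>" "card K + 8 * l + 8 \<le> a \<beta>"
  shows "sum a K \<le> card (edge_rows X)"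
proof (cases "Hit X c \<alpha> \<inter> Hit X d \<alpha> = {} \<and> Hit X c \<beta> \<inter> Hit X d \<beta> = {}")
  case False
  then show ?thesis
    using two_large_common_hit[OF X cd K, of l] two_large_common_hit[OF X cd K(2,1) K(3)[symmetric], of l] small
    by fastforce
next
  case True
  define m where "m = card (edge_rows X)"
  define P Q A D where "P = Hit X c \<alpha>" "Q = Hit X d \<alpha>" "A = Hit X c \<beta>" "D = Hit X d \<beta>"
  note defs = P_Q_A_D_def
  have fin: "finite P" "finite Q" "finite A" "finite D" by (simp_all add: defs)
  have ca: "a \<alpha> \<le> card P" "a \<alpha> \<le> card Q" "a \<beta> \<le> card A" "a \<beta> \<le> card D"
    unfolding defs using card_Hit_maximal[OF X] cd K by auto
  have dis: "P \<inter> D = {}" "Q \<inter> A = {}" "P \<inter> Q = {}" "A \<inter> D = {}"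
    unfolding defs using True Hit_disjoint[OF X cd K(3)] Hit_disjoint[OF X cd(2,1) cd(3)[symmetric] K(3)] by auto
  have E: "P \<subseteq> edge_rows X" "Q \<subseteq> edge_rows X" "A \<subseteq> edge_rows X" "D \<subseteq> edge_rows X"
    unfolding defs by (simp_all add: Hit_subset)
  have le_m: "card S + card T \<le> m" if "S \<subseteq> edge_rows X" "T \<subseteq> edge_rows X" "S \<inter> T = {}" for S T
    using that card_mono[of "edge_rows X" "S \<union> T"] card_Un_disjoint[of S T] finite_subset[OF _ finite_rows(1)]
    unfolding m_def by (metis Un_least finite_rows(1))
  have rest: "card (edge_rows X - S - T) < l"
    if "a \<alpha> + a \<beta> \<le> card S + card T" "S \<subseteq> edge_rows X" "T \<subseteq> edge_rows X" "S \<inter> T = {}" for S T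
  proof -
    have f: "finite S" "finite T" using that finite_subset[OF _ finite_rows(1)] by auto
    have "card (edge_rows X - (S \<union> T)) = m - card (S \<union> T)"
      unfolding m_def using that f by (intro card_Diff_subset) auto
    moreover have "edge_rows X - S - T = edge_rows X - (S \<union> T)" by blast
    moreover have "card (S \<union> T) = card S + card T" using that f card_Un_disjoint by blast
    ultimately show ?thesis using that(1) le_m[OF that(2-4)] small(1) unfolding m_def by simp
  qed
  have rPD: "card (edge_rows X - P - D) < l" and rQA: "card (edge_rows X - Q - A) < l"
    using rest[of P D] rest[of Q A] ca E dis by auto
  \<comment> \<open>\<open>A\<close> avoids \<open>D\<close>, and \<open>P\<close> together with
    \<open>D\<close> is almost everything, so \<open>A\<close> lies almost inside
    \<open>P\<close>.\<close>
  have "A - P \<subseteq> edge_rows X - P - D" using E dis by blast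
  then have AP: "card (A - P) < l" using rPD card_mono[of "edge_rows X - P - D" "A - P"] by fastforce
  have rQP: "card (edge_rows X - Q - P) < 2 * l"
  proof -
    have "edge_rows X - Q - P \<subseteq> (edge_rows X - Q - A) \<union> (A - P)" by blast
    then have "card (edge_rows X - Q - P) \<le> card ((edge_rows X - Q - A) \<union> (A - P))"
      using fin by (intro card_mono) auto
    also have "\<dots> \<le> card (edge_rows X - Q - A) + card (A - P)" by (rule card_Un_le)
    finally show ?thesis using rQA AP by linarith
  qed
  have split: "card S \<le> card (S \<inter> T) + card (edge_rows X - U - T)"
    if "S \<subseteq> edge_rows X" "S \<inter> U = {}" for S T U
  proof -
    have "S \<subseteq> (S \<inter> T) \<union> (edge_rows X - U - T)" using that by blast
    then have "card S \<le> card ((S \<inter> T) \<union> (edge_rows X - U - T))"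
      using that finite_subset[OF that(1)] by (intro card_mono) auto
    also have "\<dots> \<le> card (S \<inter> T) + card (edge_rows X - U - T)" by (rule card_Un_le)
    finally show ?thesis .
  qed
  have cX: "c \<notin> edge_rows X" "d \<notin> edge_rows X" using cd edge_rows_holes by blast+
  have "P \<noteq> {}" using ca(1) small(2) by auto
  then obtain e where e: "e \<in> P" by blast
  have eE: "e \<in> edge_rows X" using e E by blast
  \<comment> \<open>The rows of \<open>P\<close> from which the hole created at \<open>e\<close> can
    recover at \<open>\<beta>\<close>.\<close>
  define R1 where "R1 = {r \<in> edge_rows X - {e}. ed ((X e)(\<alpha> := X c \<alpha>, \<beta> := X r \<beta>))} \<inter> P"
  define Y1 where "Y1 = sw \<alpha> c e X"
  note rot1 = rotate[OF X cd(1) e[unfolded defs], folded Y1_def, simplified]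
  have ne: "c \<noteq> e" "d \<noteq> e" using eE cX by auto
  have hol1: "e \<in> holes Y1" "d \<in> holes Y1" using rot1(2) cd by auto
  have Y1: "Y1 e = (X e)(\<alpha> := X c \<alpha>)" "\<And>t. t \<noteq> c \<Longrightarrow> t \<noteq> e \<Longrightarrow> Y1 t = X t"
    by (simp_all add: Y1_def)
  define A1 where "A1 = {r \<in> edge_rows X - {e}. ed ((X e)(\<alpha> := X c \<alpha>, \<beta> := X r \<beta>))}"
  have "Hit Y1 e \<beta> \<subseteq> insert c A1" using rot1(3) Y1 by (auto simp: Hit_def A1_def)
  then have "card (Hit Y1 e \<beta>) \<le> card (insert c A1)" by (intro card_mono) (auto simp: A1_def)
  also have "\<dots> \<le> Suc (card A1)" by (rule card_insert_le_m1) auto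
  finally have cA1: "a \<beta> \<le> Suc (card A1)" using card_Hit_maximal[OF rot1(1) hol1(1) K(2)] by linarith
  have "A1 \<inter> Q \<subseteq> Hit Y1 e \<beta> \<inter> Hit Y1 d \<alpha>"
  proof
    fix r assume r: "r \<in> A1 \<inter> Q"
    then have "r \<noteq> c" "r \<noteq> e" "r \<in> edge_rows X" using cX by (auto simp: A1_def)
    then show "r \<in> Hit Y1 e \<beta> \<inter> Hit Y1 d \<alpha>"
      using r rot1(3) Y1(2)[of r] Y1(2)[of d] cd ne Y1(1) by (auto simp: Hit_def A1_def defs)
  qed
  then have "A1 \<inter> Q = {}" using Hit_disjoint[OF rot1(1) hol1 ne(2)[symmetric] K(3)[symmetric]] by blast
  then have R1: "a \<beta> \<le> card R1 + 2 * l"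
    using split[of A1 Q P] rQP cA1 unfolding R1_def A1_def[symmetric] by (simp add: A1_def)
  have many: "a \<alpha> \<le> card {f \<in> P. \<not> ed ((X f)(\<alpha> := X e' \<alpha>))} + l + 2" if e': "e' \<in> R1" for e'
  proof -
    define Y2 where "Y2 = sw \<beta> e e' Y1"
    have e'E: "e' \<in> edge_rows X" "e' \<noteq> e" "e' \<noteq> c" "e' \<noteq> d" using e' cX by (auto simp: R1_def)
    have "e' \<in> Hit Y1 e \<beta>" using e' e'E rot1(3) Y1 by (auto simp: Hit_def R1_def)
    note rot2 = rotate[OF rot1(1) hol1(1) this, folded Y2_def, simplified]
    have hol2: "e' \<in> holes Y2" "d \<in> holes Y2" using rot2(2) hol1 ne by auto
    have Y2: "Y2 e' = (X e')(\<beta> := X e \<beta>)" "\<And>t. t \<noteq> c \<Longrightarrow> t \<noteq> e \<Longrightarrow> t \<noteq> e' \<Longrightarrow> Y2 t = X t"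
      using Y1 e'E K by (simp_all add: Y2_def)
    define P2 where "P2 = {r \<in> edge_rows X - {e, e'}. ed ((X e')(\<beta> := X e \<beta>, \<alpha> := X r \<alpha>))}"
    have "Hit Y2 e' \<alpha> \<subseteq> insert c (insert e P2)" using rot2(3) rot1(3) Y2 by (auto simp: Hit_def P2_def)
    then have "card (Hit Y2 e' \<alpha>) \<le> card (insert c (insert e P2))" by (intro card_mono) (auto simp: P2_def)
    also have "\<dots> \<le> Suc (Suc (card P2))"
      by (metis card_insert_le_m1 card_insert_if finite_insert le_SucI le_refl card.infinite not_less_eq_eq)
    finally have cP2: "a \<alpha> \<le> Suc (Suc (card P2))" using card_Hit_maximal[OF rot2(1) hol2(1) K(1)] by linarith
    have "P2 \<inter> D \<subseteq> Hit Y2 e' \<alpha> \<inter> Hit Y2 d \<beta>"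
    proof
      fix r assume r: "r \<in> P2 \<inter> D"
      then have "r \<noteq> c" "r \<noteq> e" "r \<noteq> e'" "r \<in> edge_rows X" using cX by (auto simp: P2_def)
      show "r \<in> Hit Y2 e' \<alpha> \<inter> Hit Y2 d \<beta>"
      proof (rule IntI)
        have "r \<in> edge_rows Y2" using rot1(3) rot2(3) \<open>r \<noteq> e\<close> \<open>r \<noteq> e'\<close> \<open>r \<in> edge_rows X\<close> by auto
        moreover have "Y2 r = X r" "Y2 d = X d"
          using Y2(2)[of r] Y2(2)[of d] \<open>r \<noteq> c\<close> \<open>r \<noteq> e\<close> \<open>r \<noteq> e'\<close> cd ne e'E(4) by auto
        ultimately show "r \<in> Hit Y2 e' \<alpha>" "r \<in> Hit Y2 d \<beta>"
          using r by (simp_all add: Hit_def P2_def defs Y2(1))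
      qed
    qed
    then have "P2 \<inter> D = {}" using Hit_disjoint[OF rot2(1) hol2 e'E(4) K(3)] by blast
    then have "card P2 \<le> card (P2 \<inter> P) + card (edge_rows X - D - P)"
      by (intro split) (auto simp: P2_def)
    moreover have "edge_rows X - D - P = edge_rows X - P - D" by blast
    ultimately have c: "card P2 \<le> card (P2 \<inter> P) + l" using rPD by simp
    \<comment> \<open>After the third rotation \<open>f\<close> is a hole of a maximal array, and
      its row is \<open>X f\<close> with the \<open>\<alpha>\<close>-entry of \<open>e'\<close>;
      hence the non-edge.\<close>
    have "P2 \<inter> P \<subseteq> {f \<in> P. \<not> ed ((X f)(\<alpha> := X e' \<alpha>))}"
    proof
      fix f assume f: "f \<in> P2 \<inter> P"
      then have fE: "f \<noteq> c" "f \<noteq> e" "f \<noteq> e'" "f \<in> edge_rows X" using cX by (auto simp: P2_def)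
      then have "f \<in> Hit Y2 e' \<alpha>"
        using f rot1(3) rot2(3) Y2(2)[of f] Y2(1) by (auto simp: Hit_def P2_def)
      note rot3 = rotate[OF rot2(1) hol2(1) this, simplified]
      have "f \<in> holes (sw \<alpha> e' f Y2)" using rot3(2) by blast
      moreover have "sw \<alpha> e' f Y2 f = (X f)(\<alpha> := X e' \<alpha>)"
        using Y2 fE K by simp
      ultimately show "f \<in> {f \<in> P. \<not> ed ((X f)(\<alpha> := X e' \<alpha>))}" using f by (simp add: holes_def)
    qed
    then have "card (P2 \<inter> P) \<le> card {f \<in> P. \<not> ed ((X f)(\<alpha> := X e' \<alpha>))}"
      using fin by (intro card_mono) auto
    then show ?thesis using c cP2 by linarith
  qed
  \<comment> \<open>One rotation of \<open>c\<close> with \<open>f\<close> shows the opposite: the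
    hits of \<open>f\<close> at \<open>\<alpha>\<close> avoid \<open>D\<close>, so they contain all
    but at most \<open>l + 1\<close> rows of \<open>P\<close>.\<close>
  have few: "card {e' \<in> R1. \<not> ed ((X f)(\<alpha> := X e' \<alpha>))} \<le> l + 1" if f: "f \<in> P" for f
  proof -
    define Y where "Y = sw \<alpha> c f X"
    note rot = rotate[OF X cd(1) f[unfolded defs], folded Y_def, simplified]
    have fE: "f \<in> edge_rows X" "f \<noteq> c" "f \<noteq> d" using f E cX by blast+
    have hol: "f \<in> holes Y" "d \<in> holes Y" using rot(2) cd by auto
    have Y: "\<And>v. (Y f)(\<alpha> := v) = (X f)(\<alpha> := v)" "\<And>t. t \<noteq> c \<Longrightarrow> t \<noteq> f \<Longrightarrow> Y t = X t"
      by (simp_all add: Y_def)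
    define G where "G = {r \<in> edge_rows X - {f}. ed ((X f)(\<alpha> := X r \<alpha>))}"
    have "Hit Y f \<alpha> \<subseteq> insert c G" using rot(3) Y by (auto simp: Hit_def G_def)
    then have "card (Hit Y f \<alpha>) \<le> card (insert c G)" by (intro card_mono) (auto simp: G_def)
    also have "\<dots> \<le> Suc (card G)" by (rule card_insert_le_m1) auto
    finally have cG: "a \<alpha> \<le> Suc (card G)" using card_Hit_maximal[OF rot(1) hol(1) K(1)] by linarith
    have "G \<inter> D \<subseteq> Hit Y f \<alpha> \<inter> Hit Y d \<beta>"
    proof
      fix r assume r: "r \<in> G \<inter> D"
      then have "r \<noteq> c" "r \<noteq> f" "r \<in> edge_rows X" using cX by (auto simp: G_def)
      then show "r \<in> Hit Y f \<alpha> \<inter> Hit Y d \<beta>"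
        using r rot(3) Y(2)[of r] Y(2)[of d] cd fE Y(1) by (auto simp: Hit_def G_def defs)
    qed
    then have GD: "G \<inter> D = {}" using Hit_disjoint[OF rot(1) hol fE(3) K(3)] by blast
    have sub: "{e' \<in> R1. \<not> ed ((X f)(\<alpha> := X e' \<alpha>))} \<subseteq> P - G"
      by (auto simp: R1_def G_def)
    have "card (P \<union> G) + card D \<le> m" using E dis GD by (intro le_m) (auto simp: G_def)
    moreover have "card (P \<union> G) = card (P - G) + card G"
      using card_Un_disjoint[of "P - G" G] fin by (auto simp: G_def Un_commute)
    ultimately have "card (P - G) \<le> l + 1" using ca(4) cG small(1) unfolding m_def by linarith
    then show ?thesis using card_mono[OF _ sub] fin by fastforce
  qed
  have "card R1 * (a \<alpha> - l - 2) \<le> card P * (l + 1)"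
  proof (rule double_count[where R = "\<lambda>e' f. \<not> ed ((X f)(\<alpha> := X e' \<alpha>))"])
    show "a \<alpha> - l - 2 \<le> card {f \<in> P. \<not> ed ((X f)(\<alpha> := X e' \<alpha>))}" if "e' \<in> R1" for e'
      using many[OF that] by linarith
  qed (use few fin in \<open>auto simp: R1_def\<close>)
  moreover have "card P \<le> a \<alpha> + l"
    using le_m[OF E(1,4) dis(1)] ca(4) small(1) unfolding m_def by linarith
  then have "card P * (l + 1) \<le> (a \<alpha> + l) * (l + 1)" by (rule mult_le_mono1)
  moreover have "6 * (l + 1) \<le> card R1" using R1 small(3) by simp
  then have "6 * (l + 1) * (a \<alpha> - l - 2) \<le> card R1 * (a \<alpha> - l - 2)" by (rule mult_le_mono1)
  ultimately have "6 * (l + 1) * (a \<alpha> - l - 2) \<le> (a \<alpha> + l) * (l + 1)" by linarith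
  then have "6 * (a \<alpha> - l - 2) * (l + 1) \<le> (a \<alpha> + l) * (l + 1)" by (simp only: mult.assoc mult.commute[of _ "l + 1"] mult.left_commute[of _ "l + 1"])
  \<comment> \<open>With \<open>l + 1\<close> cancelled this says
    \<open>5 * a \<alpha> \<le> 7 * l + 12\<close>, against
    \<open>a \<alpha> \<ge> 8 * l + 8\<close>.\<close>
  then have "6 * (a \<alpha> - l - 2) \<le> a \<alpha> + l" by (metis add_is_0 mult_le_cancel2 neq0_conv zero_neq_one)
  then show ?thesis using small(2) by linarith
qed

section \<open>One large codegree\<close>

text \<open>Exchanging everything except column \<open>\<alpha>\<close> amounts to exchanging the
  \<open>\<alpha>\<close>-entries, but each row keeps its vertex of \<open>V \<alpha>\<close>. A row
  number can thus stand for a vertex of that class.\<close>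

definition bsw :: "'i \<Rightarrow> nat \<Rightarrow> nat \<Rightarrow> (nat \<Rightarrow> 'i \<Rightarrow> 'v) \<Rightarrow> nat \<Rightarrow> 'i \<Rightarrow> 'v" where
  "bsw \<alpha> r s X = X(r := (X s)(\<alpha> := X r \<alpha>), s := (X r)(\<alpha> := X s \<alpha>))"

lemma bsw_left [simp]: "bsw \<alpha> r s X r = (X s)(\<alpha> := X r \<alpha>)"
  and bsw_right [simp]: "bsw \<alpha> r s X s = (X r)(\<alpha> := X s \<alpha>)"
  and bsw_other [simp]: "t \<noteq> r \<Longrightarrow> t \<noteq> s \<Longrightarrow> bsw \<alpha> r s X t = X t"
  and bsw_col [simp]: "bsw \<alpha> r s X t \<alpha> = X t \<alpha>"
  by (auto simp: bsw_def)

lemma sw_col: "p \<noteq> q \<Longrightarrow> sw p r s X t q = X t q"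
  by (simp add: sw_apply)

lemma arr_bsw:
  assumes "arr X" "r < n" "s < n"
  shows "arr (bsw \<alpha> r s X)"
proof -
  have "bsw \<alpha> r s X = (\<lambda>t q. X ((if q = \<alpha> then id else transpose r s) t) q)"
    by (auto simp: bsw_def fun_eq_iff transpose_def)
  then show ?thesis
    using arr_reindex[OF assms(1), of "\<lambda>q. if q = \<alpha> then id else transpose r s"] assms
      bij_betw_transpose by auto
qed

text \<open>The first \<open>z\<close> vertices in column \<open>\<alpha>\<close> form a smaller
  class: the codegree at \<open>\<alpha>\<close> drops by at most \<open>n - z\<close>, and the rows
  from \<open>z\<close> on are a supply of spare vertices in the other classes. In a maximum choice
  a hole \<open>c\<close> is repaired at the expense of a row \<open>r\<close>, which becomes the
  new hole, and \<open>c\<close> even receives a second possible edge on a spare row. Rows with a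
  second edge accumulate in \<open>D\<close>, which cannot outgrow the \<open>\<nu>\<close> edge
  rows.\<close>

lemma small_class_matching:
  assumes X0: "arr X0" and \<alpha>: "\<alpha> \<in> K" and z: "2 * z + card K \<le> n"
  shows "\<exists>X. arr X \<and> (\<forall>r. X r \<alpha> = X0 r \<alpha>) \<and>
    min z ((a \<alpha> - (n - z)) + sum a (K - {\<alpha>})) \<le> card (edge_rows X \<inter> {..<z})"
proof -
  define good where "good X \<longleftrightarrow> arr X \<and> (\<forall>r. X r \<alpha> = X0 r \<alpha>)" for X
  define E where "E X = edge_rows X \<inter> {..<z}" for X
  have finE: "finite (E X)" for X by (simp add: E_def)
  have bound: "card (E X) \<le> z" for X using card_mono[of "{..<z}" "E X"] by (simp add: E_def)
  let ?P = "\<lambda>m. \<exists>X. good X \<and> card (E X) = m"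
  have "?P (card (E X0))" using X0 by (auto simp: good_def)
  then obtain \<nu> where \<nu>: "?P \<nu>" "\<And>m. ?P m \<Longrightarrow> m \<le> \<nu>"
    using Nat.ex_has_greatest_nat[of ?P _ z] bound by blast
  have no_gain: False if "good X" "card (E X) = \<nu>" "h < z" "h \<notin> E X" "good Y" "insert h (E X) \<subseteq> E Y" for X Y h
  proof -
    have "card (insert h (E X)) \<le> card (E Y)" using that finE by (intro card_mono) auto
    then show False using that \<nu>(2)[of "card (E Y)"] finE by auto
  qed
  have good_bsw: "good (bsw \<alpha> r s X)" if "good X" "r < n" "s < n" for r s X
    using that by (simp add: good_def arr_bsw)
  have good_sw: "good (sw p r s X)" if "good X" "r < n" "s < n" "p \<noteq> \<alpha>" for p r s X
    using that by (simp add: good_def arr_sw sw_col)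
  have zn: "r < n" if "r < z" for r using that z by linarith
  show ?thesis
  proof (rule ccontr)
    assume "\<not> ?thesis"
    then have less: "\<nu> < z" "\<nu> < (a \<alpha> - (n - z)) + sum a (K - {\<alpha>})"
      using \<nu>(1) unfolding good_def E_def by (metis min_less_iff_conj not_le)+
    \<comment> \<open>Each of the \<open>t\<close> rows \<open>r\<close> of \<open>D\<close> could
      switch to an edge on the spare row \<open>\<pi> r\<close> and release all its vertices except
      the one in \<open>V \<alpha>\<close>.\<close>
    define Q where "Q t X c D \<pi> \<longleftrightarrow> good X \<and> card (E X) = \<nu> \<and> c < z \<and> c \<notin> E X \<and> D \<subseteq> E X \<and> card D = t \<and>
      inj_on \<pi> D \<and> \<pi> ` D \<subseteq> {z..<n} \<and> (\<forall>r\<in>D. ed ((X (\<pi> r))(\<alpha> := X r \<alpha>)))" for t X c D \<pi>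
    have step: "\<exists>X' c' D' \<pi>'. Q (Suc t) X' c' D' \<pi>'" if QX: "Q t X c D \<pi>" for t X c D \<pi>
    proof -
      have X: "good X" "card (E X) = \<nu>" and c: "c < z" "c \<notin> E X" and D: "D \<subseteq> E X" "card D = t"
        and \<pi>: "inj_on \<pi> D" "\<pi> ` D \<subseteq> {z..<n}" "\<And>r. r \<in> D \<Longrightarrow> ed ((X (\<pi> r))(\<alpha> := X r \<alpha>))"
        using QX unfolding Q_def by auto
      have arrX: "arr X" using X by (simp add: good_def)
      have finD: "finite D" using D finE finite_subset by blast
      have Ez: "r < z" if "r \<in> E X" for r using that by (simp add: E_def)
      have Eed: "ed (X r)" if "r \<in> E X" for r using that by (simp add: E_def edge_rows_def)
      define Fr where "Fr = {z..<n} - \<pi> ` D"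
      have "t \<le> \<nu>" using D X finE card_mono by blast
      moreover have "card Fr = (n - z) - t"
        unfolding Fr_def using \<pi> D finD by (simp add: card_Diff_subset card_image)
      ultimately have "card K \<le> card Fr" using less(1) z by linarith
      then obtain f where f: "inj_on f K" "\<forall>j\<in>K. f j \<in> Fr"
        using distinct_representatives[OF finite_K, of "\<lambda>_. Fr"] by (auto simp: Fr_def)
      have fz: "z \<le> f j" "f j < n" "f j \<noteq> c" "f j \<notin> \<pi> ` D" if "j \<in> K" for j
        using f(2) that c(1) by (force simp: Fr_def)+
      define T where "T j = (X (f j))(\<alpha> := X c \<alpha>)" for j
      \<comment> \<open>Column \<open>\<alpha>\<close> plays a different role: there
        \<open>r\<close> itself would move to the spare row \<open>f \<alpha>\<close> and free its
        other vertices. At the other columns \<open>r\<close> lends one entry to \<open>c\<close>,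
        rebuilt on the spare row \<open>f j\<close>.\<close>
      define H where "H j = (if j = \<alpha> then {r. r < z \<and> ed ((X (f \<alpha>))(\<alpha> := X r \<alpha>))}
        else {r. r < n \<and> ed ((T j)(j := X r j))})" for j
      have EI: "r \<in> E Y" if "r < z" "ed (Y r)" for r Y
        using that zn by (simp add: E_def edge_rows_def)
      have H_out: "r \<in> E X" if r: "r \<in> H j" and j: "j \<in> K" "j \<noteq> \<alpha>" for r j
      proof (rule ccontr)
        assume rE: "r \<notin> E X"
        define Y where "Y = (if r = f j then bsw \<alpha> c (f j) X else
           if r = c then sw j c (f j) (bsw \<alpha> c (f j) X) else sw j c r (bsw \<alpha> c (f j) X))"
        have rn: "r < n" using r j by (simp add: H_def)
        have "good Y" unfolding Y_def using X c rn fz[OF j(1)] zn good_bsw good_sw j by auto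
        moreover have "Y c = (T j)(j := X r j)"
          using fz[OF j(1)] j by (auto simp: Y_def T_def fun_upd_twist)
        moreover have "Y t = X t" if "t \<in> E X" for t
        proof -
          have "t \<noteq> r" "t \<noteq> c" "t \<noteq> f j" using that rE c fz(1)[OF j(1)] Ez by force+
          then show ?thesis by (simp add: Y_def)
        qed
        ultimately have "insert c (E X) \<subseteq> E Y"
          using r j c Eed Ez by (auto simp: H_def intro!: EI)
        then show False using no_gain[OF X c \<open>good Y\<close>] by blast
      qed
      \<comment> \<open>A row of \<open>D\<close> would first switch to its second edge, and its old
        \<open>j\<close>-entry would then be free for \<open>c\<close>.\<close>
      have H_D: "r \<notin> D" if r: "r \<in> H j" and j: "j \<in> K" "j \<noteq> \<alpha>" for r j
      proof
        assume rD: "r \<in> D"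
        define Y where "Y = sw j c (\<pi> r) (bsw \<alpha> c (f j) (bsw \<alpha> r (\<pi> r) X))"
        have rows: "r < z" "r \<noteq> c" "z \<le> \<pi> r" "\<pi> r < n" "\<pi> r \<noteq> f j" "\<pi> r \<noteq> c"
          using rD D c \<pi> fz(4)[OF j(1)] Ez by force+
        have "good Y" unfolding Y_def using X c rows fz[OF j(1)] zn good_bsw good_sw j by auto
        moreover have "Y c = (T j)(j := X r j)"
          using fz[OF j(1)] j rows by (auto simp: Y_def T_def fun_upd_twist)
        moreover have "ed (Y t)" if "t \<in> E X" for t
        proof -
          have "t \<noteq> \<pi> r" "t \<noteq> c" "t \<noteq> f j" using that c fz(1)[OF j(1)] rows Ez by force+
          then show ?thesis using rows fz(1)[OF j(1)] \<pi>(3)[OF rD] Eed[OF that]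
            by (cases "t = r") (auto simp: Y_def fun_upd_def)
        qed
        ultimately have "insert c (E X) \<subseteq> E Y"
          using r j c Ez by (auto simp: H_def intro!: EI)
        then show False using no_gain[OF X c \<open>good Y\<close>] by blast
      qed
      have H\<alpha>: "r \<in> E X" if r: "r \<in> H \<alpha>" for r
      proof (rule ccontr)
        assume rE: "r \<notin> E X"
        define Y where "Y = bsw \<alpha> r (f \<alpha>) X"
        have rn: "r < z" "ed (Y r)" using r by (auto simp: H_def Y_def)
        have "good Y" unfolding Y_def using X rn fz[OF \<alpha>] zn good_bsw by auto
        moreover have "Y t = X t" if "t \<in> E X" for t
        proof -
          have "t \<noteq> r" "t \<noteq> f \<alpha>" using that rE fz(1)[OF \<alpha>] Ez by force+
          then show ?thesis by (simp add: Y_def)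
        qed
        ultimately have "insert r (E X) \<subseteq> E Y"
          using rn Eed Ez by (auto intro!: EI)
        then show False using no_gain[OF X rn(1) rE \<open>good Y\<close>] by blast
      qed
      have HE: "H j \<subseteq> E X" if "j \<in> K" for j using H_out H\<alpha> that by blast
      have cH: "a j \<le> card (H j)" if j: "j \<in> K" "j \<noteq> \<alpha>" for j
      proof -
        have "T j p \<in> V p" if "p \<in> K - {j}" for p
          using that arr_mem[OF arrX] fz(2)[OF j(1)] zn[OF c(1)] by (auto simp: T_def)
        then show ?thesis using card_hits[OF arrX j(1), of "T j"] j by (simp add: H_def)
      qed
      have cH\<alpha>: "a \<alpha> - (n - z) \<le> card (H \<alpha>)"
      proof -
        let ?S = "{r. r < n \<and> ed ((X (f \<alpha>))(\<alpha> := X r \<alpha>))}"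
        have "a \<alpha> \<le> card ?S"
          using card_hits[OF arrX \<alpha>, of "X (f \<alpha>)"] arr_mem[OF arrX] fz(2)[OF \<alpha>] by auto
        also have "\<dots> \<le> card (H \<alpha> \<union> {z..<n})" by (intro card_mono) (auto simp: H_def)
        also have "\<dots> \<le> card (H \<alpha>) + (n - z)" using card_Un_le[of "H \<alpha>" "{z..<n}"] by simp
        finally show ?thesis by linarith
      qed
      define L where "L = E X - D"
      have cL: "card L = \<nu> - t" unfolding L_def using D X finD by (simp add: card_Diff_subset)
      \<comment> \<open>The sizes of the sets \<open>H j\<close> add up to more than
        \<open>\<nu>\<close>, and only \<open>H \<alpha>\<close> can lose elements to
        \<open>D\<close>, at most \<open>t\<close> of them. So two of the sets meet in one of the
        \<open>\<nu> - t\<close> rows outside \<open>D\<close>.\<close>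
      have "\<exists>i\<in>K. \<exists>j\<in>K. i \<noteq> j \<and> H i \<inter> H j \<inter> L \<noteq> {}"
      proof (rule ccontr)
        assume "\<not> ?thesis"
        then have "(\<Sum>j\<in>K. card (H j \<inter> L)) = card (\<Union>j\<in>K. H j \<inter> L)"
          using finite_K finE by (intro card_UN_disjoint[symmetric]) (auto simp: L_def)
        also have "\<dots> \<le> card L" by (intro card_mono) (auto simp: L_def finE)
        finally have "(\<Sum>j\<in>K. card (H j \<inter> L)) \<le> \<nu> - t" using cL by simp
        moreover have "(\<Sum>j\<in>K. card (H j \<inter> L)) = card (H \<alpha> \<inter> L) + (\<Sum>j\<in>K - {\<alpha>}. card (H j \<inter> L))"
          using \<alpha> finite_K by (rule sum.remove[rotated])
        moreover have "sum a (K - {\<alpha>}) \<le> (\<Sum>j\<in>K - {\<alpha>}. card (H j \<inter> L))"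
        proof (rule sum_mono)
          fix j assume j: "j \<in> K - {\<alpha>}"
          then have "H j \<inter> L = H j" using H_out H_D by (auto simp: L_def)
          then show "a j \<le> card (H j \<inter> L)" using cH j by simp
        qed
        moreover have "card (H \<alpha>) \<le> card (H \<alpha> \<inter> L) + t"
        proof -
          have "H \<alpha> \<subseteq> (H \<alpha> \<inter> L) \<union> D" using HE[OF \<alpha>] by (auto simp: L_def)
          then have "card (H \<alpha>) \<le> card ((H \<alpha> \<inter> L) \<union> D)"
            using finD finE by (intro card_mono) (auto simp: L_def)
          also have "\<dots> \<le> card (H \<alpha> \<inter> L) + card D" by (rule card_Un_le)
          finally show ?thesis using D by simp
        qed
        ultimately show False using cH\<alpha> less(2) \<open>t \<le> \<nu>\<close> by linarith
      qed
      then obtain i j r where ij: "i \<in> K" "j \<in> K" "i \<noteq> j" and r: "r \<in> H i" "r \<in> H j" "r \<in> L" by blast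
      have rE: "r \<in> E X" "r \<notin> D" "r < z" "r \<noteq> c" using r(3) c Ez by (auto simp: L_def)
      have fr: "f i \<noteq> r" "f j \<noteq> r" "f \<alpha> \<noteq> r" "f i \<noteq> f j" "f i \<noteq> c" "f j \<noteq> c" "f \<alpha> \<noteq> c"
        using rE fz ij \<alpha> f(1) by (force simp: inj_on_def)+
      \<comment> \<open>If one of the two columns is \<open>\<alpha>\<close>, both rows are served
        at once: \<open>c\<close> by an entry of \<open>r\<close>, and \<open>r\<close> by its spare
        row.\<close>
      have mixed: False if j: "j \<in> K" "j \<noteq> \<alpha>" "r \<in> H j" and ra: "r \<in> H \<alpha>" for j
      proof -
        have fj: "f j \<noteq> r" "f j \<noteq> c" "f \<alpha> \<noteq> f j"
          using rE fz j \<alpha> f(1) by (force simp: inj_on_def)+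
        define Y where "Y = bsw \<alpha> r (f \<alpha>) (sw j c r (bsw \<alpha> c (f j) X))"
        have "good Y" unfolding Y_def using X c rE fz[OF \<alpha>] fz[OF j(1)] zn good_bsw good_sw j by auto
        moreover have "Y c = (T j)(j := X r j)" "Y r = (X (f \<alpha>))(\<alpha> := X r \<alpha>)"
          using fr fj rE j by (auto simp: Y_def T_def sw_col fun_upd_twist)
        moreover have "Y t = X t" if "t \<in> E X" "t \<noteq> r" for t
        proof -
          have "t \<noteq> c" "t \<noteq> f j" "t \<noteq> f \<alpha>" using that c fz(1)[OF j(1)] fz(1)[OF \<alpha>] Ez by force+
          then show ?thesis using that by (simp add: Y_def)
        qed
        ultimately have "ed (Y t)" if "t \<in> insert c (E X)" for t
          using that j ra Eed by (cases "t = r") (auto simp: H_def)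
        then have "insert c (E X) \<subseteq> E Y" using c Ez by (auto intro!: EI)
        then show False using no_gain[OF X c \<open>good Y\<close>] by blast
      qed
      then have ij\<alpha>: "i \<noteq> \<alpha>" "j \<noteq> \<alpha>" using ij r by blast+
      \<comment> \<open>The repair at \<open>i\<close> is carried out and makes \<open>r\<close> the
        hole; the repair at \<open>j\<close> is kept on row \<open>f j\<close> as the second edge
        for \<open>c\<close>.\<close>
      define X' where "X' = sw j r (f j) (sw i c r (bsw \<alpha> c (f i) X))"
      have g': "good X'" unfolding X'_def using X c rE fz ij ij\<alpha> zn good_bsw good_sw by auto
      have X'c: "X' c = (T i)(i := X r i)"
        using fr rE ij ij\<alpha> by (auto simp: X'_def T_def)
      have X'f: "X' (f j) = (X (f j))(j := X r j)"
        using fr rE ij ij\<alpha> by (auto simp: X'_def T_def)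
      have X'o: "X' t = X t" if "t \<noteq> c" "t \<noteq> r" "t \<noteq> f i" "t \<noteq> f j" for t
        using that by (simp add: X'_def)
      have X'E: "X' t = X t" if "t \<in> E X" "t \<noteq> r" for t
        using that c fz(1) ij Ez[OF that(1)] by (intro X'o) force+
      have X'\<alpha>: "X' t \<alpha> = X t \<alpha>" for t using g' X by (simp add: good_def)
      have "ed (X' c)" using X'c r(1) ij\<alpha> by (simp add: H_def)
      then have sub: "insert c (E X - {r}) \<subseteq> E X'" using c X'E Eed Ez by (auto intro!: EI)
      have cc: "card (insert c (E X - {r})) = \<nu>"
        using c X rE finE by (metis Diff_iff card_Suc_Diff1 card_insert_disjoint finite_Diff)
      then have "\<nu> \<le> card (E X')" using card_mono[OF finE sub] by simp
      then have c': "card (E X') = \<nu>" using \<nu>(2) g' by (metis le_antisym)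
      have "E X' = insert c (E X - {r})" using card_subset_eq[OF finE sub] cc c' by simp
      then have r': "r \<notin> E X'" using rE by simp
      have "Q (Suc t) X' r (insert c D) (\<pi>(c := f j))"
        unfolding Q_def
      proof (intro conjI)
        have cD: "c \<notin> D" using c D by blast
        show "card (insert c D) = Suc t" using cD finD D by simp
        show "insert c D \<subseteq> E X'" using sub D rE by blast
        show "inj_on (\<pi>(c := f j)) (insert c D)"
        proof -
          have "inj_on (\<pi>(c := f j)) D = inj_on \<pi> D" using cD by (intro inj_on_cong) auto
          moreover have "(\<pi>(c := f j)) ` D = \<pi> ` D" using cD by (intro image_cong) auto
          ultimately show ?thesis using cD \<pi>(1) fz(4)[OF ij(2)] by (simp add: inj_on_insert del: fun_upd_image)
        qed
        show "(\<pi>(c := f j)) ` insert c D \<subseteq> {z..<n}"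
          using cD \<pi>(2) fz[OF ij(2)] by auto
        show "\<forall>s\<in>insert c D. ed ((X' ((\<pi>(c := f j)) s))(\<alpha> := X' s \<alpha>))"
        proof
          fix s assume s: "s \<in> insert c D"
          show "ed ((X' ((\<pi>(c := f j)) s))(\<alpha> := X' s \<alpha>))"
          proof (cases "s = c")
            case True
            have "(X' (f j))(\<alpha> := X' c \<alpha>) = (T j)(j := X r j)"
              using X'f X'\<alpha> ij\<alpha> by (auto simp: T_def fun_upd_twist)
            then show ?thesis using True r(2) ij\<alpha> by (simp add: H_def)
          next
            case False
            then have sD: "s \<in> D" using s by blast
            then have "\<pi> s \<in> {z..<n}" using \<pi>(2) by blast
            then have "\<pi> s \<noteq> c" "\<pi> s \<noteq> r" "\<pi> s \<noteq> f i" "\<pi> s \<noteq> f j"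
              using c rE fz(4) ij sD by force+
            then show ?thesis using False X'o X'\<alpha> \<pi>(3)[OF sD] by simp
          qed
        qed
      qed (use g' c' rE r' in auto)
      then show ?thesis by blast
    qed
    obtain X where X: "good X" "card (E X) = \<nu>" using \<nu>(1) by blast
    obtain c where c: "c < z" "c \<notin> E X"
    proof -
      have "\<not> {..<z} \<subseteq> E X" using card_mono[OF finE, of "{..<z}" X] X less(1) by auto
      then show ?thesis using that by blast
    qed
    have "Q 0 X c {} id" using X c by (auto simp: Q_def)
    then have "\<exists>X c D \<pi>. Q t X c D \<pi>" for t
      by (induction t) (use step in blast)+
    then obtain X c D \<pi> where "Q (Suc \<nu>) X c D \<pi>" by blast
    then have "D \<subseteq> E X" "card D = Suc \<nu>" "card (E X) = \<nu>" by (auto simp: Q_def)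
    then show False using card_mono[OF finE] by (metis not_less_eq_eq order_refl)
  qed
qed

end

lemma extend_bij_betw:
  assumes "finite B" "card B = n" "t \<le> n" "inj_on f {..<t}" "f ` {..<t} \<subseteq> B"
  shows "\<exists>g. bij_betw g {..<n} B \<and> (\<forall>r<t. g r = f r)"
proof -
  have "card (B - f ` {..<t}) = card {t..<n}"
    using assms by (simp add: card_Diff_subset card_image)
  then obtain h where h: "bij_betw h {t..<n} (B - f ` {..<t})"
    using finite_same_card_bij assms(1) by (metis finite_Diff finite_atLeastLessThan)
  define g where "g r = (if r < t then f r else h r)" for r
  have "bij_betw g {..<t} (f ` {..<t})"
    using assms(4) by (auto simp: bij_betw_def g_def inj_on_def)
  moreover have "bij_betw g {t..<n} (B - f ` {..<t})"
    using bij_betw_cong[of "{t..<n}" g h "B - f ` {..<t}"] h by (simp add: g_def)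
  ultimately have "bij_betw g ({..<t} \<union> {t..<n}) (f ` {..<t} \<union> (B - f ` {..<t}))"
    by (rule bij_betw_combine) auto
  moreover have "{..<t} \<union> {t..<n} = {..<n}" "f ` {..<t} \<union> (B - f ` {..<t}) = B"
    using assms by auto
  ultimately show ?thesis by (metis g_def)
qed

section \<open>Extending partial columns to arrays; one codegree close to \<open>n\<close>\<close>

context kpartite_system
begin

text \<open>The number of prescribed rows may vary with the column, as it does in
  \<open>one_large_codegree\<close>.\<close>

lemma arr_extend:
  assumes "\<And>p. p \<in> K \<Longrightarrow> t p \<le> n \<and> inj_on (\<lambda>r. x r p) {..<t p} \<and> (\<lambda>r. x r p) ` {..<t p} \<subseteq> V p"
  shows "\<exists>X. arr X \<and> (\<forall>p\<in>K. \<forall>r<t p. X r p = x r p)"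
proof -
  have "\<exists>g. bij_betw g {..<n} (V p) \<and> (\<forall>r<t p. g r = x r p)" if "p \<in> K" for p
    using extend_bij_betw[of "V p" n "t p" "\<lambda>r. x r p"] card_V[OF that] assms[OF that] by blast
  then obtain g where "\<And>p. p \<in> K \<Longrightarrow> bij_betw (g p) {..<n} (V p) \<and> (\<forall>r<t p. g p r = x r p)"
    by metis
  then show ?thesis by (intro exI[of _ "\<lambda>r p. g p r"]) (auto simp: arr_def)
qed

lemma arr_exists: "\<exists>X. arr X"
  using arr_extend[of "\<lambda>_. 0"] by auto

text \<open>Few vertices of \<open>V \<alpha>\<close> fit less than half of the rows of
  \<open>X0\<close>; enough of these are matched by \<open>small_class_matching\<close>. Every other
  vertex of \<open>V \<alpha>\<close> fits more than \<open>L\<close> of the remaining rows, while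
  each row accepts at least \<open>n - L\<close> vertices, so a hole can exchange its
  \<open>\<alpha>\<close>-entry with some row to the benefit of both.\<close>

lemma one_large_codegree:
  assumes \<alpha>: "\<alpha> \<in> K" and s: "sum a K < n" "n \<le> sum a K + card K"
    and L: "n \<le> a \<alpha> + L" "(4 * card K + 6) * L + 2 * card K < n"
  shows "\<exists>X. arr X \<and> sum a K \<le> card (edge_rows X)"
proof -
  define s where "s = sum a K"
  define b where "b = sum a (K - {\<alpha>})"
  have sb: "s = a \<alpha> + b" unfolding s_def b_def using sum.remove[OF finite_K \<alpha>] by simp
  obtain X0 where X0: "arr X0" using arr_exists by blast
  define adj where "adj v = {r. r < n \<and> ed ((X0 r)(\<alpha> := v))}" for v
  define Z where "Z = {v \<in> V \<alpha>. 2 * card (adj v) < n}"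
  define z where "z = card Z"
  have V: "finite (V \<alpha>)" "card (V \<alpha>) = n" using card_V[OF \<alpha>] by auto
  have Z: "Z \<subseteq> V \<alpha>" "finite Z" using V by (auto simp: Z_def intro: finite_subset)
  have zn: "z \<le> n" unfolding z_def using Z V card_mono by metis
  \<comment> \<open>Each row misses at most \<open>L\<close> vertices, and each vertex of
    \<open>Z\<close> misses more than half of the rows.\<close>
  have z2: "z \<le> 2 * L"
  proof -
    have "n * a \<alpha> \<le> (\<Sum>r<n. card {v \<in> V \<alpha>. ed ((X0 r)(\<alpha> := v))})"
      using sum_bounded_below[of "{..<n}" "a \<alpha>"] codegree[OF \<alpha>] arr_mem[OF X0] by simp
    also have "\<dots> = (\<Sum>v\<in>V \<alpha>. card {r \<in> {..<n}. ed ((X0 r)(\<alpha> := v))})"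
      by (rule sum_multicount_gen) (use V in auto)
    also have "\<dots> = (\<Sum>v\<in>V \<alpha>. card (adj v))" by (simp add: adj_def)
    finally have "2 * (n * a \<alpha>) \<le> (\<Sum>v\<in>V \<alpha>. 2 * card (adj v))" by (simp add: sum_distrib_left[symmetric])
    also have "\<dots> = (\<Sum>v\<in>V \<alpha> - Z. 2 * card (adj v)) + (\<Sum>v\<in>Z. 2 * card (adj v))"
      using sum.subset_diff[OF Z(1) V(1)] by simp
    also have "\<dots> \<le> (n - z) * (2 * n) + z * n"
    proof (rule add_mono)
      have "card (adj v) \<le> n" for v using card_mono[of "{..<n}" "adj v"] by (auto simp: adj_def)
      then have "(\<Sum>v\<in>V \<alpha> - Z. 2 * card (adj v)) \<le> of_nat (card (V \<alpha> - Z)) * (2 * n)"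
        by (intro sum_bounded_above) simp
      then show "(\<Sum>v\<in>V \<alpha> - Z. 2 * card (adj v)) \<le> (n - z) * (2 * n)"
        using Z V by (simp add: card_Diff_subset z_def)
      have "(\<Sum>v\<in>Z. 2 * card (adj v)) \<le> of_nat (card Z) * n"
        by (intro sum_bounded_above) (simp add: Z_def)
      then show "(\<Sum>v\<in>Z. 2 * card (adj v)) \<le> z * n" by (simp add: z_def)
    qed
    finally have "n * (2 * a \<alpha>) \<le> n * (2 * (n - z) + z)" by (simp add: algebra_simps)
    then have "2 * a \<alpha> \<le> 2 * (n - z) + z" using s(1) by simp
    then show ?thesis using zn L(1) by linarith
  qed
  obtain f where f: "bij_betw f {..<z} Z" using Z(2) ex_bij_betw_nat_finite unfolding z_def
    by (metis atLeast0LessThan)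
  obtain X1 where X1: "arr X1" "\<forall>r<z. X1 r \<alpha> = f r"
  proof -
    have "(if p = \<alpha> then z else 0) \<le> n \<and> inj_on (\<lambda>r. f r) {..<if p = \<alpha> then z else 0} \<and>
      (\<lambda>r. f r) ` {..<if p = \<alpha> then z else 0} \<subseteq> V p" if "p \<in> K" for p
      using f zn Z by (auto simp: bij_betw_def)
    from arr_extend[of "\<lambda>p. if p = \<alpha> then z else 0" "\<lambda>r p. f r", OF this] \<alpha> that
    show ?thesis by auto
  qed
  have KL: "card K * z \<le> 2 * card K * L" using z2 by simp
  have L2: "4 * (card K * L) + 6 * L + 2 * card K < n" using L(2) by (simp add: algebra_simps)
  have "2 * z + card K \<le> n" using z2 L2 by linarith
  from small_class_matching[OF X1(1) \<alpha> this] obtain X2 where X2: "arr X2" "\<forall>r. X2 r \<alpha> = X1 r \<alpha>"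
    "min z ((a \<alpha> - (n - z)) + b) \<le> card (edge_rows X2 \<inter> {..<z})" unfolding b_def by blast
  define \<nu> where "\<nu> = min z ((a \<alpha> - (n - z)) + b)"
  have \<nu>: "\<nu> \<le> z" "\<nu> \<le> s" "s - \<nu> \<le> n - z" using s sb zn unfolding \<nu>_def s_def by linarith+
  obtain N where N: "N \<subseteq> edge_rows X2 \<inter> {..<z}" "card N = \<nu>"
    using X2(3) obtain_subset_with_card_n unfolding \<nu>_def by metis
  have finN: "finite N" using N(1) finite_subset by blast
  obtain \<iota> where \<iota>: "bij_betw \<iota> {..<\<nu>} N" using finN N(2) ex_bij_betw_nat_finite by (metis atLeast0LessThan)
  \<comment> \<open>The rows of \<open>X0\<close> that avoid the matched vertices. Each matched row
    spoils at most one row per column, so at least \<open>u\<close> remain.\<close>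
  define U where "U = {r. r < n \<and> (\<forall>p\<in>K - {\<alpha>}. \<forall>h\<in>N. X0 r p \<noteq> X2 h p)}"
  define u where "u = n - card K * z"
  have "card ({..<n} - U) \<le> card K * z"
  proof -
    have "{..<n} - U \<subseteq> (\<Union>p\<in>K. \<Union>h\<in>N. {r. r < n \<and> X0 r p = X2 h p})" by (auto simp: U_def)
    then have "card ({..<n} - U) \<le> card (\<Union>p\<in>K. \<Union>h\<in>N. {r. r < n \<and> X0 r p = X2 h p})"
      using finite_K finN by (intro card_mono) auto
    also have "\<dots> \<le> (\<Sum>p\<in>K. card (\<Union>h\<in>N. {r. r < n \<and> X0 r p = X2 h p}))"
      by (rule card_UN_le[OF finite_K])
    also have "\<dots> \<le> (\<Sum>p\<in>K. \<nu>)"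
    proof (rule sum_mono)
      fix p assume p: "p \<in> K"
      have "card {r. r < n \<and> X0 r p = X2 h p} \<le> 1" for h
      proof -
        have "\<forall>x\<in>{r. r < n \<and> X0 r p = X2 h p}. \<forall>y\<in>{r. r < n \<and> X0 r p = X2 h p}. x = y"
          using arr_inj[OF X0 p] by auto
        then show ?thesis by (simp add: card_le_Suc0_iff_eq)
      qed
      then have "(\<Sum>h\<in>N. card {r. r < n \<and> X0 r p = X2 h p}) \<le> of_nat (card N) * 1"
        by (intro sum_bounded_above) simp
      then show "card (\<Union>h\<in>N. {r. r < n \<and> X0 r p = X2 h p}) \<le> \<nu>"
        using card_UN_le[OF finN, of "\<lambda>h. {r. r < n \<and> X0 r p = X2 h p}"] N(2) by simp
    qed
    also have "\<dots> \<le> card K * z" using \<nu>(1) by simp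
    finally show ?thesis .
  qed
  moreover have "card ({..<n} - U) = n - card U"
    by (subst card_Diff_subset) (auto simp: U_def)
  ultimately have "u \<le> card U" unfolding u_def by linarith
  then obtain U' where U': "U' \<subseteq> U" "card U' = u" using obtain_subset_with_card_n by metis
  have finU': "finite U'" using U'(1) by (auto simp: U_def intro: finite_subset)
  obtain \<rho> where \<rho>: "bij_betw \<rho> {..<u} U'"
    using ex_bij_betw_nat_finite[OF finU'] U'(2) by (auto simp: atLeast0LessThan)
  define P where "P = V \<alpha> - Z"
  have "card P = n - z" unfolding P_def z_def using Z V by (simp add: card_Diff_subset)
  then obtain P' where P': "P' \<subseteq> P" "card P' = s - \<nu>" using \<nu>(3) obtain_subset_with_card_n by metis
  have "finite P'" using P'(1) V by (auto simp: P_def intro: finite_subset)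
  then obtain \<theta> where \<theta>: "bij_betw \<theta> {..<s - \<nu>} P'" using P'(2) ex_bij_betw_nat_finite by (metis atLeast0LessThan)
  \<comment> \<open>The matching on \<open>Z\<close> comes on top. Below it, column
    \<open>\<alpha>\<close> takes vertices outside \<open>Z\<close> up to row \<open>s\<close>, and
    the other columns continue with rows of \<open>X0\<close> up to row
    \<open>\<nu> + u\<close>.\<close>
  define x where "x r p = (if r < \<nu> then X2 (\<iota> r) p else if p = \<alpha> then \<theta> (r - \<nu>) else X0 (\<rho> (r - \<nu>)) p)" for r p
  define t where "t p = (if p = \<alpha> then s else \<nu> + u)" for p
  have \<iota>N: "\<iota> r \<in> N" if "r < \<nu>" for r using bij_betw_apply[OF \<iota>] that by simp
  have Nn: "h < n" "h < z" "ed (X2 h)" if "h \<in> N" for h using N(1) that by (auto simp: edge_rows_def)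
  have \<rho>U: "\<rho> r \<in> U" "\<rho> r < n" if "r < u" for r
    using bij_betw_apply[OF \<rho>, of r] that U'(1) by (auto simp: U_def)
  have tn: "t p \<le> n" for p
  proof -
    have "z \<le> card K * z" using \<alpha> finite_K by (cases "card K") auto
    moreover have "card K * z \<le> n" using KL L2 by linarith
    ultimately have "\<nu> + u \<le> n" using \<nu>(1) unfolding u_def by linarith
    then show ?thesis using s(1) by (simp add: t_def s_def)
  qed
  have xV: "inj_on (\<lambda>r. x r p) {..<t p} \<and> (\<lambda>r. x r p) ` {..<t p} \<subseteq> V p" if p: "p \<in> K" for p
  proof (cases "p = \<alpha>")
    case True
    have 1: "x r p \<in> Z" if "r < \<nu>" for r
      using that True X2(2) X1(2) \<iota>N[OF that] Nn bij_betw_apply[OF f] by (simp add: x_def)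
    have 2: "x r p \<in> P'" if "\<not> r < \<nu>" "r < s" for r
      using that True bij_betw_apply[OF \<theta>, of "r - \<nu>"] by (simp add: x_def)
    have "inj_on (\<lambda>r. x r p) {..<s}"
    proof (rule inj_onI)
      fix q r assume qr: "q \<in> {..<s}" "r \<in> {..<s}" "x q p = x r p"
      have "Z \<inter> P' = {}" using P'(1) by (auto simp: P_def)
      then have same: "q < \<nu> \<longleftrightarrow> r < \<nu>" using 1[of q] 1[of r] 2[of q] 2[of r] qr by auto
      show "q = r"
      proof (cases "q < \<nu>")
        case True
        then have "\<iota> q = \<iota> r" using qr same arr_inj[OF X2(1) p] \<iota>N Nn by (simp add: x_def)
        then show ?thesis using \<iota> True same by (auto simp: bij_betw_def inj_on_def)
      next
        case False
        then have "\<theta> (q - \<nu>) = \<theta> (r - \<nu>)" using qr same \<open>p = \<alpha>\<close> by (simp add: x_def)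
        then have "q - \<nu> = r - \<nu>" using \<theta> qr False same by (auto simp: bij_betw_def inj_on_def)
        then show ?thesis using False same by linarith
      qed
    qed
    moreover have "(\<lambda>r. x r p) ` {..<s} \<subseteq> V p"
    proof (rule image_subsetI)
      fix r assume "r \<in> {..<s}"
      then show "x r p \<in> V p" using 1[of r] 2[of r] Z(1) P'(1) True by (auto simp: P_def)
    qed
    ultimately show ?thesis using True by (simp add: t_def)
  next
    case False
    have "inj_on (\<lambda>r. x r p) {..<\<nu> + u}"
    proof (rule inj_onI)
      fix q r assume qr: "q \<in> {..<\<nu> + u}" "r \<in> {..<\<nu> + u}" "x q p = x r p"
      have ne: "X2 (\<iota> i) p \<noteq> X0 (\<rho> (j - \<nu>)) p" if "i < \<nu>" "\<not> j < \<nu>" "j < \<nu> + u" for i j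
      proof -
        have "\<rho> (j - \<nu>) \<in> U" using that \<rho>U(1)[of "j - \<nu>"] by simp
        then show ?thesis using \<iota>N[OF that(1)] p False unfolding U_def by force
      qed
      have same: "q < \<nu> \<longleftrightarrow> r < \<nu>" using ne[of q r] ne[of r q] qr False by (auto simp: x_def split: if_splits)
      show "q = r"
      proof (cases "q < \<nu>")
        case True
        then have "\<iota> q = \<iota> r" using qr same arr_inj[OF X2(1) p] \<iota>N Nn by (simp add: x_def)
        then show ?thesis using \<iota> True same by (auto simp: bij_betw_def inj_on_def)
      next
        case nu: False
        have lt: "q - \<nu> < u" "r - \<nu> < u" using qr nu same by auto
        then have "\<rho> (q - \<nu>) = \<rho> (r - \<nu>)" using qr nu same False arr_inj[OF X0 p] \<rho>U(2) by (simp add: x_def)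
        then have "q - \<nu> = r - \<nu>" using \<rho> lt by (auto simp: bij_betw_def inj_on_def)
        then show ?thesis using nu same by linarith
      qed
    qed
    moreover have "x r p \<in> V p" if "r < \<nu> + u" for r
    proof (cases "r < \<nu>")
      case True
      then show ?thesis using arr_mem[OF X2(1) p] \<iota>N Nn by (simp add: x_def)
    next
      case nu: False
      then show ?thesis using arr_mem[OF X0 p] \<rho>U(2)[of "r - \<nu>"] that False by (simp add: x_def)
    qed
    ultimately show ?thesis using False by (auto simp: t_def)
  qed
  obtain X3 where X3: "arr X3" "\<forall>p\<in>K. \<forall>r<t p. X3 r p = x r p"
    using arr_extend[of t x] tn xV by blast
  \<comment> \<open>Only \<open>\<alpha>\<close>-entries of rows from \<open>\<nu>\<close> on may
    change, and those above row \<open>s\<close> have to stay outside \<open>Z\<close>.\<close>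
  define good where "good Y \<longleftrightarrow> arr Y \<and> (\<forall>r p. p \<noteq> \<alpha> \<longrightarrow> Y r p = X3 r p) \<and> (\<forall>r<\<nu>. Y r \<alpha> = X3 r \<alpha>) \<and>
    (\<forall>r. \<nu> \<le> r \<and> r < s \<longrightarrow> Y r \<alpha> \<in> P)" for Y
  define E where "E Y = edge_rows Y \<inter> {..<s}" for Y
  have "good X3"
  proof -
    have "X3 r \<alpha> \<in> P" if "\<nu> \<le> r" "r < s" for r
    proof -
      have "X3 r \<alpha> = \<theta> (r - \<nu>)" using that X3(2) \<alpha> by (simp add: t_def x_def)
      moreover have "\<theta> (r - \<nu>) \<in> P'" using bij_betw_apply[OF \<theta>, of "r - \<nu>"] that by simp
      ultimately show ?thesis using P'(1) by auto
    qed
    then show ?thesis using X3(1) by (simp add: good_def)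
  qed
  let ?M = "\<lambda>m. \<exists>Y. good Y \<and> card (E Y) = m"
  have "card (E Y) \<le> s" for Y using card_mono[of "{..<s}" "E Y"] by (simp add: E_def)
  then obtain m where m: "?M m" "\<And>m'. ?M m' \<Longrightarrow> m' \<le> m"
    using Nat.ex_has_greatest_nat[of ?M "card (E X3)" s] \<open>good X3\<close> by blast
  then obtain Y where Y: "good Y" "card (E Y) = m" by blast
  have arrY: "arr Y" using Y by (simp add: good_def)
  have sn: "r < n" if "r < s" for r using that s by (simp add: s_def)
  have "r \<in> E Y" if rs: "r < s" for r
  proof (rule ccontr)
    assume rE: "r \<notin> E Y"
    then have rh: "\<not> ed (Y r)" using rs sn by (auto simp: E_def edge_rows_def)
    have r\<nu>: "\<nu> \<le> r"
    proof (rule ccontr)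
      assume "\<not> \<nu> \<le> r"
      then have r: "r < \<nu>" by simp
      have "Y r p = X2 (\<iota> r) p" if "p \<in> K" for p
      proof -
        have "Y r p = X3 r p" using Y(1) r by (cases "p = \<alpha>") (auto simp: good_def)
        moreover have "r < t p" using r rs by (auto simp: t_def)
        ultimately show ?thesis using X3(2) that r by (simp add: x_def)
      qed
      then have "ed (Y r) = ed (X2 (\<iota> r))" by (rule ed_cong)
      then show False using rh Nn \<iota>N[OF r] by simp
    qed
    define v where "v = Y r \<alpha>"
    have "v \<in> P" using Y(1) r\<nu> rs by (auto simp: good_def v_def)
    then have adj: "n \<le> 2 * card (adj v)" by (auto simp: P_def Z_def)
    define w where "w = min (s - \<nu>) u"
    define A where "A = {q. \<nu> \<le> q \<and> q < s \<and> ed ((Y q)(\<alpha> := v))}"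
    have finA: "finite A" by (simp add: A_def)
    have "adj v \<inter> \<rho> ` {..<w} \<subseteq> (\<lambda>q. \<rho> (q - \<nu>)) ` A"
    proof
      fix i assume "i \<in> adj v \<inter> \<rho> ` {..<w}"
      then obtain j where j: "i = \<rho> j" "j < w" "ed ((X0 i)(\<alpha> := v))" by (auto simp: adj_def)
      have js: "\<nu> + j < s" "j < u" using j(2) by (auto simp: w_def)
      have "((Y (\<nu> + j))(\<alpha> := v)) p = ((X0 i)(\<alpha> := v)) p" if "p \<in> K" for p
        using that Y(1) X3(2) js j(1) by (cases "p = \<alpha>") (auto simp: good_def t_def x_def)
      then have "ed ((Y (\<nu> + j))(\<alpha> := v))" using ed_cong j(3) by metis
      then show "i \<in> (\<lambda>q. \<rho> (q - \<nu>)) ` A" using js j(1) by (intro image_eqI[of _ _ "\<nu> + j"]) (auto simp: A_def)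
    qed
    then have "card (adj v \<inter> \<rho> ` {..<w}) \<le> card A"
      by (meson card_image_le card_mono finA finite_imageI order_trans)
    moreover have "card (adj v) \<le> card (adj v \<inter> \<rho> ` {..<w}) + (n - w)"
    proof -
      have "inj_on \<rho> {..<w}" using inj_on_subset[OF bij_betw_imp_inj_on[OF \<rho>]] by (simp add: w_def)
      moreover have "\<rho> ` {..<w} \<subseteq> {..<n}" using \<rho>U(2) by (auto simp: w_def)
      ultimately have "card ({..<n} - \<rho> ` {..<w}) = n - w"
        by (simp add: card_Diff_subset card_image)
      moreover have "adj v \<subseteq> (adj v \<inter> \<rho> ` {..<w}) \<union> ({..<n} - \<rho> ` {..<w})" by (auto simp: adj_def)
      then have "card (adj v) \<le> card ((adj v \<inter> \<rho> ` {..<w}) \<union> ({..<n} - \<rho> ` {..<w}))"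
        by (intro card_mono) (auto simp: adj_def)
      ultimately show ?thesis using card_Un_le[of "adj v \<inter> \<rho> ` {..<w}" "{..<n} - \<rho> ` {..<w}"] by linarith
    qed
    moreover have "n - w \<le> card K * z + z + card K"
      using s(2) \<nu>(1) unfolding w_def u_def s_def by linarith
    \<comment> \<open>With \<open>z \<le> 2 * L\<close> this is precisely the assumption on
      \<open>(4 * card K + 6) * L + 2 * card K\<close>.\<close>
    ultimately have cA: "L < card A" using adj z2 KL L2 by linarith
    define B where "B = {q. q < n \<and> ed ((Y r)(\<alpha> := Y q \<alpha>))}"
    have "a \<alpha> \<le> card B" unfolding B_def using card_hits[OF arrY \<alpha>, of "Y r"] arr_mem[OF arrY] sn[OF rs] by auto
    moreover have "\<not> A \<inter> B = {}"
    proof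
      assume "A \<inter> B = {}"
      then have "card A + card B = card (A \<union> B)" using finA by (simp add: card_Un_disjoint B_def)
      also have "\<dots> \<le> card {..<n}" using sn by (intro card_mono) (auto simp: A_def B_def)
      finally show False using cA L(1) \<open>a \<alpha> \<le> card B\<close> by simp
    qed
    ultimately obtain q where q: "q \<in> A" "q \<in> B" by blast
    have qr: "q \<noteq> r" using q(1) rh by (auto simp: A_def v_def)
    define Y' where "Y' = sw \<alpha> r q Y"
    have qs: "\<nu> \<le> q" "q < s" using q by (auto simp: A_def)
    have "good Y'"
      using Y(1) rs r\<nu> qs sn unfolding good_def Y'_def
      by (auto simp: arr_sw sw_apply)
    moreover have "insert r (E Y) \<subseteq> E Y'"
    proof
      fix i assume i: "i \<in> insert r (E Y)"
      have "Y' r = (Y r)(\<alpha> := Y q \<alpha>)" "Y' q = (Y q)(\<alpha> := v)" using qr by (simp_all add: Y'_def v_def)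
      moreover have "Y' j = Y j" if "j \<noteq> r" "j \<noteq> q" for j using that by (simp add: Y'_def)
      ultimately have "ed (Y' i)"
        using i q by (cases "i = r \<or> i = q") (auto simp: A_def B_def E_def edge_rows_def)
      then show "i \<in> E Y'" using i rs sn by (auto simp: E_def edge_rows_def)
    qed
    then have "card (insert r (E Y)) \<le> card (E Y')" by (intro card_mono) (auto simp: E_def)
    ultimately show False using m(2)[of "card (E Y')"] Y(2) rE by (auto simp: E_def)
  qed
  then have "{..<s} \<subseteq> edge_rows Y" by (auto simp: E_def)
  then have "s \<le> card (edge_rows Y)" using card_mono[of "edge_rows Y" "{..<s}"] by simp
  then show ?thesis using arrY by (auto simp: s_def)
qed

end

section \<open>Absorbers\<close>

text \<open>As \<open>A\<close> ignores coordinate \<open>i\<close>, it is a union of lines in that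
  direction, and on each line at least \<open>m\<close> of the \<open>n\<close> points satisfy
  \<open>B\<close>. This is the bound \<open>m / n\<close> for a conditional probability, stated
  without division.\<close>

lemma fibre_lower:
  fixes W :: "'d \<Rightarrow> 'w set"
  assumes D: "finite D" "i \<in> D" and W: "\<And>p. p \<in> D \<Longrightarrow> finite (W p) \<and> card (W p) = n"
    and inv: "\<And>z v. A (z(i := v)) = A z"
    and m: "\<And>z. z \<in> PiE D W \<Longrightarrow> A z \<Longrightarrow> m \<le> card {v \<in> W i. B (z(i := v))}"
  shows "card {z \<in> PiE D W. A z} * m \<le> card {z \<in> PiE D W. A z \<and> B z} * n"
proof (rule double_count[where R = "\<lambda>z y. \<exists>v\<in>W i. y = z(i := v)"])
  have fin: "finite (PiE D W)" using D W by (intro finite_PiE) auto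
  then show "finite {z \<in> PiE D W. A z}" "finite {z \<in> PiE D W. A z \<and> B z}" by auto
  fix z assume z: "z \<in> {z \<in> PiE D W. A z}"
  have "m \<le> card {v \<in> W i. B (z(i := v))}" using m z by blast
  also have "\<dots> = card ((\<lambda>v. z(i := v)) ` {v \<in> W i. B (z(i := v))})"
    by (rule card_image[symmetric]) (metis (mono_tags, lifting) fun_upd_same inj_onI)
  also have "\<dots> \<le> card {y \<in> {z \<in> PiE D W. A z \<and> B z}. \<exists>v\<in>W i. y = z(i := v)}"
    using z D inv by (intro card_mono[OF finite_subset[OF _ fin]]) (auto simp: PiE_iff extensional_def)
  finally show "m \<le> card {y \<in> {z \<in> PiE D W. A z \<and> B z}. \<exists>v\<in>W i. y = z(i := v)}" .
next
  fix y assume y: "y \<in> {z \<in> PiE D W. A z \<and> B z}"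
  have "x \<in> (\<lambda>u. y(i := u)) ` W i" if "x \<in> PiE D W" "y = x(i := v)" for x v
    using that D by (intro image_eqI[of _ _ "x i"]) auto
  then have "{x \<in> {z \<in> PiE D W. A z}. \<exists>v\<in>W i. y = x(i := v)} \<subseteq> (\<lambda>u. y(i := u)) ` W i"
    by blast
  then have "card {x \<in> {z \<in> PiE D W. A z}. \<exists>v\<in>W i. y = x(i := v)} \<le> card ((\<lambda>u. y(i := u)) ` W i)"
    using W D by (intro card_mono) auto
  also have "\<dots> \<le> n" using card_image_le[of "W i"] W[OF D(2)] by metis
  finally show "card {x \<in> {z \<in> PiE D W. A z}. \<exists>v\<in>W i. y = x(i := v)} \<le> n" .
qed

text \<open>Averaging over the lines in direction \<open>i\<close>, each of which has at most
  \<open>m\<close> points in \<open>B\<close>. It bounds the density of unwanted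
  coincidences.\<close>

lemma fibre_upper:
  fixes W :: "'d \<Rightarrow> 'w set"
  assumes D: "finite D" "i \<in> D" and W: "\<And>p. p \<in> D \<Longrightarrow> finite (W p) \<and> card (W p) = n"
    and m: "\<And>z. z \<in> PiE D W \<Longrightarrow> card {v \<in> W i. B (z(i := v))} \<le> m"
  shows "card {z \<in> PiE D W. B z} * n \<le> card (PiE D W) * m"
proof (rule double_count[where R = "\<lambda>z y. \<exists>v\<in>W i. y = z(i := v)"])
  show fin: "finite (PiE D W)" using D W by (intro finite_PiE) auto
  then show "finite {z \<in> PiE D W. B z}" by auto
  fix z assume z: "z \<in> {z \<in> PiE D W. B z}"
  have "n = card (W i)" using W D by simp
  also have "\<dots> = card ((\<lambda>v. z(i := v)) ` W i)"
    by (rule card_image[symmetric]) (metis (mono_tags, lifting) fun_upd_same inj_onI)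
  also have "\<dots> \<le> card {y \<in> PiE D W. \<exists>v\<in>W i. y = z(i := v)}"
    using z D by (intro card_mono[OF finite_subset[OF _ fin]]) (auto simp: PiE_iff extensional_def)
  finally show "n \<le> card {y \<in> PiE D W. \<exists>v\<in>W i. y = z(i := v)}" .
next
  fix y assume y: "y \<in> PiE D W"
  have "x \<in> (\<lambda>u. y(i := u)) ` {v \<in> W i. B (y(i := v))}" if "x \<in> PiE D W" "B x" "y = x(i := v)" for x v
    using that D by (intro image_eqI[of _ _ "x i"]) auto
  then have "{x \<in> {z \<in> PiE D W. B z}. \<exists>v\<in>W i. y = x(i := v)} \<subseteq> (\<lambda>u. y(i := u)) ` {v \<in> W i. B (y(i := v))}"
    by blast
  then have "card {x \<in> {z \<in> PiE D W. B z}. \<exists>v\<in>W i. y = x(i := v)} \<le> card ((\<lambda>u. y(i := u)) ` {v \<in> W i. B (y(i := v))})"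
    using W D by (intro card_mono) auto
  also have "\<dots> \<le> m" using card_image_le[of "{v \<in> W i. B (y(i := v))}"] W[OF D(2)] m[OF y]
    by (metis (no_types, lifting) finite_subset le_trans mem_Collect_eq subsetI)
  finally show "card {x \<in> {z \<in> PiE D W. B z}. \<exists>v\<in>W i. y = x(i := v)} \<le> m" .
qed

text \<open>Derandomised sampling: choosing the gadgets one after the other so as to minimise the potential
  \<open>\<Sum>q. 2 ^ - (number of accepted gadgets)\<close> makes the potential shrink geometrically.\<close>

lemma greedy_cover:
  fixes acc :: "'q \<Rightarrow> 'g \<Rightarrow> bool" and vs :: "'g \<Rightarrow> 'w set" and \<theta> :: real
  assumes Q: "finite Q" "Q \<noteq> {}" and \<Gamma>: "finite \<Gamma>" "\<Gamma> \<noteq> {}" and \<theta>: "0 < \<theta>"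
    and vs: "\<And>g. g \<in> \<Gamma> \<Longrightarrow> finite (vs g) \<and> card (vs g) \<le> w"
    and dense: "\<And>U q. q \<in> Q \<Longrightarrow> finite U \<Longrightarrow> card U \<le> w * t \<Longrightarrow>
      \<theta> * card \<Gamma> \<le> card {g \<in> \<Gamma>. acc q g \<and> vs g \<inter> U = {}}"
    and small: "card Q * (1 - \<theta> / 2) ^ t < (1 / 2) ^ k"
  shows "\<exists>\<gamma>. (\<forall>i<t. \<gamma> i \<in> \<Gamma>) \<and> (\<forall>i<t. \<forall>j<t. i \<noteq> j \<longrightarrow> vs (\<gamma> i) \<inter> vs (\<gamma> j) = {}) \<and>
    (\<forall>q\<in>Q. k < card {i. i < t \<and> acc q (\<gamma> i)})"
proof -
  define N where "N s \<gamma> q = card {i. i < s \<and> acc q (\<gamma> i)}" for s :: nat and \<gamma> q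
  define \<Phi> where "\<Phi> s \<gamma> = (\<Sum>q\<in>Q. (1 / 2 :: real) ^ N s \<gamma> q)" for s \<gamma>
  have "\<exists>\<gamma>. (\<forall>i<s. \<gamma> i \<in> \<Gamma>) \<and> (\<forall>i<s. \<forall>j<s. i \<noteq> j \<longrightarrow> vs (\<gamma> i) \<inter> vs (\<gamma> j) = {}) \<and>
    \<Phi> s \<gamma> \<le> card Q * (1 - \<theta> / 2) ^ s" if "s \<le> t" for s
    using that
  proof (induction s)
    case 0
    then show ?case by (simp add: \<Phi>_def N_def)
  next
    case (Suc s)
    then obtain \<gamma> where \<gamma>: "\<forall>i<s. \<gamma> i \<in> \<Gamma>" "\<forall>i<s. \<forall>j<s. i \<noteq> j \<longrightarrow> vs (\<gamma> i) \<inter> vs (\<gamma> j) = {}"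
      "\<Phi> s \<gamma> \<le> card Q * (1 - \<theta> / 2) ^ s" by auto
    define U where "U = (\<Union>i<s. vs (\<gamma> i))"
    have finU: "finite U" using \<gamma>(1) vs by (auto simp: U_def)
    have "card U \<le> (\<Sum>i<s. card (vs (\<gamma> i)))" unfolding U_def by (rule card_UN_le) simp
    also have "\<dots> \<le> (\<Sum>i<s. w)" using \<gamma>(1) vs by (intro sum_mono) auto
    also have "\<dots> \<le> w * t" using Suc.prems by simp
    finally have cU: "card U \<le> w * t" .
    define \<Gamma>' where "\<Gamma>' = {g \<in> \<Gamma>. vs g \<inter> U = {}}"
    have fin': "finite \<Gamma>'" using \<Gamma> by (simp add: \<Gamma>'_def)
    have acc: "\<theta> * card \<Gamma> \<le> card {g \<in> \<Gamma>'. acc q g}" if "q \<in> Q" for q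
    proof -
      have "{g \<in> \<Gamma>'. acc q g} = {g \<in> \<Gamma>. acc q g \<and> vs g \<inter> U = {}}" by (auto simp: \<Gamma>'_def)
      then show ?thesis using dense[OF that finU cU] by simp
    qed
    have le: "real (card \<Gamma>') \<le> card \<Gamma>" using \<Gamma> by (auto simp: \<Gamma>'_def intro: card_mono)
    have pos: "0 < \<theta> * card \<Gamma>" using \<Gamma> \<theta> by (simp add: card_gt_0_iff)
    have ne: "\<Gamma>' \<noteq> {}"
    proof
      assume "\<Gamma>' = {}"
      then show False using acc Q(2) pos by fastforce
    qed
    define h where "h q = (1 / 2 :: real) ^ N s \<gamma> q" for q
    \<comment> \<open>The potential after adding \<open>g\<close>. Accepting \<open>g\<close> halves
      the term of \<open>q\<close>, and for each \<open>q\<close> at least a fraction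
      \<open>\<theta>\<close> of the gadgets is still usable and accepted, so the factor is at most
      \<open>1 - \<theta> / 2\<close> on average.\<close>
    define \<Psi> where "\<Psi> g = (\<Sum>q\<in>Q. h q * (if acc q g then 1 / 2 else 1))" for g
    have "(\<Sum>g\<in>\<Gamma>'. \<Psi> g) = (\<Sum>q\<in>Q. \<Sum>g\<in>\<Gamma>'. h q * (if acc q g then 1 / 2 else 1))"
      unfolding \<Psi>_def by (rule sum.swap)
    also have "\<dots> \<le> (\<Sum>q\<in>Q. h q * (card \<Gamma>' * (1 - \<theta> / 2)))"
    proof (rule sum_mono)
      fix q assume q: "q \<in> Q"
      have "(\<Sum>g\<in>\<Gamma>'. (if acc q g then 1 / 2 else (1 :: real))) = (\<Sum>g\<in>\<Gamma>'. 1 - (if acc q g then 1 / 2 else 0))"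
        by (intro sum.cong) auto
      also have "\<dots> = card \<Gamma>' - (\<Sum>g\<in>\<Gamma>'. if acc q g then 1 / 2 else 0)"
        by (simp add: sum_subtractf)
      also have "(\<Sum>g\<in>\<Gamma>'. if acc q g then 1 / 2 else (0 :: real)) = (\<Sum>g\<in>{g \<in> \<Gamma>'. acc q g}. 1 / 2)"
        by (rule sum.inter_filter[OF fin', symmetric])
      also have "real (card \<Gamma>') - (\<Sum>g\<in>{g \<in> \<Gamma>'. acc q g}. 1 / 2) \<le> card \<Gamma>' - \<theta> * card \<Gamma> / 2"
        using acc[OF q] by simp
      also have "\<dots> \<le> card \<Gamma>' * (1 - \<theta> / 2)"
        using mult_left_mono[OF le, of \<theta>] \<theta> by (simp add: algebra_simps)
      finally have "(\<Sum>g\<in>\<Gamma>'. (if acc q g then 1 / 2 else (1 :: real))) \<le> card \<Gamma>' * (1 - \<theta> / 2)" .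
      then have "h q * (\<Sum>g\<in>\<Gamma>'. (if acc q g then 1 / 2 else 1)) \<le> h q * (card \<Gamma>' * (1 - \<theta> / 2))"
        by (intro mult_left_mono) (auto simp: h_def)
      then show "(\<Sum>g\<in>\<Gamma>'. h q * (if acc q g then 1 / 2 else 1)) \<le> h q * (card \<Gamma>' * (1 - \<theta> / 2))"
        by (simp add: sum_distrib_left)
    qed
    also have "\<dots> = card \<Gamma>' * ((1 - \<theta> / 2) * \<Phi> s \<gamma>)"
      by (simp add: \<Phi>_def h_def sum_distrib_left sum_distrib_right algebra_simps)
    finally have sum_le: "(\<Sum>g\<in>\<Gamma>'. \<Psi> g) \<le> (\<Sum>g\<in>\<Gamma>'. (1 - \<theta> / 2) * \<Phi> s \<gamma>)" by simp
    have "\<exists>g\<in>\<Gamma>'. \<Psi> g \<le> (1 - \<theta> / 2) * \<Phi> s \<gamma>"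
    proof (rule ccontr)
      assume "\<not> ?thesis"
      then have "(1 - \<theta> / 2) * \<Phi> s \<gamma> < \<Psi> g" if "g \<in> \<Gamma>'" for g using that by force
      then have "(\<Sum>g\<in>\<Gamma>'. (1 - \<theta> / 2) * \<Phi> s \<gamma>) < (\<Sum>g\<in>\<Gamma>'. \<Psi> g)"
        by (intro sum_strict_mono fin' ne)
      then show False using sum_le by simp
    qed
    then obtain g where g: "g \<in> \<Gamma>'" "\<Psi> g \<le> (1 - \<theta> / 2) * \<Phi> s \<gamma>" by blast
    define \<gamma>' where "\<gamma>' = \<gamma>(s := g)"
    have "card {g \<in> \<Gamma>'. acc q g} \<le> card \<Gamma>'" for q using fin' by (intro card_mono) auto
    then have "\<theta> * card \<Gamma> \<le> card \<Gamma>"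
      using acc Q(2) le by (metis all_not_in_conv of_nat_le_iff order_trans)
    then have "\<theta> \<le> 1" using \<Gamma> by (simp add: card_gt_0_iff)
    have "N (Suc s) \<gamma>' q = N s \<gamma> q + (if acc q g then 1 else 0)" for q
    proof -
      have "{i. i < Suc s \<and> acc q (\<gamma>' i)} = {i. i < s \<and> acc q (\<gamma> i)} \<union> (if acc q g then {s} else {})"
        by (auto simp: \<gamma>'_def less_Suc_eq)
      then show ?thesis by (auto simp: N_def)
    qed
    then have "\<Phi> (Suc s) \<gamma>' = \<Psi> g" unfolding \<Phi>_def \<Psi>_def h_def by (intro sum.cong) auto
    also have "\<dots> \<le> (1 - \<theta> / 2) * (card Q * (1 - \<theta> / 2) ^ s)"
      using g(2) \<gamma>(3) \<open>\<theta> \<le> 1\<close> mult_left_mono[OF \<gamma>(3), of "1 - \<theta> / 2"] by linarith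
    finally have "\<Phi> (Suc s) \<gamma>' \<le> card Q * (1 - \<theta> / 2) ^ Suc s" by (simp add: algebra_simps)
    moreover have "\<forall>i<Suc s. \<gamma>' i \<in> \<Gamma>" using \<gamma>(1) g(1) by (auto simp: \<gamma>'_def \<Gamma>'_def less_Suc_eq)
    moreover have "\<forall>i<Suc s. \<forall>j<Suc s. i \<noteq> j \<longrightarrow> vs (\<gamma>' i) \<inter> vs (\<gamma>' j) = {}"
    proof -
      have "vs g \<inter> vs (\<gamma> i) = {}" if "i < s" for i using g(1) that by (auto simp: \<Gamma>'_def U_def)
      then show ?thesis using \<gamma>(2) by (fastforce simp: \<gamma>'_def less_Suc_eq)
    qed
    ultimately show ?case by blast
  qed
  then obtain \<gamma> where \<gamma>: "\<forall>i<t. \<gamma> i \<in> \<Gamma>" "\<forall>i<t. \<forall>j<t. i \<noteq> j \<longrightarrow> vs (\<gamma> i) \<inter> vs (\<gamma> j) = {}"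
    "\<Phi> t \<gamma> \<le> card Q * (1 - \<theta> / 2) ^ t" by blast
  have "k < N t \<gamma> q" if q: "q \<in> Q" for q
  proof (rule ccontr)
    assume "\<not> k < N t \<gamma> q"
    \<comment> \<open>A point with at most \<open>k\<close> accepted gadgets would keep the
      potential at \<open>(1 / 2) ^ k\<close> or more by its own term.\<close>
    then have "(1 / 2 :: real) ^ k \<le> (1 / 2) ^ N t \<gamma> q" by (intro power_decreasing) auto
    also have "\<dots> \<le> \<Phi> t \<gamma>" unfolding \<Phi>_def using q Q by (intro member_le_sum) auto
    finally show False using \<gamma>(3) small by linarith
  qed
  then show ?thesis using \<gamma> unfolding N_def by blast
qed

section \<open>Density of absorbing pairs\<close>

context kpartite_system
begin

text \<open>For hole rows \<open>c\<close>, \<open>d\<close> and edge rows \<open>g\<close>, \<open>g'\<close>: swapping entries makes \<open>c\<close>, \<open>d\<close> and \<open>g\<close>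
  edges and leaves \<open>g'\<close> as the only hole.\<close>

definition absorbs :: "'i \<Rightarrow> 'i \<Rightarrow> ('i \<Rightarrow> 'v) \<Rightarrow> ('i \<Rightarrow> 'v) \<Rightarrow> ('i \<Rightarrow> 'v) \<Rightarrow> ('i \<Rightarrow> 'v) \<Rightarrow> bool" where
  "absorbs \<alpha> \<beta> c d g g' \<longleftrightarrow>
     ed (d(\<alpha> := g \<alpha>)) \<and> ed (c(\<alpha> := g' \<alpha>)) \<and> ed (g(\<alpha> := d \<alpha>, \<beta> := g' \<beta>))"

text \<open>A pair of rows is a point \<open>z\<close> of a product over
  \<open>K \<times> UNIV\<close>, the Boolean selecting the row. Five conditions are imposed in
  turn, each by means of a coordinate that the earlier ones do not read, so each keeps at least a
  fraction \<open>1 / M\<close>. Coincidences within the pair or with \<open>U\<close> cost at most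
  half of what is left. Vertices in \<open>U\<close> are tagged by their column because the locale
  does not assume disjoint classes.\<close>

lemma dense_absorbers:
  fixes U :: "('i \<times> 'v) set"
  assumes K: "\<alpha> \<in> K" "\<beta> \<in> K" "\<gamma> \<in> K" "\<alpha> \<noteq> \<beta>" "\<alpha> \<noteq> \<gamma>" "\<beta> \<noteq> \<gamma>"
    and q: "q \<le> a \<alpha>" "q \<le> a \<beta>" "q \<le> a \<gamma>" "n \<le> M * q" "0 < n"
    and cd: "\<And>p. p \<in> K \<Longrightarrow> c p \<in> V p" "\<And>p. p \<in> K \<Longrightarrow> d p \<in> V p"
    and U: "finite U" "2 * M ^ 5 * (card K + 2 * card U) \<le> n"
  shows "1 / (2 * real M ^ 5) * card (PiE (K \<times> (UNIV :: bool set)) (V \<circ> fst))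
    \<le> card {z \<in> PiE (K \<times> (UNIV :: bool set)) (V \<circ> fst).
         ed (\<lambda>p. z (p, False)) \<and> ed (\<lambda>p. z (p, True)) \<and> (\<forall>p\<in>K. z (p, False) \<noteq> z (p, True)) \<and>
         absorbs \<alpha> \<beta> c d (\<lambda>p. z (p, False)) (\<lambda>p. z (p, True)) \<and>
         (\<lambda>(p, b). (p, z (p, b))) ` (K \<times> UNIV) \<inter> U = {}}"
proof -
  define D where "D = K \<times> (UNIV :: bool set)"
  define W where "W = V \<circ> (fst :: 'i \<times> bool \<Rightarrow> 'i)"
  define \<Omega> where "\<Omega> = PiE D W"
  have finD: "finite D" using finite_K by (simp add: D_def)
  have cW: "finite (W p) \<and> card (W p) = n" if "p \<in> D" for p
    using that card_V by (auto simp: D_def W_def)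
  have fin\<Omega>: "finite \<Omega>" unfolding \<Omega>_def using finD cW by (intro finite_PiE) auto
  \<comment> \<open>The coordinates used are \<open>(\<alpha>, False)\<close>,
    \<open>(\<beta>, False)\<close>, \<open>(\<alpha>, True)\<close>, \<open>(\<beta>, True)\<close>
    and \<open>(\<gamma>, True)\<close>, in this order. \<open>A5\<close> reads the whole second
    row, whose entries at \<open>\<alpha>\<close> and \<open>\<beta>\<close> are already tied by
    \<open>A3\<close> and \<open>A4\<close>; this is where a third large codegree enters.\<close>
  define A1 where "A1 z \<longleftrightarrow> ed (d(\<alpha> := z (\<alpha>, False)))" for z
  define A2 where "A2 z \<longleftrightarrow> ed (\<lambda>p. z (p, False))" for z
  define A3 where "A3 z \<longleftrightarrow> ed (c(\<alpha> := z (\<alpha>, True)))" for z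
  define A4 where "A4 z \<longleftrightarrow> ed ((\<lambda>p. z (p, False))(\<alpha> := d \<alpha>, \<beta> := z (\<beta>, True)))" for z
  define A5 where "A5 z \<longleftrightarrow> ed (\<lambda>p. z (p, True))" for z
  note As = A1_def A2_def A3_def A4_def A5_def
  have mem: "z (p, b) \<in> V p" if "z \<in> \<Omega>" "p \<in> K" for z p b
    using that by (force simp: \<Omega>_def D_def W_def PiE_iff)
  note fl = fibre_lower[where W = W and n = n and m = q, OF finD _ cW, folded \<Omega>_def]
  have s1: "card \<Omega> * q \<le> card {z \<in> \<Omega>. A1 z} * n"
  proof -
    have "q \<le> card {v \<in> V \<alpha>. A1 (z((\<alpha>, False) := v))}" for z
      using codegree[OF K(1), of d] cd(2) q(1) by (simp add: A1_def) 
    then show ?thesis using fl[where i = "(\<alpha>, False)" and A = "\<lambda>_. True" and B = A1] K by (simp add: D_def W_def)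
  qed
  have s2: "card {z \<in> \<Omega>. A1 z} * q \<le> card {z \<in> \<Omega>. A1 z \<and> A2 z} * n"
  proof (rule fl[where i = "(\<beta>, False)" and A = A1 and B = A2])
    fix z assume "z \<in> \<Omega>"
    then have "a \<beta> \<le> card {v \<in> V \<beta>. ed ((\<lambda>p. z (p, False))(\<beta> := v))}"
      using codegree[OF K(2), of "\<lambda>p. z (p, False)"] mem by simp
    then show "q \<le> card {v \<in> W (\<beta>, False). A2 (z((\<beta>, False) := v))}"
      using q by (simp add: W_def A2_def fun_upd_def)
  qed (use K in \<open>auto simp: D_def A1_def\<close>)
  have s3: "card {z \<in> \<Omega>. A1 z \<and> A2 z} * q \<le> card {z \<in> \<Omega>. (A1 z \<and> A2 z) \<and> A3 z} * n"
  proof (rule fl[where i = "(\<alpha>, True)" and A = "\<lambda>z. A1 z \<and> A2 z" and B = A3])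
    fix z :: "'i \<times> bool \<Rightarrow> 'v"
    have "a \<alpha> \<le> card {v \<in> V \<alpha>. ed (c(\<alpha> := v))}"
      using codegree[OF K(1), of c] cd by simp
    then show "q \<le> card {v \<in> W (\<alpha>, True). A3 (z((\<alpha>, True) := v))}"
      using q by (simp add: W_def A3_def)
  qed (use K in \<open>auto simp: D_def A1_def A2_def\<close>)
  have s4: "card {z \<in> \<Omega>. (A1 z \<and> A2 z) \<and> A3 z} * q \<le> card {z \<in> \<Omega>. ((A1 z \<and> A2 z) \<and> A3 z) \<and> A4 z} * n"
  proof (rule fl[where i = "(\<beta>, True)" and A = "\<lambda>z. (A1 z \<and> A2 z) \<and> A3 z" and B = A4])
    fix z assume "z \<in> \<Omega>"
    then have "a \<beta> \<le> card {v \<in> V \<beta>. ed ((\<lambda>p. z (p, False))(\<alpha> := d \<alpha>, \<beta> := v))}"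
      using mem cd by (intro codegree[OF K(2)]) (auto simp: K(1))
    then show "q \<le> card {v \<in> W (\<beta>, True). A4 (z((\<beta>, True) := v))}"
      using q by (simp add: W_def A4_def fun_upd_def)
  qed (use K in \<open>auto simp: D_def A1_def A2_def A3_def\<close>)
  have s5: "card {z \<in> \<Omega>. ((A1 z \<and> A2 z) \<and> A3 z) \<and> A4 z} * q \<le> card {z \<in> \<Omega>. (((A1 z \<and> A2 z) \<and> A3 z) \<and> A4 z) \<and> A5 z} * n"
  proof (rule fl[where i = "(\<gamma>, True)" and A = "\<lambda>z. ((A1 z \<and> A2 z) \<and> A3 z) \<and> A4 z" and B = A5])
    fix z assume "z \<in> \<Omega>"
    then have "a \<gamma> \<le> card {v \<in> V \<gamma>. ed ((\<lambda>p. z (p, True))(\<gamma> := v))}"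
      using codegree[OF K(3), of "\<lambda>p. z (p, True)"] mem by simp
    then show "q \<le> card {v \<in> W (\<gamma>, True). A5 (z((\<gamma>, True) := v))}"
      using q by (simp add: W_def A5_def fun_upd_def)
  qed (use K in \<open>auto simp: D_def A1_def A2_def A3_def A4_def\<close>)
  define G where "G = {z \<in> \<Omega>. (((A1 z \<and> A2 z) \<and> A3 z) \<and> A4 z) \<and> A5 z}"
  have G: "card \<Omega> * q ^ 5 \<le> card G * n ^ 5"
  proof -
    have "card \<Omega> * q ^ 5 = card \<Omega> * q * q ^ 4" by (simp add: eval_nat_numeral)
    also have "\<dots> \<le> card {z \<in> \<Omega>. A1 z} * n * q ^ 4" using s1 by (rule mult_le_mono1)
    also have "\<dots> = card {z \<in> \<Omega>. A1 z} * q * (n * q ^ 3)" by (simp add: eval_nat_numeral)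
    also have "\<dots> \<le> card {z \<in> \<Omega>. A1 z \<and> A2 z} * n * (n * q ^ 3)" using s2 by (rule mult_le_mono1)
    also have "\<dots> = card {z \<in> \<Omega>. A1 z \<and> A2 z} * q * (n ^ 2 * q ^ 2)" by (simp add: eval_nat_numeral)
    also have "\<dots> \<le> card {z \<in> \<Omega>. (A1 z \<and> A2 z) \<and> A3 z} * n * (n ^ 2 * q ^ 2)" using s3 by (rule mult_le_mono1)
    also have "\<dots> = card {z \<in> \<Omega>. (A1 z \<and> A2 z) \<and> A3 z} * q * (n ^ 3 * q)" by (simp add: eval_nat_numeral)
    also have "\<dots> \<le> card {z \<in> \<Omega>. ((A1 z \<and> A2 z) \<and> A3 z) \<and> A4 z} * n * (n ^ 3 * q)" using s4 by (rule mult_le_mono1)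
    also have "\<dots> = card {z \<in> \<Omega>. ((A1 z \<and> A2 z) \<and> A3 z) \<and> A4 z} * q * n ^ 4" by (simp add: eval_nat_numeral)
    also have "\<dots> \<le> card G * n * n ^ 4" using s5 unfolding G_def by (rule mult_le_mono1)
    also have "\<dots> = card G * n ^ 5" by (simp add: eval_nat_numeral)
    finally show ?thesis .
  qed
  \<comment> \<open>The two rows share a vertex, or one of them uses a vertex of \<open>U\<close>.
    Each such equation determines one coordinate and has density at most
    \<open>1 / n\<close>.\<close>
  define B where "B = (\<Union>p\<in>K. {z \<in> \<Omega>. z (p, False) = z (p, True)}) \<union>
    (\<Union>(p, v)\<in>U \<inter> K \<times> UNIV. {z \<in> \<Omega>. z (p, False) = v} \<union> {z \<in> \<Omega>. z (p, True) = v})"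
  have fu: "card {z \<in> \<Omega>. R z} * n \<le> card \<Omega>"
    if pK: "p \<in> K" and uu: "\<And>z. z \<in> \<Omega> \<Longrightarrow> \<exists>u. {v \<in> V p. R (z((p, b) := v))} \<subseteq> {u}" for p b R
  proof -
    have "card {v \<in> W (p, b). R (z((p, b) := v))} \<le> 1" if z: "z \<in> \<Omega>" for z
    proof -
      obtain u where "{v \<in> V p. R (z((p, b) := v))} \<subseteq> {u}" using uu[OF z] by blast
      then show ?thesis using card_mono[of "{u}" "{v \<in> V p. R (z((p, b) := v))}"] by (simp add: W_def)
    qed
    then show ?thesis
      using fibre_upper[where W = W and n = n and i = "(p, b)" and B = R and m = 1, OF finD _ cW, folded \<Omega>_def] pK by (simp add: D_def)
  qed
  have cB: "card B * n \<le> (card K + 2 * card U) * card \<Omega>"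
  proof -
    have "card B \<le> (\<Sum>p\<in>K. card {z \<in> \<Omega>. z (p, False) = z (p, True)}) +
      (\<Sum>(p, v)\<in>U \<inter> K \<times> UNIV. card {z \<in> \<Omega>. z (p, False) = v} + card {z \<in> \<Omega>. z (p, True) = v})"
      unfolding B_def
    proof (intro order_trans[OF card_Un_le] add_mono)
      show "card (\<Union>p\<in>K. {z \<in> \<Omega>. z (p, False) = z (p, True)}) \<le> (\<Sum>p\<in>K. card {z \<in> \<Omega>. z (p, False) = z (p, True)})"
        by (rule card_UN_le[OF finite_K])
      have "finite (U \<inter> K \<times> UNIV)" using U by blast
      then have "card (\<Union>(p, v)\<in>U \<inter> K \<times> UNIV. {z \<in> \<Omega>. z (p, False) = v} \<union> {z \<in> \<Omega>. z (p, True) = v})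
        \<le> (\<Sum>x\<in>U \<inter> K \<times> UNIV. card (case x of (p, v) \<Rightarrow> {z \<in> \<Omega>. z (p, False) = v} \<union> {z \<in> \<Omega>. z (p, True) = v}))"
        by (rule card_UN_le)
      also have "\<dots> \<le> (\<Sum>(p, v)\<in>U \<inter> K \<times> UNIV. card {z \<in> \<Omega>. z (p, False) = v} + card {z \<in> \<Omega>. z (p, True) = v})"
        by (intro sum_mono) (auto intro: card_Un_le)
      finally show "card (\<Union>(p, v)\<in>U \<inter> K \<times> UNIV. {z \<in> \<Omega>. z (p, False) = v} \<union> {z \<in> \<Omega>. z (p, True) = v}) \<le> \<dots>" .
    qed
    then have "card B * n \<le> ((\<Sum>p\<in>K. card {z \<in> \<Omega>. z (p, False) = z (p, True)}) +
      (\<Sum>(p, v)\<in>U \<inter> K \<times> UNIV. card {z \<in> \<Omega>. z (p, False) = v} + card {z \<in> \<Omega>. z (p, True) = v})) * n"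
      by (rule mult_le_mono1)
    also have "\<dots> = (\<Sum>p\<in>K. card {z \<in> \<Omega>. z (p, False) = z (p, True)} * n) +
      (\<Sum>(p, v)\<in>U \<inter> K \<times> UNIV. card {z \<in> \<Omega>. z (p, False) = v} * n + card {z \<in> \<Omega>. z (p, True) = v} * n)"
      by (simp add: add_mult_distrib sum_distrib_right case_prod_beta)
    also have "\<dots> \<le> (\<Sum>p\<in>K. card \<Omega>) + (\<Sum>x\<in>U \<inter> K \<times> UNIV. 2 * card \<Omega>)"
    proof (intro add_mono sum_mono)
      fix p assume p: "p \<in> K"
      have "\<exists>u. {v \<in> V p. (z((p, False) := v)) (p, False) = (z((p, False) := v)) (p, True)} \<subseteq> {u}" for z
        by (rule exI[of _ "z (p, True)"]) auto
      then show "card {z \<in> \<Omega>. z (p, False) = z (p, True)} * n \<le> card \<Omega>"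
        using fu[where R = "\<lambda>z. z (p, False) = z (p, True)", OF p] by blast
    next
      fix x assume x: "x \<in> U \<inter> K \<times> UNIV"
      have "\<exists>u. {v \<in> V (fst x). (z((fst x, b) := v)) (fst x, b) = snd x} \<subseteq> {u}" for z b
        by (rule exI[of _ "snd x"]) auto
      then have "card {z \<in> \<Omega>. z (fst x, b) = snd x} * n \<le> card \<Omega>" for b
        using fu[where R = "\<lambda>z. z (fst x, b) = snd x" and p = "fst x"] x by fastforce
      then show "(case x of (p, v) \<Rightarrow> card {z \<in> \<Omega>. z (p, False) = v} * n + card {z \<in> \<Omega>. z (p, True) = v} * n) \<le> 2 * card \<Omega>"
        by (simp add: case_prod_beta add_mono mult_2)
    qed
    also have "\<dots> \<le> card K * card \<Omega> + card U * (2 * card \<Omega>)"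
      using U card_mono[of U "U \<inter> K \<times> UNIV"] by simp
    finally show ?thesis by (simp add: algebra_simps)
  qed
  have sub: "G - B \<subseteq> {z \<in> \<Omega>. ed (\<lambda>p. z (p, False)) \<and> ed (\<lambda>p. z (p, True)) \<and> (\<forall>p\<in>K. z (p, False) \<noteq> z (p, True)) \<and>
         absorbs \<alpha> \<beta> c d (\<lambda>p. z (p, False)) (\<lambda>p. z (p, True)) \<and>
         (\<lambda>(p, b). (p, z (p, b))) ` (K \<times> UNIV) \<inter> U = {}}" (is "_ \<subseteq> ?T")
  proof
    fix z assume z: "z \<in> G - B"
    have "(\<lambda>(p, b). (p, z (p, b))) ` (K \<times> UNIV) \<inter> U = {}"
    proof (rule ccontr)
      assume "\<not> ?thesis"
      then obtain p b where pb: "p \<in> K" "(p, z (p, b)) \<in> U" by auto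
      have "z \<in> \<Omega>" using z by (simp add: G_def)
      then have "z \<in> {y \<in> \<Omega>. y (p, False) = z (p, b)} \<union> {y \<in> \<Omega>. y (p, True) = z (p, b)}"
        by (cases b) auto
      then have "z \<in> B" unfolding B_def using pb by (intro UnI2 UN_I[of "(p, z (p, b))"]) auto
      then show False using z by blast
    qed
    then show "z \<in> ?T" using z by (auto simp: G_def B_def As absorbs_def)
  qed
  have M: "0 < M" using q(4,5) by (cases M) auto
  have "card G \<le> card (G - B) + card B"
  proof -
    have "finite B" by (rule finite_subset[OF _ fin\<Omega>]) (auto simp: B_def)
    moreover have "finite G" by (rule finite_subset[OF _ fin\<Omega>]) (auto simp: G_def)
    ultimately have "card G \<le> card ((G - B) \<union> B)" by (intro card_mono) auto
    then show ?thesis using card_Un_le[of "G - B" B] by linarith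
  qed
  moreover have "card (G - B) \<le> card ?T" using sub fin\<Omega> by (intro card_mono) auto
  ultimately have GB: "real (card G) \<le> card ?T + real (card B)" by linarith
  have g: "card \<Omega> / real M ^ 5 \<le> card G"
  proof -
    have "real (card \<Omega>) * n ^ 5 \<le> card \<Omega> * (real M * q) ^ 5"
      using q(4) by (intro mult_left_mono power_mono) (auto simp flip: of_nat_mult)
    also have "\<dots> = real (card \<Omega> * q ^ 5) * M ^ 5" by (simp add: power_mult_distrib)
    also have "\<dots> \<le> real (card G * n ^ 5) * M ^ 5"
      using G by (intro mult_right_mono) (simp_all del: of_nat_mult of_nat_power)
    finally have "real (card \<Omega>) * n ^ 5 \<le> (card G * real M ^ 5) * n ^ 5" by (simp add: algebra_simps)
    then have "real (card \<Omega>) \<le> card G * real M ^ 5" using q(5) by simp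
    then show ?thesis using M by (simp add: field_simps)
  qed
  have b: "card B \<le> card \<Omega> / (2 * real M ^ 5)"
  proof -
    have "card B * (2 * M ^ 5) * n = card B * n * (2 * M ^ 5)" by simp
    also have "\<dots> \<le> (card K + 2 * card U) * card \<Omega> * (2 * M ^ 5)" using cB by (rule mult_le_mono1)
    also have "\<dots> = 2 * M ^ 5 * (card K + 2 * card U) * card \<Omega>" by simp
    also have "\<dots> \<le> n * card \<Omega>" using U(2) by (rule mult_le_mono1)
    finally have "card B * (2 * M ^ 5) \<le> card \<Omega>" using q(5) by simp
    then have "real (card B * (2 * M ^ 5)) \<le> real (card \<Omega>)" by (simp only: of_nat_le_iff)
    then have "real (card B) * (2 * real M ^ 5) \<le> card \<Omega>" by simp
    then show ?thesis using M by (simp add: field_simps)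
  qed
  have "1 / (2 * real M ^ 5) * card \<Omega> = card \<Omega> / real M ^ 5 - card \<Omega> / (2 * real M ^ 5)"
    using M by (simp add: field_simps)
  then have "1 / (2 * real M ^ 5) * card \<Omega> \<le> card ?T" using g b GB by linarith
  then show ?thesis unfolding \<Omega>_def D_def W_def .
qed

end

text \<open>With \<open>c = - ln r\<close> the power \<open>r ^ j\<close> becomes an exponential,
  and \<open>x ^ A / exp x\<close> tends to 0. Replacing \<open>n\<close> by a multiple of
  \<open>n div m + 1\<close> costs the constant \<open>B\<close>.\<close>

lemma poly_times_geometric_small:
  fixes r :: real and A m :: nat
  assumes r: "0 < r" "r < 1" and m: "0 < m" and \<delta>: "0 < \<delta>"
  shows "\<exists>n0. \<forall>n\<ge>n0. real (n ^ A) * r ^ (n div m) < \<delta>"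
proof -
  define c where "c = - ln r"
  have c: "0 < c" using r by (simp add: c_def)
  have pw: "r ^ j = exp (- (c * real j))" for j
    using r by (simp add: c_def exp_of_nat2_mult)
  have "filterlim (\<lambda>j. c * real (Suc j)) at_top sequentially"
    using c by (intro filterlim_tendsto_pos_mult_at_top[OF tendsto_const]
      filterlim_compose[OF filterlim_real_sequentially filterlim_Suc]) auto
  then have "((\<lambda>j. (c * real (Suc j)) ^ A / exp (c * real (Suc j))) \<longlongrightarrow> 0) sequentially"
    by (rule filterlim_compose[OF tendsto_power_div_exp_0])
  moreover define B where "B = (real m / c) ^ A * exp c"
  have "0 < B" using c m by (simp add: B_def)
  ultimately have "\<forall>\<^sub>F j in sequentially. (c * real (Suc j)) ^ A / exp (c * real (Suc j)) < \<delta> / B"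
    using \<delta> by (intro order_tendstoD(2)) auto
  then obtain j0 where j0: "\<And>j. j0 \<le> j \<Longrightarrow> (c * real (Suc j)) ^ A / exp (c * real (Suc j)) < \<delta> / B"
    unfolding eventually_sequentially by blast
  have "real (n ^ A) * r ^ (n div m) < \<delta>" if n: "j0 * m \<le> n" for n
  proof -
    define j where "j = n div m"
    have "j0 \<le> j" using n m by (simp add: j_def less_eq_div_iff_mult_less_eq)
    have "n < m * Suc j" unfolding j_def by (metis m dividend_less_times_div mult_Suc_right)
    then have "real (n ^ A) \<le> (real m * real (Suc j)) ^ A"
      by (metis less_imp_le of_nat_le_iff of_nat_mult of_nat_power power_mono zero_le)
    then have "real (n ^ A) * r ^ j \<le> (real m * real (Suc j)) ^ A * r ^ j"
      using r by (intro mult_right_mono) auto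
    also have "\<dots> = B * ((c * real (Suc j)) ^ A / exp (c * real (Suc j)))"
    proof -
      have "(real m * real (Suc j)) ^ A = (real m / c) ^ A * (c * real (Suc j)) ^ A"
        using c by (simp add: power_mult_distrib[symmetric] del: of_nat_Suc)
      moreover have "r ^ j = exp c / exp (c * real (Suc j))"
        by (simp add: pw exp_diff[symmetric] algebra_simps)
      ultimately show ?thesis by (simp add: B_def del: of_nat_Suc)
    qed
    also have "\<dots> < B * (\<delta> / B)" using j0[OF \<open>j0 \<le> j\<close>] \<open>0 < B\<close> by (intro mult_strict_left_mono)
    finally show ?thesis using \<open>0 < B\<close> by (simp add: j_def)
  qed
  then show ?thesis by blast
qed

section \<open>Reserving absorbers, and rows mixed from several holes\<close>

context kpartite_system
begin

lemma absorbs_cong: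
  assumes "\<alpha> \<in> K" "\<beta> \<in> K" "\<And>p. p \<in> K \<Longrightarrow> c p = c' p" "\<And>p. p \<in> K \<Longrightarrow> d p = d' p"
    "\<And>p. p \<in> K \<Longrightarrow> g p = h p" "\<And>p. p \<in> K \<Longrightarrow> g' p = h' p"
  shows "absorbs \<alpha> \<beta> c d g g' = absorbs \<alpha> \<beta> c' d' h h'"
proof -
  have "ed (d(\<alpha> := g \<alpha>)) = ed (d'(\<alpha> := h \<alpha>))" "ed (c(\<alpha> := g' \<alpha>)) = ed (c'(\<alpha> := h' \<alpha>))"
    "ed (g(\<alpha> := d \<alpha>, \<beta> := g' \<beta>)) = ed (h(\<alpha> := d' \<alpha>, \<beta> := h' \<beta>))"
    using assms by (auto intro!: ed_cong)
  then show ?thesis by (simp add: absorbs_def)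
qed

text \<open>There are only \<open>n ^ (2 * card K)\<close> pairs of transversals, so the
  exponentially small factor in \<open>greedy_cover\<close> serves all of them at once. Quantifying
  over transversals rather than over rows of \<open>X\<close> keeps the absorbers valid after the
  other rows have been rearranged.\<close>

lemma absorber_arrangement:
  assumes K: "\<alpha> \<in> K" "\<beta> \<in> K" "\<gamma> \<in> K" "\<alpha> \<noteq> \<beta>" "\<alpha> \<noteq> \<gamma>" "\<beta> \<noteq> \<gamma>"
    and q: "q \<le> a \<alpha>" "q \<le> a \<beta>" "q \<le> a \<gamma>" "n \<le> M * q" "0 < n"
    and t: "2 * M ^ 5 * (card K + 4 * card K * t) \<le> n"
    and small: "real (n ^ (2 * card K)) * (1 - 1 / (4 * real M ^ 5)) ^ t < (1 / 2) ^ k0"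
  shows "\<exists>X. arr X \<and> {..<2 * t} \<subseteq> edge_rows X \<and>
    (\<forall>c d. (\<forall>p\<in>K. c p \<in> V p \<and> d p \<in> V p) \<longrightarrow>
      k0 < card {i. i < t \<and> absorbs \<alpha> \<beta> c d (X (2 * i)) (X (2 * i + 1))})"
proof -
  define \<Omega> where "\<Omega> = PiE (K \<times> (UNIV :: bool set)) (V \<circ> fst)"
  define vs where "vs z = (\<lambda>(p, b). (p, z (p, b))) ` (K \<times> (UNIV :: bool set))" for z :: "'i \<times> bool \<Rightarrow> 'v"
  define \<Gamma> where "\<Gamma> = {z \<in> \<Omega>. ed (\<lambda>p. z (p, False)) \<and> ed (\<lambda>p. z (p, True)) \<and> (\<forall>p\<in>K. z (p, False) \<noteq> z (p, True))}"
  define Q where "Q = PiE K V \<times> PiE K V"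
  define acc where "acc = (\<lambda>(c, d) z. absorbs \<alpha> \<beta> c d (\<lambda>p. z (p, False)) (\<lambda>p. z (p, True)))"
  define \<theta> where "\<theta> = 1 / (2 * real M ^ 5)"
  have M: "0 < M" using q(4,5) by (cases M) auto
  have \<theta>: "0 < \<theta>" using M by (simp add: \<theta>_def)
  have fin\<Omega>: "finite \<Omega>" unfolding \<Omega>_def using finite_K card_V by (intro finite_PiE) auto
  have fin\<Gamma>: "finite \<Gamma>" using fin\<Omega> by (simp add: \<Gamma>_def)
  have Vne: "V p \<noteq> {}" if "p \<in> K" for p using card_V[OF that] q(5) by auto
  have "\<Omega> \<noteq> {}" unfolding \<Omega>_def using Vne by (auto simp: PiE_eq_empty_iff)
  have Qne: "Q \<noteq> {}" using Vne by (auto simp: Q_def PiE_eq_empty_iff)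
  have finQ: "finite Q" unfolding Q_def using finite_K card_V by (intro finite_cartesian_product finite_PiE) auto
  have "card (PiE K V) = n ^ card K" using card_V finite_K by (simp add: card_PiE)
  then have cQ: "card Q = n ^ (2 * card K)" by (simp add: Q_def card_cartesian_product power_add mult_2)
  have dense: "\<theta> * card \<Omega> \<le> card {g \<in> \<Gamma>. acc x g \<and> vs g \<inter> U = {}}"
    if "x \<in> Q" "finite U" "card U \<le> 2 * card K * t" for U x
  proof -
    obtain c d where x: "x = (c, d)" "c \<in> PiE K V" "d \<in> PiE K V" using \<open>x \<in> Q\<close> unfolding Q_def by (cases x) auto
    have "card K + 2 * card U \<le> card K + 4 * card K * t" using that(3) by linarith
    then have "2 * M ^ 5 * (card K + 2 * card U) \<le> 2 * M ^ 5 * (card K + 4 * card K * t)"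
      by (rule mult_le_mono2)
    then have "2 * M ^ 5 * (card K + 2 * card U) \<le> n" using t by linarith
    from dense_absorbers[OF K q _ _ that(2) this, of c d] x(2,3)
    have "\<theta> * card \<Omega> \<le> card {z \<in> \<Omega>. ed (\<lambda>p. z (p, False)) \<and> ed (\<lambda>p. z (p, True)) \<and> (\<forall>p\<in>K. z (p, False) \<noteq> z (p, True)) \<and>
         absorbs \<alpha> \<beta> c d (\<lambda>p. z (p, False)) (\<lambda>p. z (p, True)) \<and> vs z \<inter> U = {}}"
      unfolding \<theta>_def \<Omega>_def vs_def by (simp add: PiE_iff)
    moreover have "{z \<in> \<Omega>. ed (\<lambda>p. z (p, False)) \<and> ed (\<lambda>p. z (p, True)) \<and> (\<forall>p\<in>K. z (p, False) \<noteq> z (p, True)) \<and>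
         absorbs \<alpha> \<beta> c d (\<lambda>p. z (p, False)) (\<lambda>p. z (p, True)) \<and> vs z \<inter> U = {}} = {g \<in> \<Gamma>. acc x g \<and> vs g \<inter> U = {}}"
      by (auto simp: \<Gamma>_def acc_def x(1))
    ultimately show ?thesis by simp
  qed
  have \<Gamma>\<Omega>: "\<theta> * card \<Gamma> \<le> \<theta> * card \<Omega>"
    using \<theta> fin\<Omega> by (intro mult_left_mono) (auto simp: \<Gamma>_def intro!: card_mono)
  have "\<Gamma> \<noteq> {}"
  proof
    assume "\<Gamma> = {}"
    moreover obtain x where "x \<in> Q" using Qne by blast
    ultimately have "\<theta> * card \<Omega> \<le> 0" using dense[of x "{}"] by simp
    then show False using \<theta> \<open>\<Omega> \<noteq> {}\<close> fin\<Omega> by (simp add: mult_le_0_iff)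
  qed
  have vs: "finite (vs g) \<and> card (vs g) \<le> 2 * card K" for g
  proof -
    have "card (vs g) \<le> card (K \<times> (UNIV :: bool set))" unfolding vs_def using finite_K by (intro card_image_le) auto
    then show ?thesis using finite_K by (simp add: vs_def card_cartesian_product)
  qed
  have "\<exists>\<gamma>. (\<forall>i<t. \<gamma> i \<in> \<Gamma>) \<and> (\<forall>i<t. \<forall>j<t. i \<noteq> j \<longrightarrow> vs (\<gamma> i) \<inter> vs (\<gamma> j) = {}) \<and>
    (\<forall>x\<in>Q. k0 < card {i. i < t \<and> acc x (\<gamma> i)})"
  proof (rule greedy_cover[OF finQ Qne fin\<Gamma> \<open>\<Gamma> \<noteq> {}\<close> \<theta> vs])
    show "\<theta> * card \<Gamma> \<le> card {g \<in> \<Gamma>. acc x g \<and> vs g \<inter> U = {}}"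
      if "x \<in> Q" "finite U" "card U \<le> 2 * card K * t" for U x
      using dense[OF that] \<Gamma>\<Omega> by linarith
    show "card Q * (1 - \<theta> / 2) ^ t < (1 / 2) ^ k0" using small cQ by (simp add: \<theta>_def)
  qed
  then obtain \<gamma> where \<gamma>: "\<And>i. i < t \<Longrightarrow> \<gamma> i \<in> \<Gamma>" "\<And>i j. i < t \<Longrightarrow> j < t \<Longrightarrow> i \<noteq> j \<Longrightarrow> vs (\<gamma> i) \<inter> vs (\<gamma> j) = {}"
    "\<And>x. x \<in> Q \<Longrightarrow> k0 < card {i. i < t \<and> acc x (\<gamma> i)}" by blast
  \<comment> \<open>Gadget \<open>i\<close> occupies the rows \<open>2 * i\<close> and
    \<open>2 * i + 1\<close>; the parity of the row is the Boolean coordinate.\<close>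
  define x where "x r p = \<gamma> (r div 2) (p, odd r)" for r p
  have inV: "x r p \<in> V p" if "r < 2 * t" "p \<in> K" for r p
  proof -
    have "\<gamma> (r div 2) \<in> \<Omega>" using \<gamma>(1)[of "r div 2"] that by (simp add: \<Gamma>_def)
    then show ?thesis using that by (force simp: \<Omega>_def x_def PiE_iff)
  qed
  have inj: "inj_on (\<lambda>r. x r p) {..<2 * t}" if p: "p \<in> K" for p
  proof (rule inj_onI, rule ccontr)
    fix r s assume rs: "r \<in> {..<2 * t}" "s \<in> {..<2 * t}" "x r p = x s p" "r \<noteq> s"
    then have lt: "r div 2 < t" "s div 2 < t" by auto
    show False
    proof (cases "r div 2 = s div 2")
      case True
      have "r = 2 * (r div 2) + r mod 2" "s = 2 * (s div 2) + s mod 2" by simp_all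
      then have "r mod 2 \<noteq> s mod 2" using rs(4) True by metis
      then have "odd r \<noteq> odd s" by presburger
      then show False using rs(3) \<gamma>(1)[OF lt(1)] True p by (cases "odd r"; cases "odd s") (auto simp: x_def \<Gamma>_def)
    next
      case False
      have "(p, x r p) \<in> vs (\<gamma> (r div 2))" "(p, x s p) \<in> vs (\<gamma> (s div 2))"
        using p by (auto simp: vs_def x_def)
      then show False using \<gamma>(2)[OF lt False] rs(3) by auto
    qed
  qed
  have "2 * t \<le> n"
  proof -
    have "0 < card K" using K finite_K by (auto simp: card_gt_0_iff)
    then have "t \<le> card K * t" by simp
    then have "2 * t \<le> card K + 4 * card K * t" by linarith
    also have "\<dots> \<le> 2 * M ^ 5 * (card K + 4 * card K * t)" using M by simp
    finally show ?thesis using t by linarith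
  qed
  then obtain X where X: "arr X" "\<forall>p\<in>K. \<forall>r<2 * t. X r p = x r p"
    using arr_extend[of "\<lambda>_. 2 * t" x] inj inV by blast
  have ev: "X (2 * i) p = \<gamma> i (p, False)" "X (2 * i + 1) p = \<gamma> i (p, True)" if "i < t" "p \<in> K" for i p
    using X(2) that by (auto simp: x_def)
  have "{..<2 * t} \<subseteq> edge_rows X"
  proof
    fix r assume r: "r \<in> {..<2 * t}"
    have "\<gamma> (r div 2) \<in> \<Gamma>" using \<gamma>(1) r by auto
    then have "ed (x r)" unfolding x_def \<Gamma>_def by (cases "odd r") auto
    moreover have "ed (X r) = ed (x r)" using X(2) r by (intro ed_cong) auto
    ultimately show "r \<in> edge_rows X" using r \<open>2 * t \<le> n\<close> by (simp add: edge_rows_def)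
  qed
  moreover have "k0 < card {i. i < t \<and> absorbs \<alpha> \<beta> c d (X (2 * i)) (X (2 * i + 1))}"
    if cd: "\<forall>p\<in>K. c p \<in> V p \<and> d p \<in> V p" for c d
  proof -
    have "(restrict c K, restrict d K) \<in> Q" using cd by (auto simp: Q_def)
    then have "k0 < card {i. i < t \<and> acc (restrict c K, restrict d K) (\<gamma> i)}" by (rule \<gamma>(3))
    moreover have "absorbs \<alpha> \<beta> c d (X (2 * i)) (X (2 * i + 1)) = acc (restrict c K, restrict d K) (\<gamma> i)" if "i < t" for i
      unfolding acc_def case_prod_conv using K ev[OF that] by (intro absorbs_cong) auto
    then have "{i. i < t \<and> absorbs \<alpha> \<beta> c d (X (2 * i)) (X (2 * i + 1))} = {i. i < t \<and> acc (restrict c K, restrict d K) (\<gamma> i)}"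
      by blast
    ultimately show ?thesis by simp
  qed
  ultimately show ?thesis using X(1) by blast
qed

text \<open>Entries of the hole rows can be permuted within columns without touching any edge row,
  so an edge assembled from them would contradict maximality.\<close>

lemma hole_general:
  assumes X: "maximal F X" and i: "i \<in> K" and \<rho>: "\<And>p. p \<in> K - {i} \<Longrightarrow> \<rho> p \<in> holes X" and v: "v \<in> holes X"
  shows "\<not> ed ((\<lambda>p. X (\<rho> p) p)(i := X v i))"
proof
  assume h: "ed ((\<lambda>p. X (\<rho> p) p)(i := X v i))"
  define \<rho>' where "\<rho>' = \<rho>(i := v)"
  have \<rho>': "\<rho>' p \<in> holes X" if "p \<in> K" for p using that \<rho> v by (auto simp: \<rho>'_def)
  define \<pi> where "\<pi> p = (if p \<in> K then transpose v (\<rho>' p) else id)" for p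
  define Y where "Y = (\<lambda>r p. X (\<pi> p r) p)"
  have "arr X" using X by (simp add: maximal_def)
  then have "arr Y" unfolding Y_def
  proof (rule arr_reindex)
    fix p assume p: "p \<in> K"
    have "bij_betw (transpose v (\<rho>' p)) {..<n} {..<n}"
      using bij_betw_transpose rows_less(2)[OF v] rows_less(2)[OF \<rho>'[OF p]] by blast
    then show "bij_betw (\<pi> p) {..<n} {..<n}" using p by (simp add: \<pi>_def)
  qed
  have fix_edges: "Y r = X r" if "r \<in> edge_rows X" for r
  proof -
    have "r \<noteq> v" "\<And>p. p \<in> K \<Longrightarrow> r \<noteq> \<rho>' p" using that v \<rho>' edge_rows_holes by blast+
    then show ?thesis by (auto simp: Y_def \<pi>_def fun_eq_iff transpose_def)
  qed
  have "ed (Y v) = ed ((\<lambda>p. X (\<rho> p) p)(i := X v i))"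
    by (rule ed_cong) (auto simp: Y_def \<pi>_def \<rho>'_def)
  then have "ed (Y v)" using h by simp
  then have "insert v (edge_rows X) \<subseteq> edge_rows Y"
    using fix_edges rows_less(2)[OF v] unfolding edge_rows_def by fastforce
  then have "card (insert v (edge_rows X)) \<le> card (edge_rows Y)" by (intro card_mono) auto
  moreover have "v \<notin> edge_rows X" using v edge_rows_holes by blast
  moreover have "F \<subseteq> edge_rows X" using X by (simp add: maximal_def)
  then have "\<forall>r\<in>F. Y r = X r" using fix_edges by blast
  then have "card (edge_rows Y) \<le> card (edge_rows X)"
    using X \<open>arr Y\<close> by (simp add: maximal_def)
  ultimately show False by simp
qed

text \<open>\<open>Hit_disjoint\<close> for rows assembled from entries of several hole rows, which
  must not compete for an entry. The rows \<open>c\<close> and \<open>d\<close> are the places where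
  the two assembled rows are put.\<close>

lemma conflict_general:
  assumes X: "maximal F X" and ij: "i \<in> K" "j \<in> K" "i \<noteq> j" and cd: "c \<in> holes X" "d \<in> holes X" "c \<noteq> d"
    and \<rho>: "\<And>p. p \<in> K - {i} \<Longrightarrow> \<rho> p \<in> holes X" and \<sigma>: "\<And>p. p \<in> K - {j} \<Longrightarrow> \<sigma> p \<in> holes X"
    and \<rho>\<sigma>: "\<And>p. p \<in> K - {i, j} \<Longrightarrow> \<rho> p \<noteq> \<sigma> p" and e: "e \<in> edge_rows X" "e \<notin> F"
    and h: "ed ((\<lambda>p. X (\<rho> p) p)(i := X e i))" "ed ((\<lambda>p. X (\<sigma> p) p)(j := X e j))"
  shows False
proof -
  define \<rho>' \<sigma>' where "\<rho>' = \<rho>(i := e)" and "\<sigma>' = \<sigma>(j := e)"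
  define S where "S = insert e (holes X)"
  have S: "\<rho>' p \<in> S" "\<sigma>' p \<in> S" if "p \<in> K" for p using that \<rho> \<sigma> by (auto simp: \<rho>'_def \<sigma>'_def S_def)
  have ne: "\<rho>' p \<noteq> \<sigma>' p" if "p \<in> K" for p
    using that \<rho>\<sigma>[of p] \<rho>[of p] \<sigma>[of p] ij e edge_rows_holes by (cases "p = i"; cases "p = j") (force simp: \<rho>'_def \<sigma>'_def)+
  have Sn: "r < n" if "r \<in> S" for r using that e rows_less by (auto simp: S_def)
  have cdS: "c \<in> S" "d \<in> S" using cd by (auto simp: S_def)
  \<comment> \<open>Chosen so that the composite \<open>\<pi> p\<close> sends \<open>c\<close> to
    \<open>\<rho>' p\<close> and \<open>d\<close> to \<open>\<sigma>' p\<close>.\<close>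
  define \<tau> where "\<tau> p = transpose c (\<rho>' p) (\<sigma>' p)" for p
  have \<tau>: "\<tau> p \<in> S" "\<tau> p \<noteq> c" if "p \<in> K" for p
    using S[OF that] ne[OF that] cdS by (auto simp: \<tau>_def transpose_def)
  define \<pi> where "\<pi> p = (if p \<in> K then transpose c (\<rho>' p) \<circ> transpose d (\<tau> p) else id)" for p
  have \<pi>c: "\<pi> p c = \<rho>' p" if "p \<in> K" for p using that \<tau>[OF that] cd by (simp add: \<pi>_def transpose_def)
  have \<pi>d: "\<pi> p d = \<sigma>' p" if "p \<in> K" for p
    using that by (simp add: \<pi>_def \<tau>_def)
  have \<pi>o: "\<pi> p r = r" if "r \<notin> S" for p r
  proof (cases "p \<in> K")
    case True
    then have "r \<noteq> c" "r \<noteq> d" "r \<noteq> \<rho>' p" "r \<noteq> \<tau> p" using that S \<tau> cdS by blast+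
    then show ?thesis by (simp add: \<pi>_def transpose_def)
  qed (simp add: \<pi>_def)
  define Y where "Y = (\<lambda>r p. X (\<pi> p r) p)"
  have "arr X" using X by (simp add: maximal_def)
  then have "arr Y" unfolding Y_def
  proof (rule arr_reindex)
    fix p assume p: "p \<in> K"
    have "bij_betw (transpose c (\<rho>' p) \<circ> transpose d (\<tau> p)) {..<n} {..<n}"
      using S[OF p] \<tau>[OF p] cdS Sn by (intro bij_betw_trans[of _ _ "{..<n}"] bij_betw_transpose) auto
    then show "bij_betw (\<pi> p) {..<n} {..<n}" using p by (simp add: \<pi>_def)
  qed
  have fixed: "Y r = X r" if "r \<notin> S" for r using \<pi>o that by (simp add: Y_def)
  have "ed (Y c) = ed ((\<lambda>p. X (\<rho> p) p)(i := X e i))"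
    by (rule ed_cong) (auto simp: Y_def \<pi>c \<rho>'_def)
  moreover have "ed (Y d) = ed ((\<lambda>p. X (\<sigma> p) p)(j := X e j))"
    by (rule ed_cong) (auto simp: Y_def \<pi>d \<sigma>'_def)
  ultimately have ed: "ed (Y c)" "ed (Y d)" using h by auto
  have cdE: "c \<notin> edge_rows X" "d \<notin> edge_rows X" using cd edge_rows_holes by blast+
  have sub: "insert c (insert d (edge_rows X - {e})) \<subseteq> edge_rows Y"
  proof
    fix r assume r: "r \<in> insert c (insert d (edge_rows X - {e}))"
    then consider "r = c" | "r = d" | "r \<in> edge_rows X" "r \<notin> S" using edge_rows_holes by (auto simp: S_def)
    then show "r \<in> edge_rows Y" using ed cd rows_less fixed by cases (auto simp: edge_rows_def)
  qed
  have "card (insert c (insert d (edge_rows X - {e}))) = Suc (card (edge_rows X))"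
    using cdE cd(3) e(1) by (simp add: card_Suc_Diff1[OF finite_rows(1) e(1)] del: card_Diff_insert)
  then have "Suc (card (edge_rows X)) \<le> card (edge_rows Y)" using card_mono[OF finite_rows(1) sub] by simp
  moreover have "F \<inter> S = {}" using maximal_holes_disjoint[OF X] e(2) by (auto simp: S_def)
  then have "\<forall>r\<in>F. Y r = X r" using fixed by blast
  then have "card (edge_rows Y) \<le> card (edge_rows X)" using X \<open>arr Y\<close> by (simp add: maximal_def)
  ultimately show False by simp
qed

text \<open>Each absorption fills one hole and spoils one reserved pair. Any two rows have more than
  \<open>k0\<close> absorbers and at most \<open>k0\<close> are ever spoiled, so an intact one
  exists until a single hole is left.\<close>

lemma absorb_holes:
  assumes X: "arr X" "{..<2 * t} \<subseteq> edge_rows X" and K: "\<alpha> \<in> K" "\<beta> \<in> K" "\<alpha> \<noteq> \<beta>"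
    and absorb: "\<And>c d. \<forall>p\<in>K. c p \<in> V p \<and> d p \<in> V p \<Longrightarrow>
      k0 < card {i. i < t \<and> absorbs \<alpha> \<beta> c d (X (2 * i)) (X (2 * i + 1))}"
    and few: "n \<le> card (edge_rows X) + k0 + 1"
  shows "\<exists>Y. arr Y \<and> n - 1 \<le> card (edge_rows Y)"
proof -
  have "\<exists>Y S. arr Y \<and> finite S \<and> card S \<le> j \<and> (\<forall>i<t. i \<notin> S \<longrightarrow> Y (2 * i) = X (2 * i) \<and> Y (2 * i + 1) = X (2 * i + 1)) \<and>
    (n - 1 \<le> card (edge_rows Y) \<or> card (edge_rows X) + j \<le> card (edge_rows Y))" if "j \<le> k0" for j
    using that
  proof (induction j)
    case 0
    show ?case using X(1) by (intro exI[of _ X] exI[of _ "{}"]) auto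
  next
    case (Suc j)
    then obtain Y S where Y: "arr Y" "finite S" "card S \<le> j"
      "\<And>i. i < t \<Longrightarrow> i \<notin> S \<Longrightarrow> Y (2 * i) = X (2 * i) \<and> Y (2 * i + 1) = X (2 * i + 1)"
      "n - 1 \<le> card (edge_rows Y) \<or> card (edge_rows X) + j \<le> card (edge_rows Y)" by auto
    show ?case
    proof (cases "n - 1 \<le> card (edge_rows Y)")
      case True
      then show ?thesis using Y by (intro exI[of _ Y] exI[of _ S]) auto
    next
      case False
      then have "2 \<le> card (holes Y)" using card_edge_rows_holes[of Y] by linarith
      then obtain c d where cd: "c \<in> holes Y" "d \<in> holes Y" "c \<noteq> d"
        by (metis card_2_iff' card_le_Suc0_iff_eq finite_rows(2) not_less_eq_eq numeral_2_eq_2)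
      have "\<forall>p\<in>K. Y c p \<in> V p \<and> Y d p \<in> V p" using cd rows_less arr_mem[OF Y(1)] by auto
      from absorb[OF this] have "\<not> {i. i < t \<and> absorbs \<alpha> \<beta> (Y c) (Y d) (X (2 * i)) (X (2 * i + 1))} \<subseteq> S"
        using card_mono[OF Y(2)] Y(3) Suc.prems by (metis (no_types, lifting) Suc_leD leD le_trans)
      then obtain i where i: "i < t" "i \<notin> S" "absorbs \<alpha> \<beta> (Y c) (Y d) (X (2 * i)) (X (2 * i + 1))" by blast
      define g g' where "g = 2 * i" and "g' = 2 * i + 1"
      have Yg: "Y g = X g" "Y g' = X g'" using Y(4)[OF i(1,2)] by (auto simp: g_def g'_def)
      have "g \<in> edge_rows X" "g' \<in> edge_rows X" using X(2) i(1) by (auto simp: g_def g'_def)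
      then have gE: "g \<in> edge_rows Y" "g' \<in> edge_rows Y" using Yg by (auto simp: edge_rows_def)
      have ne: "c \<noteq> g" "c \<noteq> g'" "d \<noteq> g" "d \<noteq> g'" "g \<noteq> g'"
        using cd gE edge_rows_holes by (blast, blast, blast, blast, simp add: g_def g'_def)
      have lt: "c < n" "d < n" "g < n" "g' < n" using cd gE rows_less by auto
      define Z where "Z = sw \<beta> g g' (sw \<alpha> c g' (sw \<alpha> d g Y))"
      have "Z c = (Y c)(\<alpha> := Y g' \<alpha>)" "Z d = (Y d)(\<alpha> := Y g \<alpha>)" "Z g = (Y g)(\<alpha> := Y d \<alpha>, \<beta> := Y g' \<beta>)"
        using ne K cd(3) by (simp_all add: Z_def fun_upd_def)
      then have "holes Z \<inter> set [c, d, g, g'] \<subseteq> {g'}"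
        using i(3) Yg by (auto simp: holes_def absorbs_def g_def g'_def)
      moreover have "arr Z" using Y(1) lt by (simp add: Z_def arr_sw)
      ultimately have "aug (set [c, d, g, g']) Y Z"
        using cd lt by (intro augI[of _ _ _ c d g']) (auto simp: Z_def)
      then have "card (edge_rows Y) < card (edge_rows Z)" by (rule aug_less)
      then have "n - 1 \<le> card (edge_rows Z) \<or> card (edge_rows X) + Suc j \<le> card (edge_rows Z)"
        using Y(5) False by linarith
      moreover have "Z (2 * h) = X (2 * h) \<and> Z (2 * h + 1) = X (2 * h + 1)" if h: "h < t" "h \<notin> insert i S" for h
      proof -
        have e: "2 * h \<in> edge_rows Y" "2 * h + 1 \<in> edge_rows Y"
          using X(2) h Y(4)[of h] by (auto simp: edge_rows_def subset_iff)
        have "r \<noteq> c" "r \<noteq> d" if "r \<in> edge_rows Y" for r using that cd edge_rows_holes by blast+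
        moreover have "2 * h \<noteq> g" "2 * h \<noteq> g'" "2 * h + 1 \<noteq> g" "2 * h + 1 \<noteq> g'"
          using h by (auto simp: g_def g'_def)
        ultimately have "Z (2 * h) = Y (2 * h)" "Z (2 * h + 1) = Y (2 * h + 1)"
          using e by (simp_all add: Z_def)
        then show ?thesis using Y(4)[of h] h by simp
      qed
      moreover have "card (insert i S) \<le> Suc j" using Y(3) card_insert_le_m1[of "Suc j" S i] by simp
      ultimately show ?thesis using \<open>arr Z\<close> Y(2) by (intro exI[of _ Z] exI[of _ "insert i S"]) auto
    qed
  qed
  from this[of k0] obtain Y where "arr Y" "n - 1 \<le> card (edge_rows Y) \<or> card (edge_rows X) + k0 \<le> card (edge_rows Y)"
    by blast
  then show ?thesis using few by (intro exI[of _ Y]) auto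
qed

end

section \<open>Maximal arrays with many holes\<close>

text \<open>The case of too many holes for absorption: \<open>I\<close> are the large indices,
  \<open>F\<close> the absorber rows, and \<open>l\<close> collects the losses caused by the small
  indices and by \<open>F\<close>. The size of \<open>Rs\<close> leaves \<open>card K + 1\<close>
  fresh holes after \<open>card K - 1\<close> of them are set aside in
  \<open>B_transversal_hits\<close>.\<close>

locale stuck_arrangement = kpartite_system K n V ed a
  for K :: "'i set" and n :: nat and V :: "'i \<Rightarrow> 'v set" and ed a +
  fixes X :: "nat \<Rightarrow> 'i \<Rightarrow> 'v" and F Rs :: "nat set" and I :: "'i set" and l :: nat
  assumes max: "maximal F X" and Rs: "Rs \<subseteq> holes X" "card Rs = 2 * card K" and K2: "2 \<le> card K"
    and I: "I \<subseteq> K" and l: "sum a (K - I) + card K * card F \<le> l"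
    and less: "card (edge_rows X) < sum a K"
begin

text \<open>The extremal pattern: all holes of \<open>Rs\<close> agree on the one large column at
  which they hit \<open>r\<close>.\<close>

definition std :: "'i \<Rightarrow> nat set" where
  "std i = {r \<in> edge_rows X - F. \<forall>c\<in>Rs. \<forall>j\<in>I. r \<in> Hit X c j \<longleftrightarrow> j = i}"

definition bad :: "nat set" where
  "bad = edge_rows X - F - (\<Union>i\<in>I. std i)"

text \<open>The vertices that can be brought into a hole row. A rotation at the column of its type
  turns a standard row into a hole and leaves its other entries in place, which is why
  \<open>j = p\<close> is excluded.\<close>

definition B :: "'i \<Rightarrow> 'v set" where
  "B p = {X r p |r. r \<in> holes X \<or> (\<exists>j\<in>I - {p}. r \<in> std j)}"

definition slack :: nat where
  "slack = l + 2 * card K * l"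

lemma arrX: "arr X" and F_edges: "F \<subseteq> edge_rows X"
  using max by (auto simp: maximal_def)

lemma finite_sets: "finite F" "finite Rs" "finite I" "finite (std i)" "finite bad"
  using F_edges Rs I finite_K finite_subset[OF _ finite_rows(1)] finite_subset[OF _ finite_rows(2)]
    finite_subset by (auto simp: std_def bad_def)

lemma std_edge: "r \<in> std i \<Longrightarrow> r \<in> edge_rows X \<and> r \<notin> F"
  by (simp add: std_def)

lemma std_hit: "r \<in> std i \<Longrightarrow> c \<in> Rs \<Longrightarrow> i \<in> I \<Longrightarrow> r \<in> Hit X c i"
  by (simp add: std_def)

lemma Rs_nonempty: "\<exists>c. c \<in> Rs"
  using Rs(2) K2 by (metis card.empty equals0I mult_is_0 not_numeral_le_zero zero_neq_numeral)

lemma std_unique: "r \<in> std i \<Longrightarrow> r \<in> std j \<Longrightarrow> i \<in> I \<Longrightarrow> j \<in> I \<Longrightarrow> i = j"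
  using Rs_nonempty by (auto simp: std_def)

lemma card_F_le: "card F \<le> l"
proof -
  have "1 * card F \<le> card K * card F" using K2 by (intro mult_le_mono1) simp
  then show ?thesis using l by linarith
qed

text \<open>Every edge row that is not standard misses one of the \<open>card Rs\<close> possible hits by the rows of
  \<open>Rs\<close>, while on average each edge row receives all of them.\<close>

lemma card_bad: "card bad \<le> 2 * card K * l"
proof -
  define E where "E = edge_rows X - F"
  define R where "R = 2 * card K"
  have finE: "finite E" by (simp add: E_def)
  define N where "N e = {(c, i). c \<in> Rs \<and> i \<in> I \<and> e \<in> Hit X c i}" for e
  have N_sub: "N e \<subseteq> Rs \<times> I" for e by (auto simp: N_def)
  have finN: "finite (N e)" for e using finite_subset[OF N_sub] finite_sets by blast
  have conflict: "i = j" if "e \<in> E" "(c, i) \<in> N e" "(d, j) \<in> N e" "c \<noteq> d" for e c d i j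
    using Hit_disjoint[OF max, of c d i j] that Rs(1) unfolding N_def E_def by blast
  have N_bad: "card (N e) + 1 \<le> R" if e: "e \<in> bad" for e
  proof -
    have eE: "e \<in> E" using e by (simp add: bad_def E_def)
    show ?thesis
    proof (cases "\<exists>c i j. (c, i) \<in> N e \<and> (c, j) \<in> N e \<and> i \<noteq> j")
      \<comment> \<open>A hole that hits \<open>e\<close> at two columns excludes every other hole,
        by \<open>conflict\<close>; at most \<open>card K\<close> pairs remain, fewer than
        \<open>2 * card K\<close>.\<close>
      case True
      then obtain c i j where c: "(c, i) \<in> N e" "(c, j) \<in> N e" "i \<noteq> j" by blast
      have "N e \<subseteq> {c} \<times> I"
      proof
        fix x assume x: "x \<in> N e"
        obtain d h where dh: "x = (d, h)" by (cases x)
        have "d = c" using conflict[OF eE, of d h c i] conflict[OF eE, of d h c j] c x dh by blast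
        then show "x \<in> {c} \<times> I" using x dh N_sub by blast
      qed
      then have "card (N e) \<le> card ({c} \<times> I)" using finite_sets by (intro card_mono) auto
      also have "\<dots> \<le> card K" using card_mono[OF finite_K I] by (simp add: card_cartesian_product)
      finally show ?thesis using K2 by (simp add: R_def)
    next
      case False
      then have "inj_on fst (N e)" by (auto simp: inj_on_def)
      then have c: "card (N e) = card (fst ` N e)" by (simp add: card_image)
      have sub: "fst ` N e \<subseteq> Rs" using N_sub by force
      have "fst ` N e \<noteq> Rs"
      proof
        assume all: "fst ` N e = Rs"
        obtain c0 where "c0 \<in> Rs" using Rs_nonempty by blast
        then obtain i where i: "(c0, i) \<in> N e" using all by force
        have "(c, j) \<in> N e \<longleftrightarrow> j = i" if "c \<in> Rs" for c j
        proof -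
          obtain h where h: "(c, h) \<in> N e" using \<open>c \<in> Rs\<close> all by force
          have "h = i" using conflict[OF eE h i] False h i by blast
          then show ?thesis using False h by blast
        qed
        then have "e \<in> std i" using eE i by (auto simp: std_def E_def N_def)
        moreover have "i \<in> I" using i by (simp add: N_def)
        ultimately show False using e by (auto simp: bad_def)
      qed
      then have "card (fst ` N e) < card Rs" using sub finite_sets by (intro psubset_card_mono) auto
      then show ?thesis using c Rs(2) by (simp add: R_def)
    qed
  qed
  have N_good: "card (N e) \<le> R" if e: "e \<in> E - bad" for e
  proof -
    obtain i where i: "i \<in> I" "e \<in> std i" using e by (auto simp: bad_def E_def)
    have "N e \<subseteq> Rs \<times> {i}" using i by (auto simp: N_def std_def)
    then have "card (N e) \<le> card (Rs \<times> {i})" using finite_sets by (intro card_mono) auto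
    then show ?thesis using Rs(2) by (simp add: R_def card_cartesian_product)
  qed
  have "R * sum a I \<le> (\<Sum>(c, i)\<in>Rs \<times> I. card {e \<in> E. (c, i) \<in> N e}) + R * (card K * card F)"
  proof -
    have "(\<Sum>(c, i)\<in>Rs \<times> I. a i) \<le> (\<Sum>(c, i)\<in>Rs \<times> I. card {e \<in> E. (c, i) \<in> N e} + card F)"
    proof (rule sum_mono, clarsimp)
      fix c i assume ci: "c \<in> Rs" "i \<in> I"
      have "a i \<le> card (Hit X c i)" using card_Hit_maximal[OF max] ci Rs I by blast
      also have "\<dots> \<le> card ({e \<in> E. (c, i) \<in> N e} \<union> F)"
        using ci finite_sets finE by (intro card_mono) (auto simp: N_def E_def dest: Hit_edge)
      also have "\<dots> \<le> card {e \<in> E. (c, i) \<in> N e} + card F" by (rule card_Un_le)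
      finally show "a i \<le> card {e \<in> E. (c, i) \<in> N e} + card F" .
    qed
    also have "\<dots> = (\<Sum>(c, i)\<in>Rs \<times> I. card {e \<in> E. (c, i) \<in> N e}) + R * card I * card F"
      by (simp add: case_prod_beta sum.distrib card_cartesian_product Rs(2) R_def)
    also have "R * card I * card F \<le> R * (card K * card F)"
      using card_mono[OF finite_K I] by simp
    finally show ?thesis
      using sum.cartesian_product[of "\<lambda>c i. a i" I Rs] Rs(2) by (simp add: R_def)
  qed
  also have "(\<Sum>(c, i)\<in>Rs \<times> I. card {e \<in> E. (c, i) \<in> N e}) = (\<Sum>e\<in>E. card (N e))"
  proof -
    have "(\<Sum>x\<in>Rs \<times> I. card {e \<in> E. x \<in> N e}) = (\<Sum>e\<in>E. card {x \<in> Rs \<times> I. x \<in> N e})"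
      by (rule sum_multicount_gen) (use finite_sets finE in auto)
    moreover have "{x \<in> Rs \<times> I. x \<in> N e} = N e" for e using N_sub by blast
    ultimately show ?thesis by (simp add: case_prod_beta)
  qed
  finally have "R * sum a I \<le> (\<Sum>e\<in>E. card (N e)) + R * (card K * card F)" .
  moreover have "(\<Sum>e\<in>E. card (N e)) + card bad \<le> R * card E"
  proof -
    have bE: "bad \<subseteq> E" by (auto simp: bad_def E_def)
    have "(\<Sum>e\<in>E. card (N e)) = (\<Sum>e\<in>E - bad. card (N e)) + (\<Sum>e\<in>bad. card (N e))"
      using sum.subset_diff[OF bE finE] by simp
    moreover have "(\<Sum>e\<in>E - bad. card (N e)) \<le> card (E - bad) * R"
      using sum_bounded_above[of "E - bad" _ R] N_good by simp
    moreover have "(\<Sum>e\<in>bad. card (N e) + 1) \<le> card bad * R"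
      using sum_bounded_above[of bad "\<lambda>e. card (N e) + 1" R] N_bad by simp
    then have "(\<Sum>e\<in>bad. card (N e)) + card bad \<le> card bad * R"
      unfolding sum.distrib by simp
    moreover have "card (E - bad) + card bad = card E"
      using bE finE card_mono[OF finE bE] by (simp add: card_Diff_subset finite_sets)
    then have "card (E - bad) * R + card bad * R = R * card E" by (metis add_mult_distrib mult.commute)
    ultimately show ?thesis by linarith
  qed
  ultimately have "R * sum a I + card bad \<le> R * card E + R * (card K * card F)" by linarith
  moreover have "card E \<le> card (edge_rows X)" by (auto simp: E_def intro: card_mono)
  then have "card E + card K * card F \<le> sum a I + l"
    using less l sum.subset_diff[OF I finite_K, of a] by linarith
  then have "R * card E + R * (card K * card F) \<le> R * sum a I + R * l"
    by (metis add_mult_distrib2 mult_le_mono2)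
  ultimately show ?thesis by (simp add: R_def)
qed

lemma card_F_bad: "card F + card bad \<le> slack"
  using card_F_le card_bad by (simp add: slack_def)

lemma std_lower: "i \<in> I \<Longrightarrow> a i \<le> card (std i) + slack"
proof -
  assume i: "i \<in> I"
  obtain c where c: "c \<in> Rs" using Rs_nonempty by blast
  have "a i \<le> card (Hit X c i)" using card_Hit_maximal[OF max] c i Rs I by blast
  also have "Hit X c i \<subseteq> std i \<union> (F \<union> bad)"
  proof
    fix r assume r: "r \<in> Hit X c i"
    show "r \<in> std i \<union> (F \<union> bad)"
    proof (rule ccontr)
      assume n: "r \<notin> std i \<union> (F \<union> bad)"
      then obtain j where "j \<in> I" "r \<in> std j" using Hit_edge[OF r] by (auto simp: bad_def)
      moreover then have "i = j" using r c i by (simp add: std_def)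
      ultimately show False using n by simp
    qed
  qed
  then have "card (Hit X c i) \<le> card (std i \<union> (F \<union> bad))" using finite_sets by (intro card_mono) auto
  also have "\<dots> \<le> card (std i) + (card F + card bad)"
    by (meson card_Un_le add_left_mono order_trans)
  finally show ?thesis using card_F_bad by linarith
qed

lemma sum_std: "(\<Sum>i\<in>I. card (std i)) \<le> card (edge_rows X)"
proof -
  have "(\<Sum>i\<in>I. card (std i)) = card (\<Union>i\<in>I. std i)"
    using finite_sets std_unique by (intro card_UN_disjoint[symmetric]) auto
  also have "\<dots> \<le> card (edge_rows X)" using std_edge by (intro card_mono) auto
  finally show ?thesis .
qed

text \<open>The lower bounds for the other types leave no more room, as the total is below
  \<open>sum a K\<close>.\<close>

lemma std_upper: "i \<in> I \<Longrightarrow> card (std i) \<le> a i + l + card K * slack"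
proof -
  assume i: "i \<in> I"
  have "card (std i) + (\<Sum>j\<in>I - {i}. card (std j)) \<le> card (edge_rows X)"
    using sum_std sum.remove[OF finite_sets(3) i, of "\<lambda>j. card (std j)"] by simp
  moreover have "sum a (I - {i}) \<le> (\<Sum>j\<in>I - {i}. card (std j) + slack)"
    using std_lower by (intro sum_mono) auto
  then have "sum a (I - {i}) \<le> (\<Sum>j\<in>I - {i}. card (std j)) + card (I - {i}) * slack"
    by (simp add: sum.distrib)
  moreover have "card (I - {i}) * slack \<le> card K * slack"
    using card_mono[OF finite_K, of "I - {i}"] I by (intro mult_le_mono1) auto
  moreover have "sum a K = a i + sum a (I - {i}) + sum a (K - I)"
    using sum.subset_diff[OF I finite_K, of a] sum.remove[OF finite_sets(3) i, of a] by simp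
  ultimately show ?thesis using less l by linarith
qed

text \<open>The error \<open>l + card K * slack\<close> of \<open>std_upper\<close>, another
  \<open>slack\<close> for reserved and bad rows, and \<open>card K\<close> for the rows moved by
  rotations.\<close>

definition miss :: nat where
  "miss = l + (card K + 1) * slack + card K"

lemma B_V: "p \<in> K \<Longrightarrow> x \<in> B p \<Longrightarrow> x \<in> V p"
  using arr_mem[OF arrX] rows_less std_edge unfolding B_def by blast

text \<open>Rotations move the vertices of \<open>x\<close> into hole rows of another maximal array, so \<open>x\<close> hits as
  many standard rows as a hole row does.\<close>

lemma B_transversal_hits:
  assumes i: "i \<in> I" and x: "\<And>p. p \<in> K - {i} \<Longrightarrow> x p \<in> B p"
  shows "card {r \<in> std i. \<not> ed (x(i := X r i))} \<le> miss"
proof -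
  have iK: "i \<in> K" using i I by blast
  have "\<exists>r. x p = X r p \<and> (r \<in> holes X \<or> (\<exists>j\<in>I - {p}. r \<in> std j))" if "p \<in> K - {i}" for p
    using x[OF that] by (auto simp: B_def)
  then obtain \<rho> where \<rho>: "\<And>p. p \<in> K - {i} \<Longrightarrow> x p = X (\<rho> p) p"
    "\<And>p. p \<in> K - {i} \<Longrightarrow> \<rho> p \<in> holes X \<or> (\<exists>j\<in>I - {p}. \<rho> p \<in> std j)" by metis
  define P where "P = \<rho> ` (K - {i})"
  have finP: "finite P" using finite_K by (simp add: P_def)
  have cP: "card P + 1 \<le> card K"
    using card_image_le[of "K - {i}" \<rho>] finite_K iK K2 unfolding P_def
    by (simp add: card_Diff_singleton)
  define D where "D = P - holes X"
  have "\<exists>j\<in>I. r \<in> std j" if "r \<in> D" for r using that \<rho>(2) by (force simp: D_def P_def)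
  then obtain \<tau> where \<tau>: "\<And>r. r \<in> D \<Longrightarrow> \<tau> r \<in> I \<and> r \<in> std (\<tau> r)" by metis
  have \<tau>\<rho>: "\<tau> (\<rho> p) \<noteq> p" if "p \<in> K - {i}" "\<rho> p \<in> D" for p
    using \<rho>(2)[OF that(1)] \<tau>[OF that(2)] that(2) std_unique by (auto simp: D_def)
  \<comment> \<open>Holes that contribute nothing to \<open>x\<close>: one for each row of
    \<open>D\<close>, to be rotated with it, and a further one, \<open>c0\<close>, that stays a hole
    and produces the conflicts.\<close>
  define Fr where "Fr = Rs - P"
  have "card Fr \<ge> card K + 1"
  proof -
    have "card Rs - card P \<le> card (Rs - P)" by (rule diff_card_le_card_Diff[OF finP])
    then show ?thesis using cP Rs(2) by (simp add: Fr_def)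
  qed
  moreover have cD: "card D + 1 \<le> card K"
    using card_mono[OF finP, of D] cP by (auto simp: D_def)
  ultimately have cFr: "card D < card Fr" by linarith
  have finFr: "finite Fr" using finite_sets by (simp add: Fr_def)
  have finD: "finite D" using finP by (simp add: D_def)
  then obtain \<kappa> where \<kappa>: "inj_on \<kappa> D" "\<forall>r\<in>D. \<kappa> r \<in> Fr"
    using distinct_representatives[of D "\<lambda>_. Fr"] cFr finFr by auto
  then have "card (\<kappa> ` D) < card Fr" using cFr by (simp add: card_image)
  then obtain c0 where c0: "c0 \<in> Fr" "c0 \<notin> \<kappa> ` D"
    using finD by (metis card_mono finite_imageI not_less subsetI)
  have \<kappa>h: "\<kappa> r \<in> holes X" "\<kappa> r \<in> Rs" "\<kappa> r \<notin> P" if "r \<in> D" for r using \<kappa>(2) that Rs(1) by (auto simp: Fr_def)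
  have DE: "r \<in> edge_rows X" "r \<notin> F" "r \<notin> holes X" if "r \<in> D" for r
    using std_edge \<tau>[OF that] edge_rows_holes by blast+
  \<comment> \<open>Each row \<open>r\<close> of \<open>D\<close> is rotated with its own hole
    \<open>\<kappa> r\<close> at the column of its type. By \<open>\<tau>\<rho>\<close> this is
    never a column where \<open>x\<close> takes its entry from \<open>r\<close>.\<close>
  have "\<exists>Y. maximal F Y \<and> holes Y = (holes X - \<kappa> ` D') \<union> D' \<and> (\<forall>r. r \<notin> D' \<union> \<kappa> ` D' \<longrightarrow> Y r = X r) \<and>
      (\<forall>r\<in>D'. \<forall>p. p \<noteq> \<tau> r \<longrightarrow> Y r p = X r p)" if "D' \<subseteq> D" for D'
  proof -
    have "finite D'" using that finD finite_subset by blast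
    then show ?thesis using that
    proof (induction D' rule: finite_induct)
      case empty
      then show ?case using max by (intro exI[of _ X]) auto
    next
      case (insert r D')
      then obtain Y where Y: "maximal F Y" "holes Y = (holes X - \<kappa> ` D') \<union> D'"
        "\<And>r. r \<notin> D' \<union> \<kappa> ` D' \<Longrightarrow> Y r = X r" "\<And>r p. r \<in> D' \<Longrightarrow> p \<noteq> \<tau> r \<Longrightarrow> Y r p = X r p" by auto
      have r: "r \<in> D" and D': "D' \<subseteq> D" using insert by auto
      have \<kappa>r: "\<kappa> r \<notin> \<kappa> ` D'" using insert.hyps r D' \<kappa>(1) by (auto simp: inj_on_def)
      have \<kappa>D: "\<kappa> s \<notin> D" if "s \<in> D" for s using \<kappa>h[OF that] DE by blast
      have rows: "Y (\<kappa> r) = X (\<kappa> r)" "Y r = X r"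
        using Y(3) \<kappa>r \<kappa>D r D' insert.hyps by blast+
      have hol: "\<kappa> r \<in> holes Y" using Y(2) \<kappa>h[OF r] \<kappa>r by blast
      have "r \<notin> holes Y" using Y(2) DE[OF r] insert.hyps by blast
      then have "r \<in> edge_rows Y" using DE[OF r] rows_less edge_or_hole by blast
      moreover have "r \<in> Hit X (\<kappa> r) (\<tau> r)" using std_hit \<tau>[OF r] \<kappa>h[OF r] by blast
      ultimately have "r \<in> Hit Y (\<kappa> r) (\<tau> r)" by (simp add: Hit_def rows)
      note rot = rotate[OF Y(1) hol this DE(2)[OF r]]
      let ?Z = "sw (\<tau> r) (\<kappa> r) r Y"
      have "holes ?Z = (holes X - \<kappa> ` insert r D') \<union> insert r D'"
        using rot(2) Y(2) \<kappa>D r D' by auto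
      moreover have "?Z s = X s" if "s \<notin> insert r D' \<union> \<kappa> ` insert r D'" for s
        using that Y(3) by simp
      moreover have "?Z s p = X s p" if "s \<in> insert r D'" "p \<noteq> \<tau> s" for s p
      proof (cases "s = r")
        case True
        then show ?thesis using that rows by (simp add: sw_apply)
      next
        case False
        moreover have "s \<noteq> \<kappa> r" using \<kappa>D[OF r] that(1) r D' by auto
        ultimately show ?thesis using that Y(4) by simp
      qed
      ultimately show ?case using rot(1) by blast
    qed
  qed
  from this[of D] obtain Y where Y: "maximal F Y" "holes Y = (holes X - \<kappa> ` D) \<union> D"
    "\<And>r. r \<notin> D \<union> \<kappa> ` D \<Longrightarrow> Y r = X r" "\<And>r p. r \<in> D \<Longrightarrow> p \<noteq> \<tau> r \<Longrightarrow> Y r p = X r p" by auto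
  have \<rho>Y: "\<rho> p \<in> holes Y \<and> Y (\<rho> p) p = x p" if p: "p \<in> K - {i}" for p
  proof (cases "\<rho> p \<in> D")
    case True
    then show ?thesis using Y(2,4) \<tau>\<rho>[OF p True] \<rho>(1)[OF p] by auto
  next
    case False
    have "\<rho> p \<in> P" using p by (simp add: P_def)
    then have "\<rho> p \<notin> \<kappa> ` D" "\<rho> p \<in> holes X" using \<kappa>h False by (auto simp: D_def)
    then show ?thesis using Y(2,3) False \<rho>(1)[OF p] by auto
  qed
  have xeq: "ed (x(i := v)) = ed ((\<lambda>p. Y (\<rho> p) p)(i := v))" for v
    using \<rho>Y by (intro ed_cong) auto
  have c0Y: "c0 \<in> holes Y" "Y c0 = X c0" "c0 \<in> Rs"
  proof -
    have "c0 \<in> holes X" using c0 Rs(1) by (auto simp: Fr_def)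
    then have "c0 \<notin> D" using DE by blast
    then show "c0 \<in> holes Y" "Y c0 = X c0" using Y(2,3) c0 \<open>c0 \<in> holes X\<close> by auto
    show "c0 \<in> Rs" using c0 by (simp add: Fr_def)
  qed
  have c0P: "c0 \<notin> P" using c0 by (simp add: Fr_def)
  have arrY: "arr Y" using Y(1) by (simp add: maximal_def)
  define H where "H = {r. r < n \<and> ed (x(i := Y r i))}"
  have "a i \<le> card H" unfolding H_def
    using card_hits[OF arrY iK, of x] x B_V by blast
  have "K - {i} \<noteq> {}" using K2 card_mono[of "{i}" K] by auto
  then obtain p0 where p0: "p0 \<in> K - {i}" by blast
  have d0: "\<rho> p0 \<in> holes Y" "\<rho> p0 \<noteq> c0" using \<rho>Y[OF p0] c0P p0 by (auto simp: P_def)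
  \<comment> \<open>A standard row of another type \<open>j\<close> is hit by \<open>c0\<close> at
    \<open>j\<close>, so a hit by \<open>x\<close> at \<open>i\<close> would contradict
    \<open>conflict_general\<close>.\<close>
  have Hsub: "H \<subseteq> (std i \<inter> H) \<union> (F \<union> bad \<union> \<kappa> ` D)"
  proof
    fix r assume r: "r \<in> H"
    then have rn: "r < n" and re: "ed ((\<lambda>p. Y (\<rho> p) p)(i := Y r i))" using xeq by (auto simp: H_def)
    have "r \<notin> holes Y" using hole_general[OF Y(1) iK, of \<rho> r] \<rho>Y re by blast
    then have rY: "r \<in> edge_rows Y" using rn edge_or_hole by blast
    show "r \<in> (std i \<inter> H) \<union> (F \<union> bad \<union> \<kappa> ` D)"
    proof (rule ccontr)
      assume neg: "\<not> ?thesis"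
      have "r \<notin> D" using \<open>r \<notin> holes Y\<close> Y(2) by blast
      then have "Y r = X r" using Y(3) neg by blast
      then have "r \<in> edge_rows X" using rY by (simp add: edge_rows_def)
      then obtain j where j: "j \<in> I" "r \<in> std j" "j \<noteq> i" using neg r by (auto simp: bad_def)
      have "r \<in> Hit X c0 j" using std_hit[OF j(2) c0Y(3) j(1)] .
      then have "ed ((Y c0)(j := Y r j))" using c0Y \<open>Y r = X r\<close> by (simp add: Hit_def)
      moreover have "r \<notin> F" using neg by blast
      moreover have "\<rho> p \<noteq> c0" if "p \<in> K - {i}" for p using c0P that by (auto simp: P_def)
      ultimately show False
        using conflict_general[OF Y(1) iK _ _ d0(1) c0Y(1) d0(2), of j \<rho> "\<lambda>_. c0" r] j I \<rho>Y re rY c0Y(1)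
        by auto
    qed
  qed
  have "card H \<le> card (std i \<inter> H) + (card F + card bad + card D)"
  proof -
    have "card H \<le> card ((std i \<inter> H) \<union> (F \<union> bad \<union> \<kappa> ` D))"
      using Hsub finite_sets finD by (intro card_mono) auto
    also have "\<dots> \<le> card (std i \<inter> H) + card (F \<union> bad \<union> \<kappa> ` D)" by (rule card_Un_le)
    also have "card (F \<union> bad \<union> \<kappa> ` D) \<le> card F + card bad + card (\<kappa> ` D)"
      by (meson card_Un_le add_right_mono order_trans)
    also have "card (\<kappa> ` D) \<le> card D" by (rule card_image_le[OF finD])
    finally show ?thesis by simp
  qed
  moreover have "{r \<in> std i. \<not> ed (x(i := X r i))} \<subseteq> std i - H"
  proof
    fix r assume r: "r \<in> {r \<in> std i. \<not> ed (x(i := X r i))}"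
    show "r \<in> std i - H"
    proof (rule ccontr)
      assume "\<not> ?thesis"
      then have rH: "r \<in> H" using r by blast
      then have "r \<notin> holes Y" using hole_general[OF Y(1) iK, of \<rho> r] \<rho>Y xeq by (auto simp: H_def)
      then have "r \<notin> D" using Y(2) by blast
      moreover have "r \<notin> \<kappa> ` D" using \<kappa>h r std_edge edge_rows_holes by blast
      ultimately have "Y r = X r" using Y(3) by blast
      then show False using rH r by (simp add: H_def)
    qed
  qed
  then have "card {r \<in> std i. \<not> ed (x(i := X r i))} \<le> card (std i - H)"
    using finite_sets by (intro card_mono) auto
  moreover have "card (std i) = card (std i \<inter> H) + card (std i - H)"
    by (metis Int_Diff_Un Int_Diff_disjoint card_Un_disjoint finite_Diff finite_Int finite_sets(4))
  ultimately show ?thesis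
    using std_upper[OF i] card_F_bad cD \<open>a i \<le> card H\<close> unfolding miss_def by simp
qed

end

section \<open>Arrays that differ from the maximal one in few rows\<close>

context stuck_arrangement
begin

definition B_row :: "('i \<Rightarrow> 'v) \<Rightarrow> bool" where
  "B_row x \<longleftrightarrow> (\<forall>p\<in>K. x p \<in> B p)"

definition changed :: "(nat \<Rightarrow> 'i \<Rightarrow> 'v) \<Rightarrow> nat set" where
  "changed Z = {r. r < n \<and> Z r \<noteq> X r}"

text \<open>One hole is left uncontrolled because an augmentation may leave one in its support. Few
  changed rows mean that most standard rows of \<open>X\<close> are still available.\<close>

definition near :: "nat \<Rightarrow> (nat \<Rightarrow> 'i \<Rightarrow> 'v) \<Rightarrow> bool" where
  "near D Z \<longleftrightarrow> arr Z \<and> card (changed Z) \<le> D \<and> (\<exists>h. \<forall>r\<in>holes Z. r \<noteq> h \<longrightarrow> B_row (Z r))"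

lemma finite_changed: "finite (changed Z)"
  by (simp add: changed_def)

lemma card_changed:
  assumes "card (changed Z) \<le> D" "finite S" "\<And>r. r \<notin> S \<Longrightarrow> Y r = Z r"
  shows "card (changed Y) \<le> D + card S"
proof -
  have "changed Y \<subseteq> changed Z \<union> S" using assms(3) by (auto simp: changed_def)
  then have "card (changed Y) \<le> card (changed Z \<union> S)"
    using finite_changed assms(2) by (intro card_mono) auto
  then show ?thesis using card_Un_le[of "changed Z" S] assms(1) by linarith
qed

lemma aug_near:
  assumes "aug S Z Y" "card (changed Z) \<le> D" "\<And>r. r \<in> holes Z \<Longrightarrow> r \<notin> S \<Longrightarrow> B_row (Z r)"
  shows "near (D + 7) Y"
proof -
  have S: "finite S" "card S \<le> 7" "arr Y" "\<And>r. r \<notin> S \<Longrightarrow> Y r = Z r" "card (holes Y \<inter> S) \<le> 1"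
    using assms(1) finite_subset unfolding aug_def by blast+
  have "\<forall>r\<in>holes Y \<inter> S. \<forall>q\<in>holes Y \<inter> S. r = q"
    using S(5) by (simp add: card_le_Suc0_iff_eq)
  then obtain h where h: "holes Y \<inter> S \<subseteq> {h}" by (cases "holes Y \<inter> S = {}") auto
  have "B_row (Y r)" if "r \<in> holes Y" "r \<noteq> h" for r
  proof -
    have "r \<notin> S" using that h by blast
    then show ?thesis using assms(3)[of r] S(4) that by (simp add: holes_def)
  qed
  then show ?thesis using S(2,3) card_changed[OF assms(2) S(1,4)] by (auto simp: near_def)
qed

lemma card_std_unchanged:
  assumes "card (changed Z) \<le> D"
  shows "card (std i) \<le> card {r \<in> std i. Z r = X r} + D"
proof -
  have "std i \<subseteq> {r \<in> std i. Z r = X r} \<union> changed Z"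
    using std_edge rows_less by (auto simp: changed_def)
  then have "card (std i) \<le> card ({r \<in> std i. Z r = X r} \<union> changed Z)"
    using finite_sets finite_changed by (intro card_mono) auto
  then show ?thesis using card_Un_le[of "{r \<in> std i. Z r = X r}" "changed Z"] assms by linarith
qed

lemma std_row: "r \<in> std i \<Longrightarrow> Z r = X r \<Longrightarrow> r \<in> edge_rows Z"
  using std_edge by (simp add: edge_rows_def)

lemma card_typical:
  assumes "i \<in> I" "\<And>p. p \<in> K - {i} \<Longrightarrow> x p \<in> B p" "S \<subseteq> std i"
  shows "card S \<le> card {r \<in> S. ed (x(i := X r i))} + miss"
proof -
  have fin: "finite S" using assms(3) finite_sets finite_subset by blast
  have "card {r \<in> S. \<not> ed (x(i := X r i))} \<le> card {r \<in> std i. \<not> ed (x(i := X r i))}"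
    using assms(3) finite_sets by (intro card_mono) auto
  also have "\<dots> \<le> miss" by (rule B_transversal_hits[OF assms(1,2)])
  finally have "card {r \<in> S. \<not> ed (x(i := X r i))} \<le> miss" .
  moreover have "card S \<le> card ({r \<in> S. ed (x(i := X r i))} \<union> {r \<in> S. \<not> ed (x(i := X r i))})"
    using fin by (intro card_mono) auto
  ultimately show ?thesis using card_Un_le[of "{r \<in> S. ed (x(i := X r i))}" "{r \<in> S. \<not> ed (x(i := X r i))}"] by linarith
qed

lemma sum_K_le: "sum a K \<le> sum a I + l"
  using sum.subset_diff[OF I finite_K, of a] l by linarith

text \<open>Otherwise the hits of \<open>y\<close> at \<open>i\<close>, at least \<open>a i\<close>
  in number, would be disjoint from the typical hits of \<open>c\<close> at every large column,
  which already account for nearly \<open>sum a I\<close> edge rows. \<open>Z\<close> need not be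
  maximal; the absence of augmentations through \<open>y\<close> takes the place of
  maximality.\<close>

lemma rotate_or_aug:
  assumes Z: "arr Z" "card (changed Z) \<le> D" "card (edge_rows Z) < sum a K"
    and yc: "y \<in> holes Z" "c \<in> holes Z" "y \<noteq> c" "B_row (Z c)" and i: "i \<in> I"
    and big: "l + card K * (slack + D + miss) \<le> a i"
    and no_aug: "\<And>S Y. y \<in> S \<Longrightarrow> \<not> aug S Z Y"
  shows "\<exists>e\<in>std i. Z e = X e \<and> ed ((Z y)(i := Z e i))"
proof (rule ccontr)
  assume neg: "\<not> ?thesis"
  have iK: "i \<in> K" using i I by blast
  define H where "H = Hit Z y i"
  have aH: "a i \<le> card H" unfolding H_def by (rule card_Hit[OF Z(1) yc(1) iK]) (use no_aug in blast)
  define G where "G j = {r \<in> {r \<in> std j. Z r = X r}. ed ((Z c)(j := X r j))}" for j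
  have cG: "a j \<le> card (G j) + (slack + D + miss)" if j: "j \<in> I" for j
  proof -
    have "card {r \<in> std j. Z r = X r} \<le> card (G j) + miss"
      unfolding G_def by (rule card_typical[OF j]) (use yc(4) in \<open>auto simp: B_row_def\<close>)
    then show ?thesis using std_lower[OF j] card_std_unchanged[OF Z(2), of j] by linarith
  qed
  have GE: "G j \<subseteq> edge_rows Z" for j
    using std_edge by (auto simp: G_def edge_rows_def)
  have HG: "H \<inter> G j = {}" if j: "j \<in> I" for j
  proof (rule ccontr)
    assume "H \<inter> G j \<noteq> {}"
    then obtain e where e: "e \<in> H" "e \<in> G j" by blast
    have eZ: "ed ((Z y)(i := Z e i))" "e \<in> edge_rows Z" using e(1) by (auto simp: H_def Hit_def)
    have eG: "e \<in> std j" "Z e = X e" "ed ((Z c)(j := Z e j))" using e(2) by (auto simp: G_def)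
    have "i \<noteq> j" using neg eZ eG by blast
    from aug_conflict[OF Z(1) yc(1,2,3) eZ(2) this eZ(1) eG(3)] show False using no_aug by blast
  qed
  have "card H + (\<Sum>j\<in>I. card (G j)) = card (H \<union> (\<Union>j\<in>I. G j))"
  proof -
    have "(\<Sum>j\<in>I. card (G j)) = card (\<Union>j\<in>I. G j)"
      using finite_sets std_unique by (intro card_UN_disjoint[symmetric]) (auto simp: G_def)
    then show ?thesis using HG finite_sets by (subst card_Un_disjoint) (auto simp: H_def G_def)
  qed
  also have "\<dots> \<le> card (edge_rows Z)"
    using GE by (intro card_mono) (auto simp: H_def dest: Hit_edge)
  finally have 1: "card H + (\<Sum>j\<in>I. card (G j)) \<le> card (edge_rows Z)" .
  have "sum a I \<le> (\<Sum>j\<in>I. card (G j) + (slack + D + miss))" using cG by (intro sum_mono) auto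
  also have "\<dots> = (\<Sum>j\<in>I. card (G j)) + card I * (slack + D + miss)"
    by (simp add: sum.distrib algebra_simps)
  also have "card I * (slack + D + miss) \<le> card K * (slack + D + miss)"
    using card_mono[OF finite_K I] by (rule mult_le_mono1)
  finally show False using 1 aH Z(3) sum_K_le big by linarith
qed

text \<open>Two holes made of \<open>B\<close>-vertices hit nearly all standard rows. A standard row
  of type \<open>\<beta>\<close> that receives the \<open>\<beta>\<close>-entry of one of them again
  consists of \<open>B\<close>-vertices, so it hits nearly all rows of type \<open>\<alpha>\<close>.
  This is the configuration of \<open>no_aug_bound\<close>.\<close>

lemma all_B_aug:
  assumes Z: "arr Z" "card (changed Z) \<le> D" "card (edge_rows Z) < sum a K"
    and cd: "c \<in> holes Z" "d \<in> holes Z" "c \<noteq> d" "B_row (Z c)" "B_row (Z d)"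
    and \<alpha>\<beta>: "\<alpha> \<in> I" "\<beta> \<in> I" "\<alpha> \<noteq> \<beta>"
    and big: "slack + D + 3 * miss + card K \<le> a \<alpha>" "slack + D + 3 * miss + card K \<le> a \<beta>"
  shows "\<exists>S Y. aug S Z Y"
proof (rule ccontr)
  assume no_aug: "\<not> ?thesis"
  have K: "\<alpha> \<in> K" "\<beta> \<in> K" using \<alpha>\<beta> I by auto
  define Sb where "Sb = {r \<in> {r \<in> {r \<in> std \<beta>. Z r = X r}. ed ((Z c)(\<beta> := X r \<beta>))}. ed ((Z d)(\<beta> := X r \<beta>))}"
  have 1: "card {r \<in> std \<beta>. Z r = X r} \<le> card {r \<in> {r \<in> std \<beta>. Z r = X r}. ed ((Z c)(\<beta> := X r \<beta>))} + miss"
    by (rule card_typical[OF \<alpha>\<beta>(2)]) (use cd in \<open>auto simp: B_row_def\<close>)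
  have 2: "card {r \<in> {r \<in> std \<beta>. Z r = X r}. ed ((Z c)(\<beta> := X r \<beta>))} \<le> card Sb + miss"
    unfolding Sb_def by (rule card_typical[OF \<alpha>\<beta>(2)]) (use cd in \<open>auto simp: B_row_def\<close>)
  have "finite Sb \<and> card K \<le> card Sb"
    using 1 2 std_lower[OF \<alpha>\<beta>(2)] card_std_unchanged[OF Z(2), of \<beta>] big(2) finite_sets by (simp add: Sb_def)
  then obtain g where g: "inj_on g K" "\<forall>j\<in>K. g j \<in> Sb"
    using distinct_representatives[OF finite_K, of "\<lambda>_. Sb"] by blast
  define Ta where "Ta h = {r \<in> {r \<in> {r \<in> {r \<in> std \<alpha>. Z r = X r}. ed ((X h)(\<beta> := Z c \<beta>, \<alpha> := X r \<alpha>))}.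
      ed ((X h)(\<beta> := Z d \<beta>, \<alpha> := X r \<alpha>))}. ed ((Z d)(\<alpha> := X r \<alpha>))}" for h
  have Ta: "finite (Ta h) \<and> card K \<le> card (Ta h)" if h: "h \<in> Sb" for h
  proof -
    have hB: "X h p \<in> B p" if "p \<in> K" "p \<noteq> \<beta>" for p
      using h that \<alpha>\<beta>(2) unfolding B_def Sb_def by blast
    have 1: "card {r \<in> std \<alpha>. Z r = X r} \<le> card {r \<in> {r \<in> std \<alpha>. Z r = X r}. ed ((X h)(\<beta> := Z c \<beta>, \<alpha> := X r \<alpha>))} + miss"
      by (rule card_typical[OF \<alpha>\<beta>(1)]) (use cd hB in \<open>auto simp: B_row_def\<close>)
    have 2: "card {r \<in> {r \<in> std \<alpha>. Z r = X r}. ed ((X h)(\<beta> := Z c \<beta>, \<alpha> := X r \<alpha>))} \<le>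
        card {r \<in> {r \<in> {r \<in> std \<alpha>. Z r = X r}. ed ((X h)(\<beta> := Z c \<beta>, \<alpha> := X r \<alpha>))}. ed ((X h)(\<beta> := Z d \<beta>, \<alpha> := X r \<alpha>))} + miss"
      by (rule card_typical[OF \<alpha>\<beta>(1)]) (use cd hB in \<open>auto simp: B_row_def\<close>)
    have 3: "card {r \<in> {r \<in> {r \<in> std \<alpha>. Z r = X r}. ed ((X h)(\<beta> := Z c \<beta>, \<alpha> := X r \<alpha>))}. ed ((X h)(\<beta> := Z d \<beta>, \<alpha> := X r \<alpha>))}
        \<le> card (Ta h) + miss"
      unfolding Ta_def by (rule card_typical[OF \<alpha>\<beta>(1)]) (use cd in \<open>auto simp: B_row_def\<close>)
    show ?thesis
      using 1 2 3 std_lower[OF \<alpha>\<beta>(1)] card_std_unchanged[OF Z(2), of \<alpha>] big(1) finite_sets by (simp add: Ta_def)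
  qed
  obtain e where e: "inj_on e K" "\<forall>j\<in>K. e j \<in> Ta (g j)"
    using distinct_representatives[OF finite_K, of "\<lambda>j. Ta (g j)"] Ta g(2) by blast
  have gS: "g j \<in> std \<beta>" "Z (g j) = X (g j)" "ed ((Z c)(\<beta> := X (g j) \<beta>))" "ed ((Z d)(\<beta> := X (g j) \<beta>))" if "j \<in> K" for j
    using g(2) that by (auto simp: Sb_def)
  have eT: "e j \<in> std \<alpha>" "Z (e j) = X (e j)" "ed ((X (g j))(\<beta> := Z c \<beta>, \<alpha> := X (e j) \<alpha>))"
    "ed ((X (g j))(\<beta> := Z d \<beta>, \<alpha> := X (e j) \<alpha>))" "ed ((Z d)(\<alpha> := X (e j) \<alpha>))" if "j \<in> K" for j
    using e(2) that by (auto simp: Ta_def)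
  have "sum a K \<le> card (edge_rows Z)"
  proof (rule no_aug_bound[OF Z(1) K \<alpha>\<beta>(3) cd(1-3) _ g(1) _ e(1)])
    show "g ` K \<subseteq> edge_rows Z" "e ` K \<subseteq> edge_rows Z"
      using gS(1,2) eT(1,2) by (auto intro: std_row[of _ \<alpha>] std_row[of _ \<beta>])
    have "g i \<noteq> e j" if "i \<in> K" "j \<in> K" for i j
      using gS(1)[OF that(1)] eT(1)[OF that(2)] std_unique[of "g i" \<beta> \<alpha>] \<alpha>\<beta> by metis
    then show "g ` K \<inter> e ` K = {}" by blast
    show "\<not> aug S Z Y" for S Y using no_aug by blast
  qed (use gS eT in auto)
  then show False using Z(3) by simp
qed

text \<open>Two rotations clean the uncontrolled hole \<open>y\<close>. After the one with
  \<open>e\<close> of type \<open>\<alpha>\<close>, only the \<open>\<alpha>\<close>-entry of the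
  new hole can lie outside \<open>B\<close>; after the one with \<open>g\<close> of type
  \<open>\<beta>\<close>, the new hole has taken over just the \<open>\<beta>\<close>-entry of
  \<open>e\<close>, which lies in \<open>B\<close>. Then \<open>all_B_aug\<close> applies. The
  rotations change 4 rows and the augmentation at most 7, hence 11.\<close>

lemma near_step:
  assumes Z: "near D Z" "card (edge_rows Z) < sum a K" and n: "sum a K < n"
    and \<alpha>\<beta>: "\<alpha> \<in> I" "\<beta> \<in> I" "\<alpha> \<noteq> \<beta>"
    and big: "\<And>i. i \<in> {\<alpha>, \<beta>} \<Longrightarrow> l + card K * (slack + (D + 4) + miss) \<le> a i"
      "\<And>i. i \<in> {\<alpha>, \<beta>} \<Longrightarrow> slack + (D + 4) + 3 * miss + card K \<le> a i"
  shows "\<exists>Y. near (D + 11) Y \<and> card (edge_rows Z) < card (edge_rows Y)"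
proof -
  obtain h where Zarr: "arr Z" and Zc: "card (changed Z) \<le> D" and h: "\<forall>r\<in>holes Z. r \<noteq> h \<longrightarrow> B_row (Z r)"
    using Z(1) by (auto simp: near_def)
  have mono: "near D' Y \<Longrightarrow> D' \<le> D + 11 \<Longrightarrow> near (D + 11) Y" for D' Y by (auto simp: near_def)
  have "2 \<le> card (holes Z)" using card_edge_rows_holes[of Z] Z(2) n by linarith
  then obtain c0 d0 where cd0: "c0 \<in> holes Z" "d0 \<in> holes Z" "c0 \<noteq> d0"
    by (metis card_2_iff' card_le_Suc0_iff_eq finite_rows(2) not_less_eq_eq numeral_2_eq_2)
  obtain y c where y: "y \<in> holes Z" "c \<in> holes Z" "y \<noteq> c" "\<And>r. r \<in> holes Z \<Longrightarrow> r \<noteq> y \<Longrightarrow> B_row (Z r)"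
  proof (cases "h \<in> holes Z")
    case True
    show ?thesis
    proof (cases "h = c0")
      case True
      show ?thesis by (rule that[of h d0]) (use \<open>h \<in> holes Z\<close> cd0 h True in auto)
    next
      case False
      show ?thesis by (rule that[of h c0]) (use \<open>h \<in> holes Z\<close> cd0 h False in auto)
    qed
  next
    case False
    then have "\<And>r. r \<in> holes Z \<Longrightarrow> B_row (Z r)" using h by metis
    then show ?thesis using that[of c0 d0] cd0 by blast
  qed
  have cB: "B_row (Z c)" using y by blast
  have lift: "?thesis" if "aug S W Y" "card (changed W) \<le> D + 4" "\<And>r. r \<in> holes W \<Longrightarrow> r \<notin> S \<Longrightarrow> B_row (W r)"
    "card (edge_rows Z) \<le> card (edge_rows W)" for S W Y
    using aug_near[OF that(1-3)] aug_less[OF that(1)] that(4) mono by fastforce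
  show ?thesis
  proof (cases "\<exists>S Y. y \<in> S \<and> aug S Z Y")
    case True
    then obtain S Y where "y \<in> S" "aug S Z Y" by blast
    then show ?thesis using lift[of S Z Y] y(4) Zc by auto
  next
    case no_aug: False
    have "l + card K * (slack + D + miss) \<le> a \<alpha>"
    proof -
      have "card K * (slack + D + miss) \<le> card K * (slack + (D + 4) + miss)" by (intro mult_le_mono2) simp
      moreover have "l + card K * (slack + (D + 4) + miss) \<le> a \<alpha>" by (rule big(1)) simp
      ultimately show ?thesis by linarith
    qed
    then obtain e where e: "e \<in> std \<alpha>" "Z e = X e" "ed ((Z y)(\<alpha> := Z e \<alpha>))"
      using rotate_or_aug[OF Zarr Zc Z(2) y(1-3) cB \<alpha>\<beta>(1)] no_aug by blast
    have eE: "e \<in> edge_rows Z" using std_row e by blast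
    have ne: "e \<noteq> y" "e \<noteq> c" using eE y edge_rows_holes by blast+
    have lt: "y < n" "e < n" "c < n" using y eE rows_less by auto
    define Z1 where "Z1 = sw \<alpha> y e Z"
    have Z1: "arr Z1" "Z1 y = (Z y)(\<alpha> := Z e \<alpha>)" "Z1 e = (Z e)(\<alpha> := Z y \<alpha>)"
      "\<And>r. r \<noteq> y \<Longrightarrow> r \<noteq> e \<Longrightarrow> Z1 r = Z r"
      using Zarr lt ne by (simp_all add: Z1_def arr_sw)
    have c1: "card (changed Z1) \<le> D + 2"
      using card_changed[OF Zc, of "{y, e}" Z1] Z1(4) ne by auto
    have h1: "holes Z1 \<subseteq> insert e (holes Z - {y})"
    proof
      fix r assume "r \<in> holes Z1"
      then show "r \<in> insert e (holes Z - {y})"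
        using Z1(2) Z1(4)[of r] e(3) by (cases "r = y"; cases "r = e") (auto simp: holes_def)
    qed
    have B1: "B_row (Z1 r)" if "r \<in> holes Z1" "r \<noteq> e" for r
    proof -
      have "r \<in> holes Z" "r \<noteq> y" using that h1 by auto
      then show ?thesis using y(4)[of r] Z1(4)[of r] that by simp
    qed
    have sub1: "insert y (edge_rows Z - {e}) \<subseteq> edge_rows Z1"
    proof
      fix r assume "r \<in> insert y (edge_rows Z - {e})"
      then show "r \<in> edge_rows Z1"
        using Z1(2) Z1(4)[of r] e(3) lt by (cases "r = y"; cases "r = e") (auto simp: edge_rows_def)
    qed
    have cy: "card (insert y (edge_rows Z - {e})) = card (edge_rows Z)"
      using y(1) eE edge_rows_holes by (metis Diff_iff card_Suc_Diff1 card_insert_disjoint disjoint_iff finite_Diff finite_rows(1))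
    then have le1: "card (edge_rows Z) \<le> card (edge_rows Z1)" using card_mono[OF finite_rows(1) sub1] by simp
    show ?thesis
    proof (cases "card (edge_rows Z) < card (edge_rows Z1)")
      case True
      then show ?thesis using B1 Z1(1) c1 by (intro exI[of _ Z1]) (auto simp: near_def)
    next
      case False
      then have w1: "card (edge_rows Z1) = card (edge_rows Z)" using le1 by simp
      have "edge_rows Z1 = insert y (edge_rows Z - {e})"
        using card_subset_eq[OF finite_rows(1) sub1] w1 cy by simp
      then have eh: "e \<in> holes Z1" using ne lt edge_or_hole by blast
      have ch: "c \<in> holes Z1" using y Z1(4)[of c] ne by (auto simp: holes_def)
      have cB1: "B_row (Z1 c)" using B1[OF ch] ne by blast
      show ?thesis
      proof (cases "\<exists>S Y. e \<in> S \<and> aug S Z1 Y")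
        case True
        then obtain S Y where "e \<in> S" "aug S Z1 Y" by blast
        then show ?thesis using lift[of S Z1 Y] B1 c1 w1 by auto
      next
        case no_aug1: False
        have "l + card K * (slack + (D + 2) + miss) \<le> a \<beta>"
        proof -
          have "card K * (slack + (D + 2) + miss) \<le> card K * (slack + (D + 4) + miss)" by (intro mult_le_mono2) simp
          moreover have "l + card K * (slack + (D + 4) + miss) \<le> a \<beta>" by (rule big(1)) simp
          ultimately show ?thesis by linarith
        qed
        then obtain g where g: "g \<in> std \<beta>" "Z1 g = X g" "ed ((Z1 e)(\<beta> := Z1 g \<beta>))"
          using rotate_or_aug[OF Z1(1) c1 _ eh ch ne(2) cB1 \<alpha>\<beta>(2)] no_aug1 Z(2) w1 by auto
        have gE: "g \<in> edge_rows Z1" using std_row g by blast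
        have ne2: "g \<noteq> e" "g \<noteq> c" using gE eh ch edge_rows_holes by blast+
        have ltg: "g < n" using gE rows_less by auto
        define Z2 where "Z2 = sw \<beta> e g Z1"
        have Z2: "arr Z2" "Z2 e = (Z1 e)(\<beta> := Z1 g \<beta>)" "Z2 g = (Z1 g)(\<beta> := Z1 e \<beta>)"
          "\<And>r. r \<noteq> e \<Longrightarrow> r \<noteq> g \<Longrightarrow> Z2 r = Z1 r"
          using Z1(1) lt ltg ne2 by (simp_all add: Z2_def arr_sw)
        have c2: "card (changed Z2) \<le> D + 4"
          using card_changed[OF c1, of "{e, g}" Z2] Z2(4) ne2 by auto
        have h2: "holes Z2 \<subseteq> insert g (holes Z1 - {e})"
        proof
          fix r assume "r \<in> holes Z2"
          then show "r \<in> insert g (holes Z1 - {e})"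
            using Z2(2) Z2(4)[of r] g(3) by (cases "r = e"; cases "r = g") (auto simp: holes_def)
        qed
        have "B_row (Z2 g)"
        proof -
          have "X g p \<in> B p" if "p \<in> K" "p \<noteq> \<beta>" for p
            using g(1) that \<alpha>\<beta>(2) unfolding B_def by blast
          moreover have "X e \<beta> \<in> B \<beta>" using e(1) \<alpha>\<beta> unfolding B_def by blast
          ultimately show ?thesis using Z2(3) Z1(3) g(2) e(2) \<alpha>\<beta>(3) by (auto simp: B_row_def)
        qed
        then have B2: "B_row (Z2 r)" if "r \<in> holes Z2" for r
          using that h2 B1 Z2(4) by (cases "r = g") force+
        have sub2: "insert e (edge_rows Z1 - {g}) \<subseteq> edge_rows Z2"
        proof
          fix r assume "r \<in> insert e (edge_rows Z1 - {g})"
          then show "r \<in> edge_rows Z2"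
            using Z2(2) Z2(4)[of r] g(3) lt by (cases "r = e"; cases "r = g") (auto simp: edge_rows_def)
        qed
        have ce: "card (insert e (edge_rows Z1 - {g})) = card (edge_rows Z1)"
          using eh gE edge_rows_holes by (metis Diff_iff card_Suc_Diff1 card_insert_disjoint disjoint_iff finite_Diff finite_rows(1))
        then have le2: "card (edge_rows Z1) \<le> card (edge_rows Z2)" using card_mono[OF finite_rows(1) sub2] by simp
        show ?thesis
        proof (cases "card (edge_rows Z) < card (edge_rows Z2)")
          case True
          then show ?thesis using B2 Z2(1) c2 by (intro exI[of _ Z2]) (auto simp: near_def)
        next
          case False
          then have w2: "card (edge_rows Z2) = card (edge_rows Z1)" using le2 w1 by simp
          have "edge_rows Z2 = insert e (edge_rows Z1 - {g})"
            using card_subset_eq[OF finite_rows(1) sub2] w2 ce by simp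
          then have gh: "g \<in> holes Z2" using ne2 ltg edge_or_hole by blast
          have ch2: "c \<in> holes Z2" using ch Z2(4)[of c] ne ne2 by (auto simp: holes_def)
          have "\<exists>S Y. aug S Z2 Y"
            by (rule all_B_aug[OF Z2(1) c2 _ ch2 gh ne2(2)[symmetric] B2[OF ch2] B2[OF gh] \<alpha>\<beta>])
              (use Z(2) w1 w2 big(2) in auto)
          then obtain S Y where "aug S Z2 Y" by blast
          then show ?thesis using lift[of S Z2 Y] B2 c2 w1 w2 by auto
        qed
      qed
    qed
  qed
qed

lemma stuck_deficit: "sum a K \<le> card (edge_rows X) + (card K * slack + l)"
proof -
  have "sum a I \<le> (\<Sum>i\<in>I. card (std i) + slack)" using std_lower by (intro sum_mono) auto
  also have "\<dots> = (\<Sum>i\<in>I. card (std i)) + card I * slack" unfolding sum.distrib by simp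
  also have "card I * slack \<le> card K * slack" using card_mono[OF finite_K I] by (rule mult_le_mono1)
  finally show ?thesis using sum_std sum_K_le by linarith
qed

text \<open>\<open>stuck_deficit\<close> bounds the number of steps and so the number of changed
  rows; the extra 4 is for the rotations inside the last step. The result need not keep the rows of
  \<open>F\<close>, so it does not contradict the maximality of \<open>X\<close>.\<close>

lemma stuck_completion:
  assumes n: "sum a K < n" and \<alpha>\<beta>: "\<alpha> \<in> I" "\<beta> \<in> I" "\<alpha> \<noteq> \<beta>"
    and D: "D = 11 * (card K * slack + l) + 4"
    and big: "\<And>i. i \<in> {\<alpha>, \<beta>} \<Longrightarrow> l + card K * (slack + D + miss) \<le> a i"
      "\<And>i. i \<in> {\<alpha>, \<beta>} \<Longrightarrow> slack + D + 3 * miss + card K \<le> a i"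
  shows "\<exists>Y. arr Y \<and> sum a K \<le> card (edge_rows Y)"
proof -
  define J where "J = sum a K - card (edge_rows X)"
  have J: "J \<le> card K * slack + l" using stuck_deficit by (simp add: J_def)
  have "\<exists>Y. near (11 * j) Y \<and> card (edge_rows X) + j \<le> card (edge_rows Y)" if "j \<le> J" for j
    using that
  proof (induction j)
    case 0
    have "B_row (X r)" if "r \<in> holes X" for r using that by (auto simp: B_row_def B_def)
    then have "near 0 X" using arrX by (auto simp: near_def changed_def)
    then show ?case by auto
  next
    case (Suc j)
    then obtain Y where Y: "near (11 * j) Y" "card (edge_rows X) + j \<le> card (edge_rows Y)" by auto
    show ?case
    proof (cases "card (edge_rows X) + Suc j \<le> card (edge_rows Y)")
      case True
      then show ?thesis using Y(1) by (intro exI[of _ Y]) (auto simp: near_def)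
    next
      case False
      then have lt: "card (edge_rows Y) < sum a K" using Suc.prems by (simp add: J_def)
      have jD: "11 * j + 4 \<le> D" using Suc.prems J D by simp
      have "l + card K * (slack + (11 * j + 4) + miss) \<le> a i" if "i \<in> {\<alpha>, \<beta>}" for i
        using big(1)[OF that] mult_le_mono2[of "slack + (11 * j + 4) + miss" "slack + D + miss" "card K"] jD by linarith
      moreover have "slack + (11 * j + 4) + 3 * miss + card K \<le> a i" if "i \<in> {\<alpha>, \<beta>}" for i
        using big(2)[OF that] jD by linarith
      ultimately obtain Y' where "near (11 * j + 11) Y'" "card (edge_rows Y) < card (edge_rows Y')"
        using near_step[OF Y(1) lt n \<alpha>\<beta>] by blast
      then show ?thesis using Y(2) by (intro exI[of _ Y']) (auto simp: algebra_simps)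
    qed
  qed
  from this[of J] obtain Y where "near (11 * J) Y" "card (edge_rows X) + J \<le> card (edge_rows Y)" by auto
  then show ?thesis using less by (intro exI[of _ Y]) (auto simp: near_def J_def)
qed

end

section \<open>The number of large codegrees\<close>

text \<open>For \<open>l = 3 * k * h\<close> the numbers \<open>s\<close>, \<open>d\<close>,
  \<open>m\<close> bound \<open>slack\<close>, the changed rows and \<open>miss\<close> in units of
  \<open>h\<close>. The sum covers the two requirements of \<open>stuck_completion\<close>, then
  \<open>2 * k * (4 * k + 6)\<close> for one large codegree, and \<open>20 * k + 8\<close> for none
  or two.\<close>

definition gap :: "nat \<Rightarrow> nat" where
  "gap k = (let s = (2 * k + 1) * (3 * k); d = 11 * (k * s + 3 * k) + 4; m = 3 * k + (k + 1) * s + k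
    in 3 * k + k * (s + d + m) + (s + d + 3 * m + k) + 2 * k * (4 * k + 6) + 20 * k + 8)"

text \<open>The ranges from \<open>n div C ^ t\<close> up to \<open>C * (n div C ^ t)\<close> are
  disjoint for different \<open>t\<close>, so \<open>card K\<close> values cannot meet all
  \<open>card K + 1\<close> of them.\<close>

lemma scale_gap:
  fixes a :: "'i \<Rightarrow> nat"
  assumes "finite K" "0 < C"
  shows "\<exists>t. 1 \<le> t \<and> t \<le> card K + 1 \<and> (\<forall>i\<in>K. a i < n div C ^ t \<or> C * (n div C ^ t) \<le> a i)"
proof (rule ccontr)
  assume "\<not> ?thesis"
  then have "\<forall>t\<in>{1..card K + 1}. \<exists>i\<in>K. n div C ^ t \<le> a i \<and> a i < C * (n div C ^ t)"
    by (meson atLeastAtMost_iff not_le)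
  then obtain f where f: "\<And>t. t \<in> {1..card K + 1} \<Longrightarrow> f t \<in> K \<and> n div C ^ t \<le> a (f t) \<and> a (f t) < C * (n div C ^ t)"
    by metis
  have step: "C * (n div C ^ t) \<le> n div C ^ s" if "s < t" for s t
  proof -
    have "C * (n div C ^ t) = C * (n div C ^ (t - 1) div C)"
      using that by (simp add: div_mult2_eq[symmetric] power_Suc2[symmetric])
    also have "\<dots> \<le> n div C ^ (t - 1)" by simp
    also have "\<dots> \<le> n div C ^ s" using that assms(2) by (intro div_le_mono2 power_increasing) auto
    finally show ?thesis .
  qed
  have ne: "f s \<noteq> f t" if "s < t" "s \<in> {1..card K + 1}" "t \<in> {1..card K + 1}" for s t
    using f[OF that(2)] f[OF that(3)] step[OF that(1)] by auto
  have "inj_on f {1..card K + 1}"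
  proof (rule inj_onI)
    fix s t assume "s \<in> {1..card K + 1}" "t \<in> {1..card K + 1}" "f s = f t"
    then show "s = t" using ne[of s t] ne[of t s] by (cases s t rule: linorder_cases) auto
  qed
  moreover have "f ` {1..card K + 1} \<subseteq> K" using f by blast
  ultimately have "card {1..card K + 1} \<le> card K" using assms(1) card_inj_on_le by blast
  then show False by simp
qed

context kpartite_system
begin

text \<open>From \<open>card K - 1\<close> hole rows one can assemble a row for each column so that
  no two compete for an entry, and \<open>conflict_general\<close> makes their repairs disjoint.
  Thus a maximal array that misses the sum has fewer holes than that.\<close>

lemma few_holes:
  assumes X: "maximal {} X" and K3: "3 \<le> card K" and many: "card K \<le> card (holes X) + 1"
  shows "sum a K \<le> card (edge_rows X)"
proof -
  define k where "k = card K"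
  obtain idx where "bij_betw idx K {..<k}"
    using ex_bij_betw_finite_nat[OF finite_K] unfolding k_def by (metis atLeast0LessThan)
  then have idx: "idx p < k" "idx p = idx q \<Longrightarrow> p = q" if "p \<in> K" "q \<in> K" for p q
    using that by (auto simp: bij_betw_def inj_on_def)
  have enough: "k - 1 \<le> card (holes X)" using many by (simp add: k_def)
  obtain S where S: "S \<subseteq> holes X" "card S = k - 1" "finite S"
    using obtain_subset_with_card_n[OF enough] by blast
  then obtain h where h: "bij_betw h {..<k - 1} S"
    using ex_bij_betw_nat_finite by (metis atLeast0LessThan)
  have h_hole: "h m \<in> holes X" if "m < k - 1" for m
    using bij_betw_apply[OF h] that S(1) by auto
  have h_inj: "m = m'" if "h m = h m'" "m < k - 1" "m' < k - 1" for m m'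
    using h that by (auto simp: bij_betw_def inj_on_def)
  \<comment> \<open>A cyclic shift, so that at each column different \<open>i\<close> use different hole rows.\<close>
  define \<mu> where "\<mu> i p = (if idx i < idx p then idx p - idx i - 1 else idx p + k - idx i - 1)" for i p
  have \<mu>: "\<mu> i p < k - 1" if "i \<in> K" "p \<in> K" "i \<noteq> p" for i p
  proof -
    have "idx i < k" "idx i \<noteq> idx p" using idx[OF that(1,2)] that(3) by auto
    then show ?thesis unfolding \<mu>_def by (cases "idx i < idx p") (use idx(1)[OF that(2,1)] in auto)
  qed
  have \<mu>_inj: "\<mu> i p \<noteq> \<mu> j p" if "i \<in> K" "j \<in> K" "p \<in> K" "i \<noteq> j" "i \<noteq> p" "j \<noteq> p" for i j p
  proof -
    have "idx i < k" "idx j < k" "idx p < k" "idx i \<noteq> idx j" "idx i \<noteq> idx p" "idx j \<noteq> idx p"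
      using idx[OF that(1,2)] idx[OF that(2,3)] idx[OF that(1,3)] idx(1)[OF that(3,1)] that(4-6) by blast+
    then show ?thesis unfolding \<mu>_def by (cases "idx i < idx p"; cases "idx j < idx p") auto
  qed
  have cd: "h 0 \<in> holes X" "h 1 \<in> holes X" "h 0 \<noteq> h 1"
  proof -
    have "0 < k - 1" "1 < k - 1" using K3 by (simp_all add: k_def)
    then show "h 0 \<in> holes X" "h 1 \<in> holes X" "h 0 \<noteq> h 1"
      using h_hole[of 0] h_hole[of 1] h_inj[of 0 1] by auto
  qed
  define H where "H i = {r. r < n \<and> ed ((\<lambda>p. X (h (\<mu> i p)) p)(i := X r i))}" for i
  have HE: "H i \<subseteq> edge_rows X" if i: "i \<in> K" for i
  proof
    fix r assume r: "r \<in> H i"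
    have "r \<notin> holes X"
      using hole_general[OF X i, of "\<lambda>p. h (\<mu> i p)" r] r \<mu> h_hole i by (force simp: H_def)
    then show "r \<in> edge_rows X" using r edge_or_hole by (auto simp: H_def)
  qed
  have "H i \<inter> H j = {}" if ij: "i \<in> K" "j \<in> K" "i \<noteq> j" for i j
  proof (rule ccontr)
    assume "H i \<inter> H j \<noteq> {}"
    then obtain e where e: "e \<in> H i" "e \<in> H j" by blast
    show False
    proof (rule conflict_general[OF X ij cd, of "\<lambda>p. h (\<mu> i p)" "\<lambda>p. h (\<mu> j p)" e])
      fix p assume "p \<in> K - {i, j}"
      then show "h (\<mu> i p) \<noteq> h (\<mu> j p)"
        using \<mu>_inj[of i j p] h_inj \<mu>[of i p] \<mu>[of j p] ij by blast
    qed (use e HE ij \<mu> h_hole in \<open>auto simp: H_def\<close>)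
  qed
  then have "(\<Sum>i\<in>K. card (H i)) = card (\<Union>i\<in>K. H i)"
    using finite_K by (intro card_UN_disjoint[symmetric]) (auto simp: H_def)
  also have "\<dots> \<le> card (edge_rows X)" using HE by (intro card_mono) auto
  finally have "(\<Sum>i\<in>K. card (H i)) \<le> card (edge_rows X)" .
  moreover have "sum a K \<le> (\<Sum>i\<in>K. card (H i))"
  proof (rule sum_mono)
    fix i assume i: "i \<in> K"
    have arrX: "arr X" using X by (simp add: maximal_def)
    show "a i \<le> card (H i)" unfolding H_def
      by (rule card_hits[OF arrX i]) (use arr_mem[OF arrX] h_hole \<mu> i rows_less(2) in blast)
  qed
  ultimately show ?thesis by linarith
qed

text \<open>Up to \<open>2 * card K + 1\<close> holes are dealt with by the absorbers; with more
  holes there are \<open>2 * card K\<close> rows for \<open>Rs\<close>.\<close>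

lemma three_large_codegrees:
  assumes K3: "3 \<le> card K" and n: "sum a K < n"
    and \<alpha>\<beta>\<gamma>: "\<alpha> \<in> I" "\<beta> \<in> I" "\<gamma> \<in> I" "\<alpha> \<noteq> \<beta>" "\<alpha> \<noteq> \<gamma>" "\<beta> \<noteq> \<gamma>" and I: "I \<subseteq> K"
    and large: "\<And>i. i \<in> I \<Longrightarrow> gap (card K) * h \<le> a i" and rest: "sum a (K - I) \<le> card K * h" and h: "0 < h"
    and N: "n \<le> N * h" and t: "2 * N ^ 5 * (card K + 4 * card K * t) \<le> n" "t \<le> h"
    and small: "real (n ^ (2 * card K)) * (1 - 1 / (4 * real N ^ 5)) ^ t < (1 / 2) ^ (2 * card K)"
  shows "\<exists>X. arr X \<and> sum a K \<le> card (edge_rows X)"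
proof -
  define k where "k = card K"
  have K: "\<alpha> \<in> K" "\<beta> \<in> K" "\<gamma> \<in> K" using \<alpha>\<beta>\<gamma> I by auto
  have "h \<le> a i" if "i \<in> I" for i
  proof -
    have "1 * h \<le> gap (card K) * h" by (intro mult_le_mono1) (simp add: gap_def Let_def)
    then show ?thesis using large[OF that] by linarith
  qed
  note q = this[OF \<alpha>\<beta>\<gamma>(1)] this[OF \<alpha>\<beta>\<gamma>(2)] this[OF \<alpha>\<beta>\<gamma>(3)]
  have "0 < n" using n by simp
  from absorber_arrangement[OF K \<alpha>\<beta>\<gamma>(4-6) q N this t(1) small]
  obtain X0 where X0: "arr X0" "{..<2 * t} \<subseteq> edge_rows X0"
    "\<And>c d. \<forall>p\<in>K. c p \<in> V p \<and> d p \<in> V p \<Longrightarrow>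
      2 * card K < card {i. i < t \<and> absorbs \<alpha> \<beta> c d (X0 (2 * i)) (X0 (2 * i + 1))}" by blast
  obtain X where X: "maximal {..<2 * t} X" "\<And>r. r < 2 * t \<Longrightarrow> X r = X0 r"
    using maximal_exists[OF X0(1,2)] by auto
  have arrX: "arr X" and FX: "{..<2 * t} \<subseteq> edge_rows X" using X(1) by (auto simp: maximal_def)
  show ?thesis
  proof (cases "sum a K \<le> card (edge_rows X)")
    case True
    then show ?thesis using arrX by blast
  next
    case less: False
    show ?thesis
    proof (cases "n \<le> card (edge_rows X) + 2 * card K + 1")
      case True
      have "\<exists>Y. arr Y \<and> n - 1 \<le> card (edge_rows Y)"
      proof (rule absorb_holes[OF arrX FX K(1,2) \<alpha>\<beta>\<gamma>(4) _ True])
        fix c d assume cd: "\<forall>p\<in>K. c p \<in> V p \<and> d p \<in> V p"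
        have "X (2 * i) = X0 (2 * i)" "X (2 * i + 1) = X0 (2 * i + 1)" if "i < t" for i
          using X(2) that by auto
        then have "{i. i < t \<and> absorbs \<alpha> \<beta> c d (X (2 * i)) (X (2 * i + 1))} =
            {i. i < t \<and> absorbs \<alpha> \<beta> c d (X0 (2 * i)) (X0 (2 * i + 1))}" by auto
        then show "2 * card K < card {i. i < t \<and> absorbs \<alpha> \<beta> c d (X (2 * i)) (X (2 * i + 1))}"
          using X0(3)[OF cd] by simp
      qed
      then obtain Y where "arr Y" "n - 1 \<le> card (edge_rows Y)" by blast
      then show ?thesis using n by (intro exI[of _ Y]) auto
    next
      case False
      then have "2 * card K \<le> card (holes X)" using card_edge_rows_holes[of X] by linarith
      then obtain Rs where Rs: "Rs \<subseteq> holes X" "card Rs = 2 * card K"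
        using obtain_subset_with_card_n by metis
      \<comment> \<open>\<open>k * h\<close> for the small indices and \<open>2 * k * h\<close> for
        the \<open>2 * t\<close> absorber rows.\<close>
      define l where "l = 3 * k * h"
      have "sum a (K - I) + card K * card {..<2 * t} \<le> k * h + k * (2 * h)"
        using rest t(2) unfolding k_def by (intro add_mono mult_le_mono2) auto
      then have l: "sum a (K - I) + card K * card {..<2 * t} \<le> l" unfolding l_def by (simp add: algebra_simps)
      interpret S: stuck_arrangement K n V ed a X "{..<2 * t}" Rs I l
        by unfold_locales (use X(1) Rs K3 I l less in auto)
      define s where "s = (2 * k + 1) * (3 * k)"
      define d where "d = 11 * (k * s + 3 * k) + 4"
      define m where "m = 3 * k + (k + 1) * s + k"
      define D where "D = 11 * (card K * S.slack + l) + 4"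
      have "S.slack = s * h" unfolding S.slack_def by (simp add: l_def s_def k_def algebra_simps)
      moreover have D: "D \<le> d * h"
      proof -
        have "D = 11 * (k * s + 3 * k) * h + 4"
          unfolding D_def \<open>S.slack = s * h\<close> by (simp add: l_def k_def[symmetric] algebra_simps)
        also have "\<dots> \<le> d * h" using h unfolding d_def by (simp add: add_mult_distrib)
        finally show ?thesis .
      qed
      moreover have m: "S.miss \<le> m * h"
      proof -
        have "S.miss = (3 * k + (k + 1) * s) * h + k"
          unfolding S.miss_def \<open>S.slack = s * h\<close> by (simp add: l_def k_def[symmetric] algebra_simps)
        also have "\<dots> \<le> m * h" using h unfolding m_def by (simp add: add_mult_distrib)
        finally show ?thesis .
      qed
      have gap: "gap (card K) = 3 * k + k * (s + d + m) + (s + d + 3 * m + k) + 2 * k * (4 * k + 6) + 20 * k + 8"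
        by (simp add: gap_def Let_def s_def d_def m_def k_def)
      have b1: "l + card K * (S.slack + D + S.miss) \<le> a i" if "i \<in> {\<alpha>, \<beta>}" for i
      proof -
        have "l + k * (S.slack + D + S.miss) \<le> 3 * k * h + k * (s * h + d * h + m * h)"
          using D m \<open>S.slack = s * h\<close> unfolding l_def by (intro add_mono mult_le_mono2) auto
        also have "\<dots> = (3 * k + k * (s + d + m)) * h" by (simp add: algebra_simps)
        also have "\<dots> \<le> gap (card K) * h" unfolding gap by (intro mult_le_mono1) simp
        also have "\<dots> \<le> a i" using large that \<alpha>\<beta>\<gamma> by auto
        finally show ?thesis by (simp add: k_def)
      qed
      have b2: "S.slack + D + 3 * S.miss + card K \<le> a i" if "i \<in> {\<alpha>, \<beta>}" for i
      proof -
        have "k \<le> k * h" using h by simp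
        then have "S.slack + D + 3 * S.miss + k \<le> s * h + d * h + 3 * (m * h) + k * h"
          using D m \<open>S.slack = s * h\<close> by linarith
        also have "\<dots> = (s + d + 3 * m + k) * h" by (simp add: algebra_simps)
        also have "\<dots> \<le> gap (card K) * h" unfolding gap by (intro mult_le_mono1) simp
        also have "\<dots> \<le> a i" using large that \<alpha>\<beta>\<gamma> by auto
        finally show ?thesis by (simp add: k_def)
      qed
      show ?thesis by (rule S.stuck_completion[OF n \<alpha>\<beta>\<gamma>(1,2,4) D_def b1 b2])
    qed
  qed
qed

text \<open>\<open>C\<close> is the required ratio between large and small codegrees.
  \<open>N\<close> gives \<open>n \<le> N * h\<close>, the factor 2 making up for rounding in
  \<open>h\<close>; \<open>T\<close> is such that \<open>n div T\<close> absorbers satisfy the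
  density condition and do not exceed \<open>h\<close>.\<close>

lemma arrangement_bound:
  assumes K3: "3 \<le> card K" and n: "sum a K < n"
    and C: "C = gap (card K)" and N: "N = 2 * C ^ (card K + 1)" and T: "T = 16 * N ^ 5 * card K"
    and large: "C ^ (card K + 1) \<le> n" "4 * N ^ 5 * card K \<le> n"
      "2 * ((4 * card K + 6) * card K + 2 * card K) < n"
    and small: "real (n ^ (2 * card K)) * (1 - 1 / (4 * real N ^ 5)) ^ (n div T) < (1 / 2) ^ (2 * card K)"
  shows "\<exists>X. arr X \<and> sum a K \<le> card (edge_rows X)"
proof (rule ccontr)
  assume neg: "\<not> ?thesis"
  define k where "k = card K"
  have C0: "0 < C" "8 + 20 * k + 2 * k * (4 * k + 6) \<le> C" by (auto simp: C gap_def Let_def k_def)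
  obtain X0 where "arr X0" using arr_exists by blast
  then obtain X where X: "maximal {} X" using maximal_exists[of X0 "{}"] by auto
  have less: "card (edge_rows X) < sum a K" using neg X unfolding maximal_def by force
  then have "\<not> k \<le> card (holes X) + 1" using few_holes[OF X K3] by (auto simp: k_def)
  \<comment> \<open>The codegrees add up to nearly \<open>n\<close>. This excludes that none of them
    is large and forces a single large one to be close to \<open>n\<close>.\<close>
  then have nk: "n \<le> sum a K + k" using card_edge_rows_holes[of X] less by linarith
  have "2 \<le> card (holes X)" using card_edge_rows_holes[of X] less n by linarith
  then obtain c d where cd: "c \<in> holes X" "d \<in> holes X" "c \<noteq> d"
    by (metis card_2_iff' card_le_Suc0_iff_eq finite_rows(2) not_less_eq_eq numeral_2_eq_2)
  obtain t where t: "1 \<le> t" "t \<le> k + 1" "\<forall>i\<in>K. a i < n div C ^ t \<or> C * (n div C ^ t) \<le> a i"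
    using scale_gap[OF finite_K C0(1)] unfolding k_def by metis
  define h where "h = n div C ^ t"
  have "n div C ^ (k + 1) \<le> h" unfolding h_def using t C0 by (intro div_le_mono2 power_increasing) auto
  moreover have "1 \<le> n div C ^ (k + 1)" using large(1) C0(1) by (simp add: k_def div_greater_zero_iff Suc_le_eq)
  ultimately have h: "0 < h" by linarith
  have Ch: "C * h \<le> n"
  proof -
    have "C ^ 1 * h \<le> C ^ t * h" using t C0 by (intro mult_le_mono1 power_increasing) auto
    also have "\<dots> \<le> n" by (simp add: h_def)
    finally show ?thesis by simp
  qed
  have Nh: "n \<le> N * h"
  proof -
    have "n < C ^ t * (h + 1)"
      unfolding h_def using C0(1) dividend_less_times_div[of "C ^ t" n] by simp
    also have "\<dots> \<le> C ^ (k + 1) * (2 * h)"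
      using t h C0 by (intro mult_le_mono power_increasing) auto
    finally show ?thesis by (simp add: N k_def)
  qed
  define I where "I = {i \<in> K. C * h \<le> a i}"
  have I: "I \<subseteq> K" "finite I" using finite_K by (auto simp: I_def)
  have "sum a (K - I) \<le> of_nat (card (K - I)) * h"
    using t(3) by (intro sum_bounded_above) (auto simp: I_def h_def)
  also have "\<dots> \<le> k * h" using finite_K by (auto simp: k_def intro!: card_mono)
  finally have rest: "sum a (K - I) \<le> k * h" by simp
  have split: "sum a K = sum a (K - I) + sum a I" using sum.subset_diff[OF I(1) finite_K] by simp
  have Cmul: "x * h \<le> n" if "x \<le> C" for x using mult_le_mono1[OF that, of h] Ch by linarith
  have c20: "2 * (k * h) \<le> n" "(2 * k * (4 * k + 6)) * h \<le> n"
    using Cmul[of "2 * k"] Cmul[of "2 * k * (4 * k + 6)"] C0(2) by simp_all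
  consider "I = {}" | \<alpha> where "I = {\<alpha>}" | \<alpha> \<beta> where "I = {\<alpha>, \<beta>}" "\<alpha> \<noteq> \<beta>"
    | \<alpha> \<beta> \<gamma> where "\<alpha> \<in> I" "\<beta> \<in> I" "\<gamma> \<in> I" "\<alpha> \<noteq> \<beta>" "\<alpha> \<noteq> \<gamma>" "\<beta> \<noteq> \<gamma>"
    by (cases "I = {}"; blast)
  then show False
  proof cases
    case 1
    then have "n \<le> k * h + k" using split rest nk by simp
    moreover have "2 * k < n" using large(3) by (simp add: k_def)
    ultimately show False using c20(1) by linarith
  next
    case (2 \<alpha>)
    have \<alpha>: "\<alpha> \<in> K" using 2 I by blast
    have L: "n \<le> a \<alpha> + (k * h + k)" using split rest nk 2 by simp
    have "(4 * k + 6) * (k * h + k) + 2 * k < n"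
    proof -
      have "2 * ((4 * k + 6) * (k * h + k) + 2 * k) = (2 * k * (4 * k + 6)) * h + 2 * ((4 * k + 6) * k + 2 * k)"
        by (simp add: algebra_simps)
      also have "\<dots> < n + n" using c20(2) large(3) unfolding k_def by linarith
      finally show ?thesis by (simp only: mult_2[symmetric] nat_mult_less_cancel_disj)
    qed
    then show False using one_large_codegree[OF \<alpha> n nk[unfolded k_def] L] neg by (simp add: k_def)
  next
    case (3 \<alpha> \<beta>)
    have K: "\<alpha> \<in> K" "\<beta> \<in> K" using 3 I by auto
    have lt: "card (edge_rows X) < a \<alpha> + a \<beta> + k * h" using less split rest 3 by simp
    have "card K + 8 * (k * h) + 8 \<le> C * h"
    proof -
      have "k + 8 * (k * h) + 8 \<le> (k + 8 * k + 8) * h" using h by (cases h) (auto simp: algebra_simps)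
      also have "\<dots> \<le> C * h" using C0(2) by (intro mult_le_mono1) linarith
      finally show ?thesis by (simp add: k_def)
    qed
    moreover have "C * h \<le> a \<alpha>" "C * h \<le> a \<beta>" using 3 by (auto simp: I_def)
    ultimately have "sum a K \<le> card (edge_rows X)"
      by (intro two_large_codegrees[OF X cd K 3(2) lt]) linarith+
    then show False using less by simp
  next
    case (4 \<alpha> \<beta> \<gamma>)
    have N0: "0 < N" using C0 by (simp add: N)
    have k0: "0 < k" using K3 by (simp add: k_def)
    define u where "u = n div T"
    have Tu: "T * u \<le> n" by (simp add: u_def)
    have "2 * N ^ 5 * (k + 4 * k * u) \<le> n"
    proof -
      have "2 * (2 * N ^ 5 * (k + 4 * k * u)) = 4 * N ^ 5 * k + T * u"
        by (simp add: T k_def algebra_simps)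
      also have "\<dots> \<le> n + n" using large(2) Tu unfolding k_def by linarith
      finally show ?thesis by linarith
    qed
    moreover have "u \<le> h"
    proof -
      have "N * 1 \<le> N * (16 * N ^ 4 * k)" using N0 k0 by (intro mult_le_mono2) simp
      also have "\<dots> = T"
        using power_Suc[of N 4] by (simp add: T k_def)
      finally have "N * 1 \<le> T" .
      then have "N * u \<le> T * u" by simp
      then have "N * u \<le> N * h" using Tu Nh by linarith
      then show ?thesis using N0 by simp
    qed
    ultimately have "\<exists>X. arr X \<and> sum a K \<le> card (edge_rows X)"
      using three_large_codegrees[OF K3 n 4 I(1) _ _ h Nh] rest small C by (simp add: I_def k_def u_def)
    then show False using neg by blast
  qed
qed

end

section \<open>Hypergraphs as systems of transversals\<close>

lemma exists_dominated_sum: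
  fixes a :: "'i \<Rightarrow> nat"
  assumes "finite K" "m \<le> sum a K"
  shows "\<exists>b. (\<forall>i\<in>K. b i \<le> a i) \<and> sum b K = m"
  using assms
proof (induction K arbitrary: m rule: finite_induct)
  case empty
  then show ?case by auto
next
  case (insert i K)
  have "m - min m (a i) \<le> sum a K" using insert by auto
  then obtain b where b: "\<forall>j\<in>K. b j \<le> a j" "sum b K = m - min m (a i)" using insert.IH by blast
  have "sum (b(i := min m (a i))) K = sum b K" using insert.hyps by (intro sum.cong) auto
  then show ?case
    using b insert.hyps by (intro exI[of _ "b(i := min m (a i))"]) auto
qed

section \<open>Codegrees and matchings in terms of transversals\<close>

lemma inj_on_transversal:
  assumes "disjoint_family_on V K" "\<And>p. p \<in> L \<Longrightarrow> x p \<in> V p" "L \<subseteq> K"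
  shows "inj_on x L"
proof (rule inj_onI)
  fix p q assume "p \<in> L" "q \<in> L" "x p = x q"
  then have "x p \<in> V p \<inter> V q" using assms(2) by fastforce
  then show "p = q" using assms(1,3) \<open>p \<in> L\<close> \<open>q \<in> L\<close> unfolding disjoint_family_on_def by blast
qed

lemma transversal_inter_class:
  assumes "disjoint_family_on V K" "\<And>p. p \<in> L \<Longrightarrow> x p \<in> V p" "L \<subseteq> K" "i \<in> K"
  shows "x ` L \<inter> V i = (if i \<in> L then {x i} else {})"
proof -
  have "p = i" if "p \<in> L" "x p \<in> V i" for p
    using assms that unfolding disjoint_family_on_def by blast
  then show ?thesis using assms(2) by auto
qed

text \<open>An edge containing \<open>S\<close> has \<open>k\<close> vertices and exactly one in
  \<open>V i\<close>, which is not in \<open>S\<close>, so it is \<open>S\<close> together with that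
  vertex.\<close>

lemma deg_transversal:
  fixes H :: "'v hypergraph" and V :: "nat \<Rightarrow> 'v set"
  assumes uni: "uniform_hypergraph k H" and par: "partite k H V"
    and i: "i \<in> {1..k}" and x: "\<And>p. p \<in> {1..k} - {i} \<Longrightarrow> x p \<in> V p"
  shows "deg H (x ` ({1..k} - {i})) = card {v \<in> V i. (x(i := v)) ` {1..k} \<in> edges H}"
proof -
  define S where "S = x ` ({1..k} - {i})"
  have dis: "disjoint_family_on V {1..k}" using par by (simp add: partite_def)
  have cS: "card S = k - 1"
    using inj_on_transversal[OF dis x, of "{1..k} - {i}"] i by (simp add: S_def card_image)
  have SV: "S \<inter> V i = {}" using transversal_inter_class[OF dis x _ i, of "{1..k} - {i}"] by (simp add: S_def)
  have img: "(x(i := v)) ` {1..k} = insert v S" for v using i by (auto simp: S_def image_iff)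
  have "{e \<in> edges H. S \<subseteq> e} = (\<lambda>v. insert v S) ` {v \<in> V i. insert v S \<in> edges H}"
  proof (intro equalityI subsetI)
    fix e assume e: "e \<in> {e \<in> edges H. S \<subseteq> e}"
    then have "card (e \<inter> V i) = 1" using par i by (auto simp: partite_def)
    then obtain v where v: "e \<inter> V i = {v}" by (auto simp: card_1_singleton_iff)
    have fe: "finite e" "card e = k"
      using e uni unfolding uniform_hypergraph_def by (auto intro: finite_subset)
    have "v \<notin> S" using v SV by auto
    have "finite S" by (simp add: S_def)
    then have "card (insert v S) = k" using cS i \<open>v \<notin> S\<close> by simp
    moreover have "insert v S \<subseteq> e" using v e by auto
    ultimately have "insert v S = e" using fe card_subset_eq by metis
    then show "e \<in> (\<lambda>v. insert v S) ` {v \<in> V i. insert v S \<in> edges H}" using v e by auto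
  qed auto
  moreover have "inj_on (\<lambda>v. insert v S) {v \<in> V i. insert v S \<in> edges H}"
    using SV by (intro inj_onI) blast
  ultimately show ?thesis unfolding deg_def S_def[symmetric] img by (simp add: card_image)
qed

text \<open>The transversal \<open>x\<close> supplies a member of the set under \<open>Min\<close>,
  so the minimum is over a nonempty set.\<close>

lemma min_codegree_le:
  fixes H :: "'v hypergraph" and V :: "nat \<Rightarrow> 'v set"
  assumes uni: "uniform_hypergraph k H" and par: "partite k H V"
    and i: "i \<in> {1..k}" and x: "\<And>p. p \<in> {1..k} - {i} \<Longrightarrow> x p \<in> V p"
  shows "min_codegree k H V i \<le> card {v \<in> V i. (x(i := v)) ` {1..k} \<in> edges H}"
proof -
  define S where "S = x ` ({1..k} - {i})"
  have dis: "disjoint_family_on V {1..k}" and ver: "verts H = (\<Union>i\<in>{1..k}. V i)"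
    using par by (simp_all add: partite_def)
  have "card S = k - 1"
    using inj_on_transversal[OF dis x, of "{1..k} - {i}"] i by (simp add: S_def card_image)
  moreover have "S \<inter> V i = {}" using transversal_inter_class[OF dis x _ i, of "{1..k} - {i}"] by (simp add: S_def)
  moreover have "crossing k H V S"
    unfolding crossing_def
  proof (intro conjI ballI)
    show "S \<subseteq> verts H" using x unfolding ver S_def by blast
    fix j assume "j \<in> {1..k}"
    then show "card (S \<inter> V j) \<le> 1" using transversal_inter_class[OF dis x, of "{1..k} - {i}" j] by (simp add: S_def)
  qed
  ultimately have "S \<in> {S. crossing k H V S \<and> card S = k - 1 \<and> S \<inter> V i = {}}" by simp
  moreover have "finite {S. crossing k H V S \<and> card S = k - 1 \<and> S \<inter> V i = {}}"
    by (rule finite_subset[of _ "Pow (verts H)"]) (use uni in \<open>auto simp: crossing_def uniform_hypergraph_def\<close>)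
  ultimately have "min_codegree k H V i \<le> deg H S" unfolding min_codegree_def by (intro Min_le) auto
  then show ?thesis using deg_transversal[OF uni par i x] by (simp add: S_def)
qed

lemma card_le_matching_number:
  assumes "uniform_hypergraph k H" "matching H M"
  shows "card M \<le> matching_number H"
proof -
  have "finite (edges H)"
    by (rule finite_subset[of _ "Pow (verts H)"]) (use assms(1) in \<open>auto simp: uniform_hypergraph_def\<close>)
  then have "finite (Pow (edges H))" by simp
  then have "finite {M. matching H M}"
    by (rule finite_subset[rotated]) (auto simp: matching_def)
  then show ?thesis using assms(2) unfolding matching_number_def by (intro Max_ge) auto
qed

text \<open>Disjoint classes turn distinct rows into disjoint edges, and these are different sets
  because \<open>K\<close> is nonempty.\<close>

lemma (in kpartite_system) edge_rows_le_matching_number: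
  fixes H :: "'v hypergraph"
  assumes uni: "uniform_hypergraph k H" and ed: "ed = (\<lambda>x. x ` K \<in> edges H)"
    and dis: "disjoint_family_on V K" and ne: "K \<noteq> {}" and X: "arr X"
  shows "card (edge_rows X) \<le> matching_number H"
proof -
  define M where "M = (\<lambda>r. X r ` K) ` edge_rows X"
  have disj: "disjnt (X r ` K) (X s ` K)" if "r \<in> edge_rows X" "s \<in> edge_rows X" "r \<noteq> s" for r s
    unfolding disjnt_def
  proof (rule ccontr)
    assume "X r ` K \<inter> X s ` K \<noteq> {}"
    then obtain v where "v \<in> X r ` K" "v \<in> X s ` K" by blast
    then obtain p q where pq: "p \<in> K" "q \<in> K" "X r p = X s q" by (auto simp: image_iff)
    have "X r p \<in> V p" "X s q \<in> V q" using arr_mem[OF X] pq(1,2) rows_less(1) that by auto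
    then have "p = q" using dis pq unfolding disjoint_family_on_def by fastforce
    then show False using arr_inj[OF X pq(1)] pq(3) rows_less(1) that by blast
  qed
  have "inj_on (\<lambda>r. X r ` K) (edge_rows X)"
  proof (rule inj_onI, rule ccontr)
    fix r s assume "r \<in> edge_rows X" "s \<in> edge_rows X" "X r ` K = X s ` K" "r \<noteq> s"
    then show False using disj[of r s] ne by (simp add: disjnt_def)
  qed
  then have "card M = card (edge_rows X)" by (simp add: M_def card_image)
  moreover have "matching H M"
    unfolding matching_def M_def
  proof
    show "(\<lambda>r. X r ` K) ` edge_rows X \<subseteq> edges H" unfolding edge_rows_def by (auto simp: ed)
    show "pairwise disjnt ((\<lambda>r. X r ` K) ` edge_rows X)"
      unfolding pairwise_def using disj by blast
  qed
  ultimately show ?thesis using card_le_matching_number[OF uni] by metis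
qed

theorem theorem1p2:
  fixes k :: nat
  assumes "k \<ge> 3"
  shows "\<exists>n0 :: nat. \<forall>(H :: 'v hypergraph) (V :: nat \<Rightarrow> 'v set) (n :: nat) (a :: nat \<Rightarrow> nat).
           n \<ge> n0 \<longrightarrow>
           uniform_hypergraph k H \<longrightarrow>
           partite k H V \<longrightarrow>
           (\<forall>i\<in>{1..k}. card (V i) = n) \<longrightarrow>
           (\<forall>i\<in>{1..k}. min_codegree k H V i \<ge> a i) \<longrightarrow>
           matching_number H \<ge> min (n - 1) (\<Sum>i=1..k. a i)"
proof -
  define C where "C = gap k"
  define N where "N = 2 * C ^ (k + 1)"
  define T where "T = 16 * N ^ 5 * k"
  have "0 < C" by (auto simp: C_def gap_def Let_def)
  then have N: "0 < N" by (simp add: N_def)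
  have "0 < T" using N assms by (simp add: T_def)
  have "0 < real N ^ 5" "1 \<le> real N ^ 5" using N by (auto intro: one_le_power)
  then have "0 < 4 * real N ^ 5" "1 < 4 * real N ^ 5" by linarith+
  then have r: "0 < 1 - 1 / (4 * real N ^ 5)" "1 - 1 / (4 * real N ^ 5) < 1" by (simp_all add: divide_simps)
  obtain n1 where n1: "\<And>n. n1 \<le> n \<Longrightarrow>
      real (n ^ (2 * k)) * (1 - 1 / (4 * real N ^ 5)) ^ (n div T) < (1 / 2) ^ (2 * k)"
    using poly_times_geometric_small[OF r \<open>0 < T\<close>, of "(1 / 2) ^ (2 * k)" "2 * k"] by auto
  \<comment> \<open>The sum of all thresholds of \<open>arrangement_bound\<close>;
    \<open>Suc\<close> provides \<open>0 < n\<close> and the strict inequality among them.\<close>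
  define n0 where "n0 = Suc (n1 + C ^ (k + 1) + 4 * N ^ 5 * k + 2 * ((4 * k + 6) * k + 2 * k))"
  show ?thesis
  proof (intro exI[of _ n0] allI impI)
    fix H :: "'v hypergraph" and V :: "nat \<Rightarrow> 'v set" and n :: nat and a :: "nat \<Rightarrow> nat"
    assume n: "n0 \<le> n" and uni: "uniform_hypergraph k H" and par: "partite k H V"
      and cV: "\<forall>i\<in>{1..k}. card (V i) = n" and co: "\<forall>i\<in>{1..k}. a i \<le> min_codegree k H V i"
    have npos: "0 < n" using n by (simp add: n0_def)
    obtain b where b: "\<forall>i\<in>{1..k}. b i \<le> a i" "sum b {1..k} = min (n - 1) (sum a {1..k})"
      using exists_dominated_sum[of "{1..k}" "min (n - 1) (sum a {1..k})" a] by auto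
    interpret kpartite_system "{1..k}" n V "\<lambda>x. x ` {1..k} \<in> edges H" b
    proof
      show "finite (V p) \<and> card (V p) = n" if "p \<in> {1..k}" for p
        using cV that npos card_ge_0_finite by metis
      show "(x ` {1..k} \<in> edges H) = (y ` {1..k} \<in> edges H)" if "\<And>p. p \<in> {1..k} \<Longrightarrow> x p = y p" for x y
      proof -
        have "x ` {1..k} = y ` {1..k}" by (intro image_cong refl that)
        then show ?thesis by simp
      qed
      show "b i \<le> card {v \<in> V i. (x(i := v)) ` {1..k} \<in> edges H}"
        if "i \<in> {1..k}" "\<And>p. p \<in> {1..k} - {i} \<Longrightarrow> x p \<in> V p" for i x
        using min_codegree_le[OF uni par that] co b(1) that(1) le_trans by meson
    qed simp
    have "\<exists>X. arr X \<and> sum b {1..k} \<le> card (edge_rows X)"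
      by (rule arrangement_bound[of C N T])
        (use assms n npos b(2) n1[of n] in \<open>auto simp: n0_def C_def N_def T_def\<close>)
    then obtain X where X: "arr X" "sum b {1..k} \<le> card (edge_rows X)" by blast
    have "card (edge_rows X) \<le> matching_number H"
      using par assms by (intro edge_rows_le_matching_number[OF uni _ _ _ X(1)]) (auto simp: partite_def)
    then show "min (n - 1) (\<Sum>i=1..k. a i) \<le> matching_number H" using X(2) b(2) by linarith
  qed
qed

end
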